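(* Let $L^*\in\mathcal S_{[N]}^{++}$ be irreducible, let $Z_1,Z_2,\dots$ be i.i.d. with distribution $\mathsf{DPP}(L^* )$, and for each $n$ let $\hat L=\hat L_n\in\mathcal S_{[N]}^{++}$ be a maximum likelihood estimator of $L^*$ based on $Z_1,\dots,Z_n$. Let $\hat D\in\mathcal D$ be such that $\|\hat D\hat L\hat D-L^*\|_F=\min_{D\in\mathcal D}\|D\hat LD-L^*\|_F$ and set $\tilde L=\hat D\hat L\hat D$. Then $\tilde L$ is asymptotically normal with asymptotic covariance operator $V(L^* )$: $$\sqrt n\,(\tilde L-L^* )\longrightarrow\mathcal N_{\mathcal S_{[N]}}\big(0,V(L^* )\big)\quad\text{in distribution as } n\to\infty.$$
   Context: Fix a positive integer $N$ (not depending on $n$) and let $[N]=\{1,\dots,N\}$. $\mathcal S_{[N]}$ is the space of real symmetric $N\times N$ matrices, $\mathcal S_{[N]}^{++}$ is the (open) subset of positive definite ones, and $\|\cdot\|_F$ is the Frobenius norm. For an $N\times N$ matrix $A$ and $J\subseteq[N]$, $A_J$ is the restriction of $A$ to $J\times J$; convention: $\det A_\emptyset=1$. $\mathcal D$ is the set of $N\times N$ diagonal matrices with diagonal entries in $\{-1,1\}$. For $L\in\mathcal S_{[N]}^{++}$, $\mathsf{DPP}(L)$ is the probability distribution on subsets of $[N]$ given by $p_J(L)=\mathbb P[Z=J]=\det(L_J)/\det(I+L)$, $J\subseteq[N]$. Given $Z_1,\dots,Z_n$, the (scaled) log-likelihood is $\hat\Phi(L)=\frac1n\sum_{i=1}^n\log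 p_{Z_i}(L)$, $L\in\mathcal S_{[N]}^{++}$. A maximum likelihood estimator (MLE) $\hat L$ is any (measurable, $\mathcal S_{[N]}^{++}$-valued) maximizer of $\hat\Phi$ over $\mathcal S_{[N]}^{++}$ (maximizers are in general not unique); on the event that $\hat\Phi$ has no maximizer in $\mathcal S_{[N]}^{++}$, $\hat L$ may take an arbitrary value. The matrix $\hat D$ is chosen measurably. The expected log-likelihood is $\Phi(L)=\sum_{J\subseteq[N]}p_J(L^* )\log\det(L_J)-\log\det(I+L)$, $L\in\mathcal S_{[N]}^{++}$, and $\mathrm d^2\Phi(L^* )$ is its second derivative (Hessian) at $L^*$, a bilinear form on $\mathcal S_{[N]}$. A matrix $L\in\mathcal S_{[N]}^{++}$ is irreducible if there is no partition of $[N]$ into at least two nonempty sets such that $L_{i,j}=0$ whenever $i,j$ lie in different sets. When $L^*$ is irreducible, $-\mathrm d^2\Phi(L^* )$ is positive definite, and $V(L^* )$ denotes its inverse: if $T$ is the linear operator on $\mathcal S_{[N]}$, self-adjoint for the inner product $(A,B)\mapsto\mathrm{Tr}(AB)$, with $-\mathrm d^2\Phi(L^* )(H,H')=\mathrm{Tr}(H\,T(H'))$ for all $H,H'\in\mathcal S_{[N]}$, then $V(L^* )(H,H')=\mathrm{Tr}(H\,T^{-1}(H'))$. For $M\in\mathcal S_{[N]}$ and a symmetric positive definite bilinear form $\Sigma$ on $\mathcal S_{[N]}$, $\mathcal N_{\mathcal S_{[N]}}(M,\Sigma)$ is the distribution of a random matrix $A\in\mathcal S_{[N]}$ such that for every $H\in\mathcal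 S_{[N]}$, $\mathrm{Tr}(AH)$ is Gaussian with mean $\mathrm{Tr}(MH)$ and variance $\Sigma(H,H)$. *)

theory Defs
  imports "HOL-Probability.Probability"
begin

text \<open>
  Throughout, the index set is a finite type \<open>'n\<close>. On \<open>real ^ 'n ^ 'n\<close> the library's
  \<open>norm\<close> is the Frobenius norm.
\<close>

definition sym_mats :: "(real ^ 'n ^ 'n) set" where
  "sym_mats = {A. transpose A = A}"

definition pd_mats :: "(real ^ 'n ^ 'n) set" where
  "pd_mats = {A. transpose A = A \<and> (\<forall>x. x \<noteq> 0 \<longrightarrow> x \<bullet> (A *v x) > 0)}"

definition sign_mats :: "(real ^ 'n ^ 'n) set" where
  "sign_mats = {D. \<forall>i j. if i = j then D $ i $ j \<in> {-1, 1} else D $ i $ j = 0}"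

text \<open>
  The determinant of the restriction of \<open>A\<close> to \<open>J \<times> J\<close>. The index set varies, so the library's
  \<open>det\<close>, whose index set is a type, does not apply; this is its defining formula with
  \<open>UNIV\<close> replaced by \<open>J\<close>.
\<close>

definition principal_minor :: "real ^ 'n ^ 'n \<Rightarrow> 'n set \<Rightarrow> real" where
  "principal_minor A J = (\<Sum>p | p permutes J. of_int (sign p) * (\<Prod>i\<in>J. A $ i $ p i))"

lemma principal_minor_UNIV: "principal_minor A UNIV = det A"
  by (simp add: principal_minor_def det_def)

lemma principal_minor_empty: "principal_minor A {} = 1"
  by (simp add: principal_minor_def)

definition irreducible_mat :: "real ^ 'n ^ 'n \<Rightarrow> bool" where
  "irreducible_mat L \<longleftrightarrow>
     \<not> (\<exists>P. partition_on UNIV P \<and> card P \<ge> 2 \<and>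
          (\<forall>A\<in>P. \<forall>B\<in>P. A \<noteq> B \<longrightarrow> (\<forall>i\<in>A. \<forall>j\<in>B. L $ i $ j = 0)))"

definition dpp_prob :: "real ^ 'n ^ 'n \<Rightarrow> 'n set \<Rightarrow> real" where
  "dpp_prob L J = principal_minor L J / det (mat 1 + L)"

definition DPP :: "real ^ 'n ^ 'n \<Rightarrow> 'n set measure" where
  "DPP L = density (count_space UNIV) (\<lambda>J. ennreal (dpp_prob L J))"

text \<open>The sample is \<open>z 0, \<dots>, z (n - 1)\<close>.\<close>

definition log_likelihood :: "nat \<Rightarrow> (nat \<Rightarrow> 'n set) \<Rightarrow> real ^ 'n ^ 'n \<Rightarrow> real" where
  "log_likelihood n z L = (1 / real n) * (\<Sum>i<n. ln (dpp_prob L (z i)))"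

definition is_max_likelihood ::
    "nat \<Rightarrow> (nat \<Rightarrow> 'n set) \<Rightarrow> real ^ 'n ^ 'n \<Rightarrow> bool" where
  "is_max_likelihood n z = is_arg_max (log_likelihood n z) (\<lambda>L. L \<in> pd_mats)"

definition is_MLE ::
    "'a measure \<Rightarrow> (nat \<Rightarrow> 'a \<Rightarrow> 'n set) \<Rightarrow> nat \<Rightarrow> ('a \<Rightarrow> real ^ 'n ^ 'n) \<Rightarrow> bool" where
  "is_MLE M Z n Lhat \<longleftrightarrow>
     Lhat \<in> borel_measurable M \<and>
     (\<forall>\<omega>\<in>space M. Lhat \<omega> \<in> pd_mats \<and>
        ((\<exists>L. is_max_likelihood n (\<lambda>i. Z i \<omega>) L) \<longrightarrow>
           is_max_likelihood n (\<lambda>i. Z i \<omega>) (Lhat \<omega>)))"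

definition expected_log_likelihood :: "real ^ 'n ^ 'n \<Rightarrow> real ^ 'n ^ 'n \<Rightarrow> real" where
  "expected_log_likelihood Lstar L =
     (\<Sum>J\<in>UNIV. dpp_prob Lstar J * ln (principal_minor L J)) - ln (det (mat 1 + L))"

text \<open>
  Second derivative of \<open>f\<close> on \<open>S\<close> at \<open>x\<close>, in directions \<open>u\<close> and \<open>v\<close>. Below, \<open>S\<close> is
  \<open>pd_mats\<close>, which is relatively open in the subspace \<open>sym_mats\<close> but has empty interior
  in \<open>real ^ 'n ^ 'n\<close> in general; hence the derivatives are determined only
  in the directions \<open>u, v \<in> sym_mats\<close>, and only those are used.
\<close>

definition second_derivative_within ::
    "('v::real_normed_vector \<Rightarrow> real) \<Rightarrow> 'v set \<Rightarrow> 'v \<Rightarrow> 'v \<Rightarrow> 'v \<Rightarrow> real" where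
  "second_derivative_within f S x u v =
     frechet_derivative (\<lambda>y. frechet_derivative f (at y within S) v) (at x within S) u"

definition information_form ::
    "real ^ 'n ^ 'n \<Rightarrow> real ^ 'n ^ 'n \<Rightarrow> real ^ 'n ^ 'n \<Rightarrow> real" where
  "information_form Lstar H H' =
     - second_derivative_within (expected_log_likelihood Lstar) pd_mats Lstar H H'"

text \<open>
  \<open>T\<close> represents the form \<open>B\<close> on \<open>sym_mats\<close> for the trace inner product. This determines \<open>T\<close>
  on \<open>sym_mats\<close>; its values elsewhere are irrelevant.
\<close>

definition represents_form ::
    "(real ^ 'n ^ 'n \<Rightarrow> real ^ 'n ^ 'n) \<Rightarrow>
     (real ^ 'n ^ 'n \<Rightarrow> real ^ 'n ^ 'n \<Rightarrow> real) \<Rightarrow> bool" where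
  "represents_form T B \<longleftrightarrow>
     linear T \<and> T ` sym_mats \<subseteq> sym_mats \<and>
     (\<forall>H\<in>sym_mats. \<forall>H'\<in>sym_mats. trace (H ** T H') = trace (T H ** H')) \<and>
     (\<forall>H\<in>sym_mats. \<forall>H'\<in>sym_mats. B H H' = trace (H ** T H'))"

definition inverse_form ::
    "(real ^ 'n ^ 'n \<Rightarrow> real ^ 'n ^ 'n \<Rightarrow> real) \<Rightarrow>
     real ^ 'n ^ 'n \<Rightarrow> real ^ 'n ^ 'n \<Rightarrow> real" where
  "inverse_form B H H' =
     trace (H ** inv_into sym_mats (SOME T. represents_form T B) H')"

definition asymptotic_covariance ::
    "real ^ 'n ^ 'n \<Rightarrow> real ^ 'n ^ 'n \<Rightarrow> real ^ 'n ^ 'n \<Rightarrow> real" where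
  "asymptotic_covariance Lstar = inverse_form (information_form Lstar)"

definition pos_def_form_on_sym ::
    "(real ^ 'n ^ 'n \<Rightarrow> real ^ 'n ^ 'n \<Rightarrow> real) \<Rightarrow> bool" where
  "pos_def_form_on_sym B \<longleftrightarrow>
     (\<forall>H\<in>sym_mats. \<forall>H'\<in>sym_mats. B H H' = B H' H) \<and>
     (\<forall>H\<in>sym_mats. \<forall>K\<in>sym_mats. \<forall>H'\<in>sym_mats. B (H + K) H' = B H H' + B K H') \<and>
     (\<forall>c. \<forall>H\<in>sym_mats. \<forall>H'\<in>sym_mats. B (c *\<^sub>R H) H' = c * B H H') \<and>
     (\<forall>H\<in>sym_mats. H \<noteq> 0 \<longrightarrow> B H H > 0)"

text \<open>The variance is \<open>v \<ge> 0\<close>; the degenerate case \<open>v = 0\<close> is a point mass.\<close>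

definition gaussian_law :: "real \<Rightarrow> real \<Rightarrow> real measure" where
  "gaussian_law m v =
     (if v = 0 then return borel m
      else density lborel (\<lambda>x. ennreal (normal_density m (sqrt v) x)))"

text \<open>
  A Gaussian law on \<open>sym_mats\<close> is regarded as a Borel measure on all matrices, carried by \<open>sym_mats\<close>.
  It is determined by the laws of its linear functionals.
\<close>

definition is_sym_normal ::
    "real ^ 'n ^ 'n \<Rightarrow> (real ^ 'n ^ 'n \<Rightarrow> real ^ 'n ^ 'n \<Rightarrow> real) \<Rightarrow>
     (real ^ 'n ^ 'n) measure \<Rightarrow> bool" where
  "is_sym_normal A0 \<Sigma> \<mu> \<longleftrightarrow>
     A0 \<in> sym_mats \<and> pos_def_form_on_sym \<Sigma> \<and>
     prob_space \<mu> \<and> sets \<mu> = sets borel \<and> (AE A in \<mu>. A \<in> sym_mats) \<and>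
     (\<forall>H\<in>sym_mats.
        distr \<mu> borel (\<lambda>A. trace (A ** H)) = gaussian_law (trace (A0 ** H)) (\<Sigma> H H))"

text \<open>The library's \<open>weak_conv_m\<close> covers only laws on the real line.\<close>

definition converges_in_distribution ::
    "'a measure \<Rightarrow> (nat \<Rightarrow> 'a \<Rightarrow> 'b::metric_space) \<Rightarrow> 'b measure \<Rightarrow> bool" where
  "converges_in_distribution M X \<mu> \<longleftrightarrow>
     (\<forall>f :: 'b \<Rightarrow> real. continuous_on UNIV f \<and> bounded (range f) \<longrightarrow>
        (\<lambda>n. \<integral>\<omega>. f (X n \<omega>) \<partial>M) \<longlonglongrightarrow> (\<integral>x. f x \<partial>\<mu>))"

end

(*
  All data enter through the empirical frequency vector q of the sample, and the maximum likelihood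
  estimator maximizes sum_J q_J log p_J(L).

  Consistency. If q is close to q0 = p(L0), L0 the true matrix, then q charges both the empty set
  and [N], which confines near-maximizers to a compact set of positive definite matrices; there the
  strict Gibbs inequality and identifiability (principal minors determine an irreducible L up to a sign conjugation) force
  them to be close to some D L0 D. Identifiability and non-degeneracy of the Fisher information both
  follow from one computation: along a minimal walk in the graph of L, closed up by one further edge,
  flipping the sign of the closing edge changes the principal minor by a nonzero amount.

  Rate. With the score s_J = grad log p_J, the score equation reads sum_J (q_J - p_J(L)) s_J(L) = 0,
  so the estimator is differentiable in q at q0, with derivative I^-1 sum_J (q_J - q0_J) s_J(L0).

  Limit law. By the Cramer-Wold device and the one-dimensional central limit theorem, the integrals of
  cos (t . x + c) converge; trigonometric polynomials then approximate every bounded continuous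
  function up to tails.
*)
theory Submission
  imports Defs
begin

section \<open>Convergence in distribution in Euclidean spaces\<close>

text \<open>The statistical part is deterministic in q and uniform on a ball around q0: for every
  \<open>\<epsilon>\<close> there is a radius within which a maximizer exists and every maximizer,
  once aligned by the best sign matrix, differs from \<open>Lstar + influence q\<close> by at most
  \<open>\<epsilon> * norm (q - qstar)\<close>. Probability enters by Chebyshev's inequality for
  centred indicator vectors, used twice: to put q into that ball, and to turn the
  \<open>\<epsilon>\<close> bound into a remainder that vanishes after scaling by sqrt n. Maximizers
  come in orbits of sign conjugation, on which all p_J are constant. The aligned matrix therefore
  maximizes the same function, and its score equation can be expanded at the matrix itself, close to
  \<open>Lstar\<close>. The coefficients q_J - p_J(L) are small near the truth, so continuity of the
  scores takes the place of a second-order expansion. Positive definite matrices have empty interior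
  among all matrices as soon as there are two indices. Derivatives are therefore taken along
  symmetric directions, and gradients are projected to symmetric matrices.\<close>

inductive trig_poly :: "('b::euclidean_space \<Rightarrow> real) \<Rightarrow> bool" where
  wave: "trig_poly (\<lambda>x. w * cos (t \<bullet> x + c))"
| add: "trig_poly f \<Longrightarrow> trig_poly g \<Longrightarrow> trig_poly (\<lambda>x. f x + g x)"

lemma trig_poly_const: "trig_poly (\<lambda>x::'b::euclidean_space. c)"
  using trig_poly.wave[of c 0 0] by simp

lemma trig_poly_sum:
  assumes "finite A" "\<And>a. a \<in> A \<Longrightarrow> trig_poly (f a)"
  shows "trig_poly (\<lambda>x::'b::euclidean_space. \<Sum>a\<in>A. f a x)"
  using assms
proof (induction A rule: finite_induct)
  case empty
  then show ?case using trig_poly_const[of 0] by simp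
next
  case (insert a A)
  then show ?case using trig_poly.add[of "f a"] by simp
qed

text \<open>The product-to-sum formula gives waves at the sum and the difference of the frequencies.
  The free phase \<open>c\<close> in \<open>trig_poly.wave\<close> keeps the class closed under this
  and makes sines waves as well.\<close>

lemma trig_poly_mult:
  fixes f g :: "'b::euclidean_space \<Rightarrow> real"
  assumes "trig_poly f" "trig_poly g"
  shows "trig_poly (\<lambda>x. f x * g x)"
  using assms(1)
proof induction
  case (wave w t c)
  show ?case using assms(2)
  proof induction
    case (wave w' t' c')
    have "w * cos (t \<bullet> x + c) * (w' * cos (t' \<bullet> x + c')) =
        (w * w' / 2) * cos ((t - t') \<bullet> x + (c - c')) + (w * w' / 2) * cos ((t + t') \<bullet> x + (c + c'))" for x
    proof -
      have "cos (t \<bullet> x + c) * cos (t' \<bullet> x + c') =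
        (cos ((t - t') \<bullet> x + (c - c')) + cos ((t + t') \<bullet> x + (c + c'))) / 2"
      proof -
        have "(t - t') \<bullet> x + (c - c') = (t \<bullet> x + c) - (t' \<bullet> x + c')"
          "(t + t') \<bullet> x + (c + c') = (t \<bullet> x + c) + (t' \<bullet> x + c')"
          by (simp_all add: inner_left_distrib inner_diff_left)
        then show ?thesis by (simp only: cos_times_cos)
      qed
      then show ?thesis by (simp add: field_simps)
    qed
    then show ?case
      using trig_poly.add[OF trig_poly.wave[of "w * w' / 2" "t - t'" "c - c'"]
          trig_poly.wave[of "w * w' / 2" "t + t'" "c + c'"]] by simp
  next
    case (add f g)
    then show ?case using trig_poly.add by (simp add: distrib_left)
  qed
next
  case (add f1 f2)
  then show ?case using trig_poly.add by (simp add: distrib_right)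
qed

text \<open>A linear functional of the vector of sines is a sum of waves, a sine being a cosine with
  phase -pi/2; sums and products of such functions stay in the class.\<close>

lemma trig_poly_polynomial_sin:
  fixes P :: "'b::euclidean_space \<Rightarrow> real"
  assumes "real_polynomial_function P"
  shows "trig_poly (\<lambda>x. P (\<Sum>b\<in>Basis. sin (a * (x \<bullet> b)) *\<^sub>R b))"
  using assms
proof induction
  case (linear h)
  then interpret bounded_linear h .
  have "h (\<Sum>b\<in>Basis. sin (a * (x \<bullet> b)) *\<^sub>R b) = (\<Sum>b\<in>Basis. h b * cos ((a *\<^sub>R b) \<bullet> x + - (pi/2)))" for x
    by (simp add: sum scaleR cos_diff inner_commute mult.commute)
  then show ?case
    using trig_poly_sum[OF finite_Basis trig_poly.wave, of h "\<lambda>b. a *\<^sub>R b" "\<lambda>_. -(pi/2)"] by simp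
qed (auto intro: trig_poly_const trig_poly.add trig_poly_mult)

lemma continuous_on_trig_poly: "trig_poly f \<Longrightarrow> continuous_on UNIV f"
  by (induction rule: trig_poly.induct) (auto intro!: continuous_intros)

lemma trig_poly_bounded: "trig_poly f \<Longrightarrow> \<exists>B. \<forall>x. \<bar>f x\<bar> \<le> B"
proof (induction rule: trig_poly.induct)
  case (wave w t c)
  have "\<bar>w * cos (t \<bullet> x + c)\<bar> \<le> \<bar>w\<bar>" for x
    by (simp add: abs_mult mult_left_le)
  then show ?case by blast
next
  case (add f g)
  then obtain B C where "\<forall>x. \<bar>f x\<bar> \<le> B" "\<forall>x. \<bar>g x\<bar> \<le> C" by blast
  then have "\<forall>x. \<bar>f x + g x\<bar> \<le> B + C" by (meson abs_triangle_ineq add_mono order_trans)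
  then show ?case by blast
qed

text \<open>On the ball \<open>x\<close> is recovered from the vector of the \<open>sin (a * x\<^sub>b)\<close> by \<open>arcsin\<close>, and that vector
  never leaves the unit cube, so the Stone--Weierstrass polynomial stays bounded globally.\<close>
lemma trig_poly_approx:
  fixes f :: "'b::euclidean_space \<Rightarrow> real"
  assumes f: "continuous_on UNIV f" and B: "\<And>x. \<bar>f x\<bar> \<le> B" and e: "0 < e" and R: "0 < R"
  obtains g where "trig_poly g" "\<And>x. norm x \<le> R \<Longrightarrow> \<bar>f x - g x\<bar> < e" "\<And>x. \<bar>g x\<bar> \<le> B + e"
proof -
  \<comment> \<open>This scale sends the ball of radius \<open>R\<close> to arguments in
    [-pi/2, pi/2], where arcsin inverts sin.\<close>
  define a where "a = pi / (2 * R)"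
  have a: "a > 0" using R by (simp add: a_def)
  define \<phi> where "\<phi> = (\<lambda>x::'b. \<Sum>b\<in>Basis. sin (a * (x \<bullet> b)) *\<^sub>R b)"
  define F where "F = (\<lambda>y::'b. f (\<Sum>b\<in>Basis. (arcsin (y \<bullet> b) / a) *\<^sub>R b))"
  have cube: "y \<in> cbox (- One) One \<longleftrightarrow> (\<forall>b\<in>Basis. -1 \<le> y \<bullet> b \<and> y \<bullet> b \<le> 1)" for y :: 'b
    by (simp add: mem_box)
  have "continuous_on (cbox (- One) One) F"
    unfolding F_def
    by (rule continuous_on_compose2[OF f])
      (use a in \<open>auto intro!: continuous_intros simp: cube\<close>)
  then obtain P where P: "real_polynomial_function P" "\<And>y. y \<in> cbox (- One) One \<Longrightarrow> \<bar>F y - P y\<bar> < e"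
    using Stone_Weierstrass_real_polynomial_function[of "cbox (- One) One" F e] e by auto
  have \<phi>: "\<phi> x \<in> cbox (- One) One" for x
    by (simp add: cube \<phi>_def)
  show ?thesis
  proof (rule that[of "P \<circ> \<phi>"])
    show "trig_poly (P \<circ> \<phi>)"
      unfolding comp_def \<phi>_def by (rule trig_poly_polynomial_sin[OF P(1)])
    show "\<bar>(P \<circ> \<phi>) x\<bar> \<le> B + e" for x
      using P(2)[OF \<phi>[of x]] B[of "\<Sum>b\<in>Basis. (arcsin (\<phi> x \<bullet> b) / a) *\<^sub>R b"]
      by (auto simp: F_def)
    fix x :: 'b assume x: "norm x \<le> R"
    have "arcsin (\<phi> x \<bullet> b) / a = x \<bullet> b" if b: "b \<in> Basis" for b
    proof -
      have "\<bar>x \<bullet> b\<bar> \<le> R" using Basis_le_norm[OF b, of x] x by simp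
      then have "\<bar>a * (x \<bullet> b)\<bar> \<le> a * R" using a by (simp add: abs_mult)
      also have "a * R = pi / 2" using R by (simp add: a_def)
      finally have "arcsin (sin (a * (x \<bullet> b))) = a * (x \<bullet> b)" by (intro arcsin_sin) auto
      moreover have "\<phi> x \<bullet> b = sin (a * (x \<bullet> b))" using b by (simp add: \<phi>_def)
      ultimately show ?thesis using a by simp
    qed
    then have "F (\<phi> x) = f x" by (simp add: F_def euclidean_representation)
    then show "\<bar>f x - (P \<circ> \<phi>) x\<bar> < e" using P(2)[OF \<phi>[of x]] by simp
  qed
qed

text \<open>Inside the ball the integrands are \<open>e\<close>-close; outside, the two sup bounds
  are paid for by the tail probability.\<close>

lemma (in prob_space) integral_diff_bound:
  fixes Y :: "'a \<Rightarrow> 'b::euclidean_space"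
  assumes Y[measurable]: "Y \<in> borel_measurable M"
    and f: "continuous_on UNIV f" and g: "continuous_on UNIV g"
    and close: "\<And>x. norm x \<le> R \<Longrightarrow> \<bar>f x - g x\<bar> \<le> e"
    and bf: "\<And>x. \<bar>f x\<bar> \<le> B" and bg: "\<And>x. \<bar>g x\<bar> \<le> C" and e: "0 \<le> e"
  shows "\<bar>expectation (\<lambda>\<omega>. f (Y \<omega>)) - expectation (\<lambda>\<omega>. g (Y \<omega>))\<bar>
      \<le> e + (B + C) * prob {\<omega>\<in>space M. norm (Y \<omega>) > R}"
proof -
  have [measurable]: "f \<in> borel_measurable borel" "g \<in> borel_measurable borel"
    using f g by (auto intro: borel_measurable_continuous_onI)
  have i: "integrable M (\<lambda>\<omega>. f (Y \<omega>))" "integrable M (\<lambda>\<omega>. g (Y \<omega>))"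
    using bf bg by (auto intro!: integrable_const_bound[where f="\<lambda>\<omega>. f (Y \<omega>)" and B=B]
        integrable_const_bound[where f="\<lambda>\<omega>. g (Y \<omega>)" and B=C])
  have BC: "0 \<le> B + C" using bf[of 0] bg[of 0] by linarith
  let ?A = "{\<omega>\<in>space M. norm (Y \<omega>) > R}"
  have A[measurable]: "?A \<in> events" by measurable
  have iA: "integrable M (\<lambda>\<omega>. e + (B + C) * indicator ?A \<omega>)"
    by (intro Bochner_Integration.integrable_add integrable_mult_right integrable_real_indicator) (auto simp: emeasure_eq_measure)
  have "\<bar>expectation (\<lambda>\<omega>. f (Y \<omega>)) - expectation (\<lambda>\<omega>. g (Y \<omega>))\<bar> = \<bar>expectation (\<lambda>\<omega>. f (Y \<omega>) - g (Y \<omega>))\<bar>"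
    using i by simp
  also have "\<dots> \<le> expectation (\<lambda>\<omega>. \<bar>f (Y \<omega>) - g (Y \<omega>)\<bar>)"
    by (rule integral_abs_bound)
  also have "\<dots> \<le> expectation (\<lambda>\<omega>. e + (B + C) * indicator ?A \<omega>)"
  proof (rule integral_mono)
    show "integrable M (\<lambda>\<omega>. \<bar>f (Y \<omega>) - g (Y \<omega>)\<bar>)" using i by auto
    fix \<omega> assume w: "\<omega> \<in> space M"
    show "\<bar>f (Y \<omega>) - g (Y \<omega>)\<bar> \<le> e + (B + C) * indicator ?A \<omega>"
    proof (cases "norm (Y \<omega>) \<le> R")
      case True
      then show ?thesis using close[OF True] by (simp add: indicator_def)
    next
      case False
      then show ?thesis using w e bf[of "Y \<omega>"] bg[of "Y \<omega>"] by (simp add: indicator_def)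
    qed
  qed (rule iA)
  also have "\<dots> = e + (B + C) * prob ?A"
    using A by (subst Bochner_Integration.integral_add) (auto simp: prob_space emeasure_eq_measure)
  finally show ?thesis .
qed

text \<open>Continuity from above: along integer radii the tail events decrease to the empty
  set.\<close>

lemma (in prob_space) tail_prob_small:
  fixes Y :: "'a \<Rightarrow> 'b::euclidean_space"
  assumes [measurable]: "Y \<in> borel_measurable M" and e: "0 < e"
  shows "\<exists>R. prob {\<omega>\<in>space M. norm (Y \<omega>) > R} \<le> e"
proof -
  let ?A = "\<lambda>n::nat. {\<omega>\<in>space M. norm (Y \<omega>) > real n}"
  have "(\<lambda>n. prob (?A n)) \<longlonglongrightarrow> prob (\<Inter>n. ?A n)"
    by (rule finite_Lim_measure_decseq) (auto simp: decseq_def)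
  moreover have "(\<Inter>n. ?A n) = {}"
    using real_arch_simple by (fastforce simp: not_less[symmetric])
  ultimately have "(\<lambda>n. prob (?A n)) \<longlonglongrightarrow> 0" by simp
  then have "\<forall>\<^sub>F n in sequentially. prob (?A n) < e" using e by (simp add: order_tendstoD)
  then obtain n where "prob (?A n) < e" by (auto simp: eventually_sequentially)
  then show ?thesis using less_imp_le by blast
qed

text \<open>Cosines of arbitrary phase carry the information of characteristic functions, and
  linearity extends their convergence to all trigonometric polynomials. Such a polynomial is close
  to \<open>f\<close> only on a ball, but it stays bounded off the ball, so tightness controls the
  rest uniformly in \<open>n\<close>.\<close>

lemma (in prob_space) converges_in_distribution_cosI:
  fixes X :: "nat \<Rightarrow> 'a \<Rightarrow> 'b::euclidean_space"
  assumes \<mu>: "prob_space \<mu>" "sets \<mu> = sets borel"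
    and X: "\<forall>\<^sub>F n in sequentially. X n \<in> borel_measurable M"
    and tight: "\<And>e. 0 < e \<Longrightarrow> \<exists>R. \<forall>\<^sub>F n in sequentially. prob {\<omega>\<in>space M. norm (X n \<omega>) > R} \<le> e"
    and cos: "\<And>t c. (\<lambda>n. expectation (\<lambda>\<omega>. cos (t \<bullet> X n \<omega> + c))) \<longlonglongrightarrow> (\<integral>x. cos (t \<bullet> x + c) \<partial>\<mu>)"
  shows "converges_in_distribution M X \<mu>"
proof -
  interpret \<mu>: prob_space \<mu> by fact
  have [measurable_cong]: "sets \<mu> = sets borel" by fact
  have trig_int: "integrable M (\<lambda>\<omega>. g (X n \<omega>))" if g: "trig_poly g" and n: "X n \<in> borel_measurable M" for g n
  proof -
    obtain B where "\<forall>x. \<bar>g x\<bar> \<le> B" using trig_poly_bounded[OF g] by blast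
    moreover have "g \<in> borel_measurable borel" using continuous_on_trig_poly[OF g] by (rule borel_measurable_continuous_onI)
    ultimately show ?thesis using n by (auto intro!: integrable_const_bound[where B=B])
  qed
  have trig_int': "integrable \<mu> g" if g: "trig_poly g" for g
  proof -
    obtain B where "\<forall>x. \<bar>g x\<bar> \<le> B" using trig_poly_bounded[OF g] by blast
    moreover have "g \<in> borel_measurable borel" using continuous_on_trig_poly[OF g] by (rule borel_measurable_continuous_onI)
    ultimately show ?thesis by (auto intro!: \<mu>.integrable_const_bound[where B=B])
  qed
  have trig: "(\<lambda>n. expectation (\<lambda>\<omega>. g (X n \<omega>))) \<longlonglongrightarrow> (\<integral>x. g x \<partial>\<mu>)" if "trig_poly g" for g
    using that
  proof induction
    case (wave w t c)
    then show ?case using tendsto_mult_left[OF cos, of w t c] by simp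
  next
    case (add f g)
    have "\<forall>\<^sub>F n in sequentially. expectation (\<lambda>\<omega>. f (X n \<omega>)) + expectation (\<lambda>\<omega>. g (X n \<omega>)) = expectation (\<lambda>\<omega>. f (X n \<omega>) + g (X n \<omega>))"
      using X by eventually_elim (simp add: trig_int add.hyps)
    then show ?case
      using tendsto_add[OF add.IH] add.hyps by (simp add: trig_int' tendsto_cong)
  qed
  show ?thesis
    unfolding converges_in_distribution_def
  proof (intro allI impI)
    fix f :: "'b \<Rightarrow> real" assume "continuous_on UNIV f \<and> bounded (range f)"
    then obtain B where f: "continuous_on UNIV f" and B: "\<And>x. \<bar>f x\<bar> \<le> B" 
      by (auto simp: bounded_iff)
    have B0: "0 \<le> B" using B[of 0] by linarith
    show "(\<lambda>n. expectation (\<lambda>\<omega>. f (X n \<omega>))) \<longlonglongrightarrow> (\<integral>x. f x \<partial>\<mu>)"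
      unfolding tendsto_iff dist_real_def
    proof (intro allI impI)
      fix e :: real assume e: "0 < e"
      \<comment> \<open>The two replacements of \<open>f\<close> by \<open>g\<close> cost (2 * B +
        2) * d each and the convergence for \<open>g\<close> costs d, in total (4 * B + 5) * d. The
        bound \<open>d \<le> 1\<close> turns the constant B + (B + d) into 2 * B + 1.\<close>
      define d where "d = min 1 (e / (8 + 4 * B))"
      have d: "0 < d" "d \<le> 1" "d * (8 + 4 * B) \<le> e"
      proof -
        have "d \<le> e / (8 + 4 * B)" by (simp add: d_def)
        then show "d * (8 + 4 * B) \<le> e" using B0 by (simp add: pos_le_divide_eq)
      qed (use e B0 in \<open>auto simp: d_def\<close>)
      obtain R1 where R1: "\<forall>\<^sub>F n in sequentially. prob {\<omega>\<in>space M. norm (X n \<omega>) > R1} \<le> d" using tight[OF d(1)] by blast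
      obtain R2 where R2: "\<mu>.prob {x\<in>space \<mu>. norm x > R2} \<le> d" using \<mu>.tail_prob_small[of "\<lambda>x. x", OF _ d(1)] by auto
      define R where "R = max 1 (max R1 R2)"
      have R: "0 < R" by (simp add: R_def)
      obtain g where g: "trig_poly g" "\<And>x. norm x \<le> R \<Longrightarrow> \<bar>f x - g x\<bar> < d" "\<And>x. \<bar>g x\<bar> \<le> B + d"
        using trig_poly_approx[OF f B d(1) R] by blast
      have cg: "continuous_on UNIV g" by (rule continuous_on_trig_poly[OF g(1)])
      have close: "\<bar>f x - g x\<bar> \<le> d" if "norm x \<le> R" for x using g(2)[OF that] by simp
      have BB: "(B + (B + d)) * p \<le> (2 * B + 1) * d" if "p \<le> d" "0 \<le> p" for p
        using that d B0 by (intro mult_mono) auto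
      have 2: "\<bar>(\<integral>x. f x \<partial>\<mu>) - (\<integral>x. g x \<partial>\<mu>)\<bar> \<le> d + (2 * B + 1) * d"
      proof -
        have "\<mu>.prob {x\<in>space \<mu>. norm x > R} \<le> \<mu>.prob {x\<in>space \<mu>. norm x > R2}"
          by (rule \<mu>.finite_measure_mono) (auto simp: R_def)
        then have "\<mu>.prob {x\<in>space \<mu>. norm x > R} \<le> d" using R2 by simp
        from BB[OF this] show ?thesis
          using \<mu>.integral_diff_bound[of "\<lambda>x. x" f g R d B "B + d"] f cg close B g(3) d(1) by auto
      qed
      have "\<forall>\<^sub>F n in sequentially. \<bar>expectation (\<lambda>\<omega>. g (X n \<omega>)) - (\<integral>x. g x \<partial>\<mu>)\<bar> < d"
        using trig[OF g(1)] d(1) by (auto simp: tendsto_iff dist_real_def)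
      then show "\<forall>\<^sub>F n in sequentially. \<bar>expectation (\<lambda>\<omega>. f (X n \<omega>)) - (\<integral>x. f x \<partial>\<mu>)\<bar> < e"
        using R1 X
      proof eventually_elim
        case (elim n)
        note [measurable] = elim(3)
        have "prob {\<omega>\<in>space M. norm (X n \<omega>) > R} \<le> prob {\<omega>\<in>space M. norm (X n \<omega>) > R1}"
          by (rule finite_measure_mono) (auto simp: R_def)
        then have "prob {\<omega>\<in>space M. norm (X n \<omega>) > R} \<le> d" using elim by simp
        from BB[OF this] have "\<bar>expectation (\<lambda>\<omega>. f (X n \<omega>)) - expectation (\<lambda>\<omega>. g (X n \<omega>))\<bar> \<le> d + (2 * B + 1) * d"
          using integral_diff_bound[of "X n" f g R d B "B + d"] f cg close B g(3) d(1) by auto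
        then show ?case using 2 elim(1) d(1,3) by (simp add: algebra_simps)
      qed
    qed
  qed
qed

text \<open>One formula for both cases of \<open>gaussian_law\<close>: for \<open>v = 0\<close> the
  scaling collapses to the point mass. It lets limits produced by the central limit theorem, which
  are integrals against the standard normal law, be read as integrals against
  \<open>gaussian_law\<close>.\<close>

lemma gaussian_law_eq_distr:
  assumes "0 \<le> v"
  shows "gaussian_law 0 v = distr std_normal_distribution borel (\<lambda>y. sqrt v * y)"
proof (cases "v = 0")
  case True
  interpret prob_space std_normal_distribution by (rule prob_space_normal_density) simp
  show ?thesis using True by (simp add: gaussian_law_def)
next
  case False
  interpret prob_space std_normal_distribution by (rule prob_space_normal_density) simp
  have "distributed std_normal_distribution lborel (\<lambda>x. x) std_normal_density"
    by (auto simp: distributed_def distr_id2)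
  from normal_density_affine[OF this, of "sqrt v" 0] have
    "distributed std_normal_distribution lborel (\<lambda>x. sqrt v * x) (normal_density 0 (sqrt v))"
    using False assms by simp
  then have "distr std_normal_distribution lborel (\<lambda>x. sqrt v * x) = density lborel (normal_density 0 (sqrt v))"
    by (simp add: distributed_distr_eq_density)
  moreover have "distr std_normal_distribution lborel (\<lambda>x. sqrt v * x) = distr std_normal_distribution borel (\<lambda>x. sqrt v * x)"
    by (rule distr_cong) auto
  ultimately show ?thesis using False by (simp add: gaussian_law_def)
qed

text \<open>The vector is the combination of the \<open>a j\<close> with independent standard normal
  coefficients, so its inner product with \<open>t\<close> is a sum of independent centred normals
  with standard deviations |t . a j|. Being a combination of the \<open>a j\<close>, it stays in
  every subspace that contains them; this later confines the limit law to symmetric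
  matrices.\<close>

lemma gaussian_vector_exists:
  fixes a :: "'j::finite \<Rightarrow> 'b::euclidean_space"
  obtains \<mu> where "prob_space \<mu>" "sets \<mu> = sets borel"
    "\<And>S. subspace S \<Longrightarrow> closed S \<Longrightarrow> range a \<subseteq> S \<Longrightarrow> AE x in \<mu>. x \<in> S"
    "\<And>t. distr \<mu> borel (\<lambda>x. t \<bullet> x) = gaussian_law 0 (\<Sum>j\<in>UNIV. (t \<bullet> a j)\<^sup>2)"
proof -
  define N where "N = (\<Pi>\<^sub>M j\<in>(UNIV::'j set). std_normal_distribution)"
  have std: "prob_space std_normal_distribution" by (rule prob_space_normal_density) simp
  interpret N: prob_space N unfolding N_def by (rule prob_space_PiM) (rule std)
  have setsN: "sets N = sets (\<Pi>\<^sub>M j\<in>(UNIV::'j set). borel :: real measure)"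
    unfolding N_def by (rule sets_PiM_cong) auto
  have comp[measurable]: "(\<lambda>\<omega>. \<omega> j) \<in> borel_measurable N" for j
    using measurable_component_singleton[of j UNIV "\<lambda>_. borel :: real measure"]
    by (subst measurable_cong_sets[OF setsN refl]) simp
  have distr_comp: "distr N borel (\<lambda>\<omega>. \<omega> j) = std_normal_distribution" for j
  proof -
    have "distr N borel (\<lambda>\<omega>. \<omega> j) = distr N std_normal_distribution (\<lambda>\<omega>. \<omega> j)"
      by (rule distr_cong) auto
    also have "\<dots> = std_normal_distribution"
      unfolding N_def by (rule distr_PiM_component) (auto intro: std)
    finally show ?thesis .
  qed
  have indep: "N.indep_vars (\<lambda>_. borel) (\<lambda>j \<omega>. \<omega> j) UNIV"
  proof (subst N.indep_vars_iff_distr_eq_PiM')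
    have "distr N (\<Pi>\<^sub>M i\<in>UNIV. borel) (\<lambda>x. \<lambda>i\<in>UNIV. x i) = distr N N (\<lambda>x. x)"
      by (rule distr_cong) (auto simp: setsN)
    also have "\<dots> = N" by (rule distr_id)
    also have "\<dots> = (\<Pi>\<^sub>M i\<in>UNIV. distr N borel (\<lambda>\<omega>. \<omega> i))"
      unfolding distr_comp by (simp add: N_def)
    finally show "distr N (\<Pi>\<^sub>M i\<in>UNIV. borel) (\<lambda>x. \<lambda>i\<in>UNIV. x i) = (\<Pi>\<^sub>M i\<in>UNIV. distr N borel (\<lambda>\<omega>. \<omega> i))" .
  qed (auto simp: comp)
  define X where "X = (\<lambda>\<omega>. \<Sum>j\<in>UNIV. \<omega> j *\<^sub>R a j)"
  have X[measurable]: "X \<in> borel_measurable N" unfolding X_def by measurable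
  show ?thesis
  proof (rule that[of "distr N borel X"])
    show "prob_space (distr N borel X)" by (rule N.prob_space_distr) simp
    show "sets (distr N borel X) = sets borel" by simp
    show "AE x in distr N borel X. x \<in> S" if "subspace S" "closed S" "range a \<subseteq> S" for S
    proof (subst AE_distr_iff)
      show "{x \<in> space borel. x \<in> S} \<in> sets borel" using that(2) by simp
      show "AE x in N. X x \<in> S" unfolding X_def using that
        by (auto intro!: AE_I2 subspace_sum subspace_scale)
    qed simp
    show "distr (distr N borel X) borel (\<lambda>x. t \<bullet> x) = gaussian_law 0 (\<Sum>j\<in>UNIV. (t \<bullet> a j)\<^sup>2)" for t
    proof -
      \<comment> \<open>The addition theorem for independent normals asks for positive standard
        deviations, so the terms with zero coefficient are dropped; if none remain, the law is the
        point mass.\<close>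
      define J where "J = {j. t \<bullet> a j \<noteq> 0}"
      have "distr (distr N borel X) borel (\<lambda>x. t \<bullet> x) = distr N borel (\<lambda>\<omega>. t \<bullet> X \<omega>)"
        by (subst distr_distr) (auto simp: comp_def)
      also have "(\<lambda>\<omega>. t \<bullet> X \<omega>) = (\<lambda>\<omega>. \<Sum>j\<in>UNIV. \<omega> j * (t \<bullet> a j))"
        by (simp add: X_def inner_sum_right)
      also have "\<dots> = (\<lambda>\<omega>. \<Sum>j\<in>J. \<omega> j * (t \<bullet> a j))"
        by (intro ext sum.mono_neutral_right) (auto simp: J_def)
      finally have 1: "distr (distr N borel X) borel (\<lambda>x. t \<bullet> x) = distr N borel (\<lambda>\<omega>. \<Sum>j\<in>J. \<omega> j * (t \<bullet> a j))" .
      have 2: "(\<Sum>j\<in>UNIV. (t \<bullet> a j)\<^sup>2) = (\<Sum>j\<in>J. (t \<bullet> a j)\<^sup>2)"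
        by (intro sum.mono_neutral_right) (auto simp: J_def)
      show ?thesis
      proof (cases "J = {}")
        case True
        then show ?thesis unfolding 1 2 by (simp add: gaussian_law_def N.distr_const)
      next
        case False
        have "distributed N lborel (\<lambda>\<omega>. \<Sum>j\<in>J. \<omega> j * (t \<bullet> a j)) (normal_density (\<Sum>j\<in>J. 0) (sqrt (\<Sum>j\<in>J. \<bar>t \<bullet> a j\<bar>\<^sup>2)))"
        proof (rule N.sum_indep_normal)
          have "N.indep_vars (\<lambda>_. borel) (\<lambda>j \<omega>. \<omega> j) J" using N.indep_vars_subset[OF indep] by simp
          then show "N.indep_vars (\<lambda>i. borel) (\<lambda>j \<omega>. \<omega> j * (t \<bullet> a j)) J"
            by (rule N.indep_vars_compose2) simp
          fix j assume j: "j \<in> J"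
          have "distributed N lborel (\<lambda>\<omega>. \<omega> j) std_normal_density"
            unfolding distributed_def
            by (auto simp: distr_comp[of j, symmetric] intro!: distr_cong)
          from N.normal_density_affine[OF this, of "t \<bullet> a j" 0] j
          show "distributed N lborel (\<lambda>\<omega>. \<omega> j * (t \<bullet> a j)) (normal_density 0 \<bar>t \<bullet> a j\<bar>)"
            by (simp add: J_def mult.commute)
        qed (use False in \<open>auto simp: J_def\<close>)
        then have "distr N lborel (\<lambda>\<omega>. \<Sum>j\<in>J. \<omega> j * (t \<bullet> a j)) = density lborel (normal_density 0 (sqrt (\<Sum>j\<in>J. (t \<bullet> a j)\<^sup>2)))"
          by (simp add: distributed_distr_eq_density)
        moreover have "distr N lborel (\<lambda>\<omega>. \<Sum>j\<in>J. \<omega> j * (t \<bullet> a j)) = distr N borel (\<lambda>\<omega>. \<Sum>j\<in>J. \<omega> j * (t \<bullet> a j))"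
          by (rule distr_cong) auto
        moreover have "(\<Sum>j\<in>J. (t \<bullet> a j)\<^sup>2) > 0"
          using False by (intro sum_pos) (auto simp: J_def)
        ultimately show ?thesis unfolding 1 2 by (simp add: gaussian_law_def)
      qed
    qed
  qed
qed

section \<open>Sums over an i.i.d. sample with finitely many values\<close>

locale iid_finite = prob_space M for M :: "'a measure" +
  fixes Z :: "nat \<Rightarrow> 'a \<Rightarrow> 'j::finite" and pr :: "'j \<Rightarrow> real"
  assumes indep: "indep_vars (\<lambda>_. count_space UNIV) Z UNIV"
    and dist: "\<And>i. distr M (count_space UNIV) (Z i) = density (count_space UNIV) (\<lambda>j. ennreal (pr j))"
    and pr_nonneg: "\<And>j. 0 \<le> pr j"
begin

lemma Z_measurable[measurable]: "Z i \<in> measurable M (count_space UNIV)"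
  using indep by (simp add: indep_vars_def)

lemma expectation_Z: "expectation (\<lambda>\<omega>. \<phi> (Z i \<omega>)) = (\<Sum>j\<in>UNIV. pr j * (\<phi> j :: real))"
proof -
  have "expectation (\<lambda>\<omega>. \<phi> (Z i \<omega>)) = (\<integral>j. \<phi> j \<partial>distr M (count_space UNIV) (Z i))"
    by (subst integral_distr) auto
  also have "\<dots> = (\<integral>j. pr j * \<phi> j \<partial>count_space UNIV)"
    unfolding dist by (subst integral_density) (auto simp: pr_nonneg)
  finally show ?thesis by (simp add: lebesgue_integral_count_space_finite)
qed

lemma integrable_Z: "integrable M (\<lambda>\<omega>. \<phi> (Z i \<omega>) :: real)"
proof (rule integrable_const_bound[where B="\<Sum>j\<in>UNIV. \<bar>\<phi> j\<bar>"])
  show "AE \<omega> in M. norm (\<phi> (Z i \<omega>)) \<le> (\<Sum>j\<in>UNIV. \<bar>\<phi> j\<bar>)"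
    by (auto intro!: AE_I2 member_le_sum[of "Z i _" UNIV "\<lambda>j. \<bar>\<phi> j\<bar>"])
qed measurable

lemma pr_sum: "(\<Sum>j\<in>UNIV. pr j) = 1"
  using expectation_Z[of "\<lambda>_. 1" 0] by (simp add: prob_space)

text \<open>The variance can vanish for a nonzero direction: the vectors summed later are symmetric
  matrices, hence orthogonal to every antisymmetric \<open>t\<close>. In that case the sum is 0
  almost surely; otherwise weak convergence is applied to the bounded continuous function cos
  (\<sigma> * y + c).\<close>

lemma clt_cos:
  assumes mean: "(\<Sum>j\<in>UNIV. pr j * \<phi> j) = 0"
  shows "(\<lambda>n. expectation (\<lambda>\<omega>. cos ((\<Sum>i<n. \<phi> (Z i \<omega>)) / sqrt (real n) + c))) \<longlonglongrightarrow>
    (\<integral>y. cos (y + c) \<partial>gaussian_law 0 (\<Sum>j\<in>UNIV. pr j * (\<phi> j)\<^sup>2))"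
proof -
  define v where "v = (\<Sum>j\<in>UNIV. pr j * (\<phi> j)\<^sup>2)"
  have v0: "0 \<le> v" by (auto simp: v_def intro!: sum_nonneg mult_nonneg_nonneg pr_nonneg)
  have var: "expectation (\<lambda>\<omega>. (\<phi> (Z i \<omega>))\<^sup>2) = v" for i
    using expectation_Z[of "\<lambda>j. (\<phi> j)\<^sup>2" i] by (simp add: v_def)
  interpret std: prob_space std_normal_distribution by (rule prob_space_normal_density) simp
  show ?thesis unfolding v_def[symmetric]
  proof (cases "v = 0")
    case True
    have "AE \<omega> in M. \<phi> (Z i \<omega>) = 0" for i
    proof -
      have "AE \<omega> in M. (\<phi> (Z i \<omega>))\<^sup>2 = 0"
        using integral_nonneg_eq_0_iff_AE[OF integrable_Z[of "\<lambda>j. (\<phi> j)\<^sup>2" i]] var[of i] True by simp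
      then show ?thesis by simp
    qed
    then have AE: "AE \<omega> in M. \<forall>i. \<phi> (Z i \<omega>) = 0" by (simp add: AE_all_countable)
    have "expectation (\<lambda>\<omega>. cos ((\<Sum>i<n. \<phi> (Z i \<omega>)) / sqrt (real n) + c)) = expectation (\<lambda>_. cos c)" for n
      using AE by (intro integral_cong_AE) (auto elim!: eventually_mono)
    then show "(\<lambda>n. expectation (\<lambda>\<omega>. cos ((\<Sum>i<n. \<phi> (Z i \<omega>)) / sqrt (real n) + c))) \<longlonglongrightarrow>
      (\<integral>y. cos (y + c) \<partial>gaussian_law 0 v)"
      using True by (simp add: gaussian_law_def prob_space integral_return)
  next
    case False
    define \<sigma> where "\<sigma> = sqrt v"
    have \<sigma>: "\<sigma> > 0" "\<sigma>\<^sup>2 = v" using False v0 by (auto simp: \<sigma>_def)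
    let ?S = "\<lambda>n \<omega>. (\<Sum>i<n. \<phi> (Z i \<omega>)) / sqrt (real n * \<sigma>\<^sup>2)"
    have wc: "weak_conv_m (\<lambda>n. distr M borel (?S n)) std_normal_distribution"
    proof (rule central_limit_theorem_zero_mean[where \<mu> = "distr (density (count_space UNIV) (\<lambda>j. ennreal (pr j))) borel \<phi>"])
      show "indep_vars (\<lambda>i. borel) (\<lambda>i \<omega>. \<phi> (Z i \<omega>)) UNIV"
        by (rule indep_vars_compose2[OF indep]) simp
      show "expectation (\<lambda>\<omega>. \<phi> (Z n \<omega>)) = 0" for n using mean by (simp add: expectation_Z)
      then show "variance (\<lambda>\<omega>. \<phi> (Z n \<omega>)) = \<sigma>\<^sup>2" for n by (simp add: var \<sigma>)
      show "distr M borel (\<lambda>\<omega>. \<phi> (Z n \<omega>)) = distr (density (count_space UNIV) (\<lambda>j. ennreal (pr j))) borel \<phi>" for n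
        unfolding dist[symmetric, of n] by (subst distr_distr) (auto simp: comp_def)
    qed (use \<sigma> integrable_Z[of "\<lambda>j. (\<phi> j)\<^sup>2"] in auto)
    have "(\<lambda>n. \<integral>y. cos (\<sigma> * y + c) \<partial>distr M borel (?S n)) \<longlonglongrightarrow> (\<integral>y. cos (\<sigma> * y + c) \<partial>std_normal_distribution)"
      by (rule weak_conv_imp_integral_bdd_continuous_conv[OF _ _ wc, where B=1])
        (auto intro!: real_distribution_distr continuous_intros simp: real_dist_normal_dist)
    also have "(\<lambda>n. \<integral>y. cos (\<sigma> * y + c) \<partial>distr M borel (?S n)) = (\<lambda>n. expectation (\<lambda>\<omega>. cos ((\<Sum>i<n. \<phi> (Z i \<omega>)) / sqrt (real n) + c)))"
    proof
      fix n
      have "\<sigma> * ?S n \<omega> = (\<Sum>i<n. \<phi> (Z i \<omega>)) / sqrt (real n)" for \<omega>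
        using \<sigma>(1) by (simp add: real_sqrt_mult)
      then show "(\<integral>y. cos (\<sigma> * y + c) \<partial>distr M borel (?S n)) = expectation (\<lambda>\<omega>. cos ((\<Sum>i<n. \<phi> (Z i \<omega>)) / sqrt (real n) + c))"
        by (subst integral_distr) auto
    qed
    also have "(\<integral>y. cos (\<sigma> * y + c) \<partial>std_normal_distribution) = (\<integral>y. cos (y + c) \<partial>gaussian_law 0 v)"
      unfolding gaussian_law_eq_distr[OF v0] \<sigma>_def by (subst integral_distr) auto
    finally show "(\<lambda>n. expectation (\<lambda>\<omega>. cos ((\<Sum>i<n. \<phi> (Z i \<omega>)) / sqrt (real n) + c))) \<longlonglongrightarrow>
      (\<integral>y. cos (y + c) \<partial>gaussian_law 0 v)" .
  qed
qed

lemma expectation_Z_pair: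
  assumes "i \<noteq> k"
  shows "expectation (\<lambda>\<omega>. \<phi> (Z i \<omega>) * \<psi> (Z k \<omega>)) = (\<Sum>j\<in>UNIV. pr j * \<phi> j) * (\<Sum>j\<in>UNIV. pr j * (\<psi> j :: real))"
proof -
  define Y where "Y = (\<lambda>l. if l = i then \<phi> else \<psi>)"
  have "indep_vars (\<lambda>_. borel) (\<lambda>l \<omega>. Y l (Z l \<omega>)) {i, k}"
    by (rule indep_vars_compose2[OF indep_vars_subset[OF indep]]) auto
  then have "expectation (\<lambda>\<omega>. \<Prod>l\<in>{i, k}. Y l (Z l \<omega>)) = (\<Prod>l\<in>{i, k}. expectation (\<lambda>\<omega>. Y l (Z l \<omega>)))"
    by (intro indep_vars_lebesgue_integral) (auto intro: integrable_Z)
  then show ?thesis using assms by (simp add: Y_def expectation_Z)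
qed

lemma integrable_Z_pair: "integrable M (\<lambda>\<omega>. f (Z i \<omega>) (Z k \<omega>) :: real)"
proof (rule integrable_const_bound[where B="\<Sum>(j, l)\<in>UNIV. \<bar>f j l\<bar>"])
  show "AE \<omega> in M. norm (f (Z i \<omega>) (Z k \<omega>)) \<le> (\<Sum>(j, l)\<in>UNIV. \<bar>f j l\<bar>)"
    using member_le_sum[of "(Z i _, Z k _)" UNIV "\<lambda>(j, l). \<bar>f j l\<bar>"] by (auto intro!: AE_I2)
  show "(\<lambda>\<omega>. f (Z i \<omega>) (Z k \<omega>)) \<in> borel_measurable M"
    by (rule measurable_compose_countable'[OF _ Z_measurable]) auto
qed

text \<open>Expand the squared norm into inner products. Off the diagonal these factor
  coordinatewise by independence and vanish with the mean.\<close>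

lemma second_moment_sum:
  fixes a :: "'j \<Rightarrow> 'b::euclidean_space"
  assumes mean: "(\<Sum>j\<in>UNIV. pr j *\<^sub>R a j) = 0"
  shows "integrable M (\<lambda>\<omega>. (norm (\<Sum>i<n. a (Z i \<omega>)))\<^sup>2)"
    and "expectation (\<lambda>\<omega>. (norm (\<Sum>i<n. a (Z i \<omega>)))\<^sup>2) = real n * (\<Sum>j\<in>UNIV. pr j * (norm (a j))\<^sup>2)"
proof -
  have eq: "(norm (\<Sum>i<n. a (Z i \<omega>)))\<^sup>2 = (\<Sum>i<n. \<Sum>k<n. a (Z i \<omega>) \<bullet> a (Z k \<omega>))" for \<omega>
    by (simp add: power2_norm_eq_inner inner_sum_left inner_sum_right) (rule sum.swap)
  note int = integrable_Z_pair[of "\<lambda>j l. a j \<bullet> a l"]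
  show "integrable M (\<lambda>\<omega>. (norm (\<Sum>i<n. a (Z i \<omega>)))\<^sup>2)"
    unfolding eq by (intro Bochner_Integration.integrable_sum int)
  have E: "expectation (\<lambda>\<omega>. a (Z i \<omega>) \<bullet> a (Z k \<omega>)) = (if i = k then \<Sum>j\<in>UNIV. pr j * (norm (a j))\<^sup>2 else 0)" for i k
  proof (cases "i = k")
    case True
    then show ?thesis using expectation_Z[of "\<lambda>j. (norm (a j))\<^sup>2" i] by (simp add: power2_norm_eq_inner)
  next
    case False
    have "expectation (\<lambda>\<omega>. a (Z i \<omega>) \<bullet> a (Z k \<omega>)) = expectation (\<lambda>\<omega>. \<Sum>b\<in>Basis. (a (Z i \<omega>) \<bullet> b) * (a (Z k \<omega>) \<bullet> b))"
      by (subst euclidean_inner) simp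
    also have "\<dots> = (\<Sum>b\<in>Basis. expectation (\<lambda>\<omega>. (a (Z i \<omega>) \<bullet> b) * (a (Z k \<omega>) \<bullet> b)))"
      by (intro Bochner_Integration.integral_sum integrable_Z_pair[of "\<lambda>j l. (a j \<bullet> _) * (a l \<bullet> _)"])
    also have "\<dots> = (\<Sum>b\<in>Basis. (\<Sum>j\<in>UNIV. pr j * (a j \<bullet> b)) * (\<Sum>j\<in>UNIV. pr j * (a j \<bullet> b)))"
      by (intro sum.cong refl expectation_Z_pair[OF False])
    also have "\<dots> = 0"
    proof (intro sum.neutral ballI)
      fix b
      have "(\<Sum>j\<in>UNIV. pr j * (a j \<bullet> b)) = (\<Sum>j\<in>UNIV. pr j *\<^sub>R a j) \<bullet> b" by (simp add: inner_sum_left)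
      then show "(\<Sum>j\<in>UNIV. pr j * (a j \<bullet> b)) * (\<Sum>j\<in>UNIV. pr j * (a j \<bullet> b)) = 0" using mean by simp
    qed
    finally show ?thesis using False by simp
  qed
  have "expectation (\<lambda>\<omega>. (norm (\<Sum>i<n. a (Z i \<omega>)))\<^sup>2) = (\<Sum>i<n. \<Sum>k<n. expectation (\<lambda>\<omega>. a (Z i \<omega>) \<bullet> a (Z k \<omega>)))"
    unfolding eq by (simp add: Bochner_Integration.integral_sum int)
  then show "expectation (\<lambda>\<omega>. (norm (\<Sum>i<n. a (Z i \<omega>)))\<^sup>2) = real n * (\<Sum>j\<in>UNIV. pr j * (norm (a j))\<^sup>2)"
    by (simp add: E)
qed

lemma measurable_sum_Z[measurable]:
  fixes a :: "'j \<Rightarrow> 'b::euclidean_space"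
  shows "(\<lambda>\<omega>. \<Sum>i<n. a (Z i \<omega>)) \<in> borel_measurable M"
  by (intro borel_measurable_sum measurable_compose[OF Z_measurable]) simp

text \<open>Chebyshev's inequality for vectors. For \<open>r\<close> of order sqrt n the bound is
  constant in \<open>n\<close>, which gives tightness; for \<open>r\<close> of order n it tends to
  0, which gives consistency.\<close>

lemma tail_sum_le:
  fixes a :: "'j \<Rightarrow> 'b::euclidean_space"
  assumes mean: "(\<Sum>j\<in>UNIV. pr j *\<^sub>R a j) = 0" and r: "r > 0"
  shows "prob {\<omega>\<in>space M. norm (\<Sum>i<n. a (Z i \<omega>)) \<ge> r} \<le> real n * (\<Sum>j\<in>UNIV. pr j * (norm (a j))\<^sup>2) / r\<^sup>2"
proof -
  have "prob {\<omega>\<in>space M. (norm (\<Sum>i<n. a (Z i \<omega>)))\<^sup>2 \<ge> r\<^sup>2}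
      \<le> expectation (\<lambda>\<omega>. (norm (\<Sum>i<n. a (Z i \<omega>)))\<^sup>2) / r\<^sup>2"
    using r second_moment_sum(1)[OF mean] by (intro integral_Markov_inequality_measure[of _ _ "{}"]) auto
  moreover have "{\<omega>\<in>space M. (norm (\<Sum>i<n. a (Z i \<omega>)))\<^sup>2 \<ge> r\<^sup>2} = {\<omega>\<in>space M. norm (\<Sum>i<n. a (Z i \<omega>)) \<ge> r}"
    using r abs_le_square_iff[of r "norm _"] by auto
  ultimately show ?thesis by (simp add: second_moment_sum(2)[OF mean])
qed

text \<open>Slutsky's lemma is immediate here: adding a remainder that tends to 0 in probability
  changes neither the limits of the cosines nor tightness.\<close>
lemma clt_remainder:
  fixes a :: "'j \<Rightarrow> 'b::euclidean_space" and X :: "nat \<Rightarrow> 'a \<Rightarrow> 'b"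
  assumes mean: "(\<Sum>j\<in>UNIV. pr j *\<^sub>R a j) = 0"
    and \<mu>: "prob_space \<mu>" "sets \<mu> = sets borel"
    and law: "\<And>t. distr \<mu> borel (\<lambda>x. t \<bullet> x) = gaussian_law 0 (\<Sum>j\<in>UNIV. pr j * (t \<bullet> a j)\<^sup>2)"
    and X: "\<And>n. n \<ge> 1 \<Longrightarrow> X n \<in> borel_measurable M"
    and rem: "\<And>r e. 0 < r \<Longrightarrow> 0 < e \<Longrightarrow>
      \<forall>\<^sub>F n in sequentially. prob {\<omega>\<in>space M. norm (X n \<omega> - (\<Sum>i<n. a (Z i \<omega>)) /\<^sub>R sqrt (real n)) > r} \<le> e"
  shows "converges_in_distribution M X \<mu>"
proof (rule converges_in_distribution_cosI[OF \<mu>])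
  define S where "S = (\<lambda>n \<omega>. (\<Sum>i<n. a (Z i \<omega>)) /\<^sub>R sqrt (real n))"
  have S[measurable]: "S n \<in> borel_measurable M" for n unfolding S_def by measurable
  have rem': "\<forall>\<^sub>F n in sequentially. prob {\<omega>\<in>space M. norm (X n \<omega> - S n \<omega>) > r} \<le> e" if "0 < r" "0 < e" for r e
    using rem[OF that] by (simp add: S_def)
  show X': "\<forall>\<^sub>F n in sequentially. X n \<in> borel_measurable M"
    using eventually_ge_at_top[of 1] by eventually_elim (rule X)
  show "\<exists>R. \<forall>\<^sub>F n in sequentially. prob {\<omega>\<in>space M. norm (X n \<omega>) > R} \<le> e" if e: "0 < e" for e
  proof -
    define V where "V = (\<Sum>j\<in>UNIV. pr j * (norm (a j))\<^sup>2)"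
    have V: "V \<ge> 0" unfolding V_def by (intro sum_nonneg mult_nonneg_nonneg pr_nonneg) simp
    \<comment> \<open>Chebyshev's bound for \<open>norm (S n \<omega>) \<ge> R\<close> is V / R^2 =
      V * e / (2 * (V + 1)), at most e / 2; the summand 1 keeps \<open>R\<close> positive when V =
      0.\<close>
    define R where "R = sqrt (2 * (V + 1) / e)"
    have R: "R > 0" "R\<^sup>2 = 2 * (V + 1) / e" using V e by (auto simp: R_def)
    have "\<forall>\<^sub>F n in sequentially. prob {\<omega>\<in>space M. norm (X n \<omega> - S n \<omega>) > 1} \<le> e / 2"
      using rem'[of 1 "e / 2"] e by simp
    then have "\<forall>\<^sub>F n in sequentially. prob {\<omega>\<in>space M. norm (X n \<omega>) > R + 1} \<le> e"
      using eventually_ge_at_top[of "1::nat"]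
    proof eventually_elim
      case (elim n)
      note [measurable] = X[OF elim(2)]
      have "{\<omega>\<in>space M. norm (X n \<omega>) > R + 1} \<subseteq> {\<omega>\<in>space M. norm (X n \<omega> - S n \<omega>) > 1} \<union> {\<omega>\<in>space M. norm (\<Sum>i<n. a (Z i \<omega>)) \<ge> sqrt (real n) * R}"
      proof
        fix \<omega> assume w: "\<omega> \<in> {\<omega>\<in>space M. norm (X n \<omega>) > R + 1}"
        have "norm (X n \<omega>) \<le> norm (S n \<omega>) + norm (X n \<omega> - S n \<omega>)" by (rule norm_triangle_sub)
        then have "norm (X n \<omega> - S n \<omega>) > 1 \<or> norm (S n \<omega>) \<ge> R" using w by auto
        moreover have "norm (S n \<omega>) = norm (\<Sum>i<n. a (Z i \<omega>)) / sqrt (real n)"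
          by (simp add: S_def divide_inverse mult.commute)
        ultimately show "\<omega> \<in> {\<omega>\<in>space M. norm (X n \<omega> - S n \<omega>) > 1} \<union> {\<omega>\<in>space M. norm (\<Sum>i<n. a (Z i \<omega>)) \<ge> sqrt (real n) * R}"
          using w elim(2) by (auto simp: pos_le_divide_eq mult.commute)
      qed
      then have "prob {\<omega>\<in>space M. norm (X n \<omega>) > R + 1} \<le>
          prob ({\<omega>\<in>space M. norm (X n \<omega> - S n \<omega>) > 1} \<union> {\<omega>\<in>space M. norm (\<Sum>i<n. a (Z i \<omega>)) \<ge> sqrt (real n) * R})"
        by (intro finite_measure_mono) measurable
      also have "\<dots> \<le> prob {\<omega>\<in>space M. norm (X n \<omega> - S n \<omega>) > 1} + prob {\<omega>\<in>space M. norm (\<Sum>i<n. a (Z i \<omega>)) \<ge> sqrt (real n) * R}"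
        by (intro measure_Un_le) measurable
      also have "prob {\<omega>\<in>space M. norm (\<Sum>i<n. a (Z i \<omega>)) \<ge> sqrt (real n) * R} \<le> real n * V / (sqrt (real n) * R)\<^sup>2"
        unfolding V_def by (rule tail_sum_le[OF mean]) (use elim(2) R in simp)
      also have "real n * V / (sqrt (real n) * R)\<^sup>2 = V / (2 * (V + 1) / e)"
        using elim(2) R by (simp add: power_mult_distrib)
      also have "\<dots> \<le> e / 2" using V e by (simp add: field_simps)
      finally show ?case using elim(1) by simp
    qed
    then show ?thesis by blast
  qed
  show "(\<lambda>n. expectation (\<lambda>\<omega>. cos (t \<bullet> X n \<omega> + c))) \<longlonglongrightarrow> (\<integral>x. cos (t \<bullet> x + c) \<partial>\<mu>)" for t c
  proof -
    have fS: "expectation (\<lambda>\<omega>. cos (t \<bullet> S n \<omega> + c)) = expectation (\<lambda>\<omega>. cos ((\<Sum>i<n. t \<bullet> a (Z i \<omega>)) / sqrt (real n) + c))" for n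
      by (simp add: S_def inner_sum_right divide_inverse mult.commute)
    have "(\<Sum>j\<in>UNIV. pr j * (t \<bullet> a j)) = t \<bullet> (\<Sum>j\<in>UNIV. pr j *\<^sub>R a j)" by (simp add: inner_sum_right)
    then have "(\<Sum>j\<in>UNIV. pr j * (t \<bullet> a j)) = 0" using mean by simp
    from clt_cos[OF this, of c] have lim: "(\<lambda>n. expectation (\<lambda>\<omega>. cos (t \<bullet> S n \<omega> + c))) \<longlonglongrightarrow>
        (\<integral>y. cos (y + c) \<partial>distr \<mu> borel (\<lambda>x. t \<bullet> x))"
      unfolding fS law .
    have [measurable_cong]: "sets \<mu> = sets borel" by fact
    have "(\<integral>y. cos (y + c) \<partial>distr \<mu> borel (\<lambda>x. t \<bullet> x)) = (\<integral>x. cos (t \<bullet> x + c) \<partial>\<mu>)"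
      by (rule integral_distr) measurable
    with lim have lim': "(\<lambda>n. expectation (\<lambda>\<omega>. cos (t \<bullet> S n \<omega> + c))) \<longlonglongrightarrow> (\<integral>x. cos (t \<bullet> x + c) \<partial>\<mu>)" by simp
    have "(\<lambda>n. expectation (\<lambda>\<omega>. cos (t \<bullet> X n \<omega> + c)) - expectation (\<lambda>\<omega>. cos (t \<bullet> S n \<omega> + c))) \<longlonglongrightarrow> 0"
      unfolding tendsto_iff dist_real_def
    proof (intro allI impI)
      fix e :: real assume e: "0 < e"
      \<comment> \<open>The cosine is 1-Lipschitz, so a remainder of norm at most \<open>r\<close>
        changes it by at most norm t * r, hence by at most e / 4. A larger remainder has probability
        at most e / 4 and changes it by at most 2. The total is 3 * e / 4, and the summand 1 covers
        \<open>t = 0\<close>.\<close>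
      define r where "r = e / (4 * (norm t + 1))"
      have r: "r > 0" using e by (simp add: r_def add_nonneg_pos)
      have tr: "norm t * r \<le> e / 4"
      proof -
        have "norm t * r \<le> (norm t + 1) * r" using r by simp
        also have "\<dots> = e / 4" by (simp add: r_def field_simps add_nonneg_eq_0_iff)
        finally show ?thesis .
      qed
      have "\<forall>\<^sub>F n in sequentially. prob {\<omega>\<in>space M. norm (X n \<omega> - S n \<omega>) > r} \<le> e / 4"
        using rem'[OF r, of "e / 4"] e by simp
      then show "\<forall>\<^sub>F n in sequentially. \<bar>expectation (\<lambda>\<omega>. cos (t \<bullet> X n \<omega> + c)) - expectation (\<lambda>\<omega>. cos (t \<bullet> S n \<omega> + c)) - 0\<bar> < e"
        using eventually_ge_at_top[of "1::nat"]
      proof eventually_elim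
        case (elim n)
        note [measurable] = X[OF elim(2)]
        let ?A = "{\<omega>\<in>space M. norm (X n \<omega> - S n \<omega>) > r}"
        have A[measurable]: "?A \<in> events" by measurable
        have i: "integrable M (\<lambda>\<omega>. cos (t \<bullet> X n \<omega> + c))" "integrable M (\<lambda>\<omega>. cos (t \<bullet> S n \<omega> + c))"
          by (auto intro!: integrable_const_bound[where B=1])
        have "\<bar>expectation (\<lambda>\<omega>. cos (t \<bullet> X n \<omega> + c)) - expectation (\<lambda>\<omega>. cos (t \<bullet> S n \<omega> + c))\<bar>
            = \<bar>expectation (\<lambda>\<omega>. cos (t \<bullet> X n \<omega> + c) - cos (t \<bullet> S n \<omega> + c))\<bar>" using i by simp
        also have "\<dots> \<le> expectation (\<lambda>\<omega>. \<bar>cos (t \<bullet> X n \<omega> + c) - cos (t \<bullet> S n \<omega> + c)\<bar>)"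
          by (rule integral_abs_bound)
        also have "\<dots> \<le> expectation (\<lambda>\<omega>. e / 4 + 2 * indicator ?A \<omega>)"
        proof (rule integral_mono)
          show "integrable M (\<lambda>\<omega>. \<bar>cos (t \<bullet> X n \<omega> + c) - cos (t \<bullet> S n \<omega> + c)\<bar>)" using i by auto
          show "integrable M (\<lambda>\<omega>. e / 4 + 2 * indicator ?A \<omega> :: real)"
            by (intro Bochner_Integration.integrable_add integrable_mult_right integrable_real_indicator) (auto simp: emeasure_eq_measure)
          fix \<omega> assume w: "\<omega> \<in> space M"
          have lip: "\<bar>cos x - cos y\<bar> \<le> \<bar>x - y\<bar>" for x y :: real
          proof -
            have "\<bar>cos x - cos y\<bar> = 2 * \<bar>sin ((x + y) / 2)\<bar> * \<bar>sin ((y - x) / 2)\<bar>"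
              by (simp add: cos_diff_cos abs_mult)
            also have "\<dots> \<le> 2 * 1 * \<bar>(y - x) / 2\<bar>" by (intro mult_mono abs_sin_x_le_abs_x) auto
            finally show ?thesis by simp
          qed
          show "\<bar>cos (t \<bullet> X n \<omega> + c) - cos (t \<bullet> S n \<omega> + c)\<bar> \<le> e / 4 + 2 * indicator ?A \<omega>"
          proof (cases "norm (X n \<omega> - S n \<omega>) > r")
            case True
            then have "indicator ?A \<omega> = (1::real)" using w by simp
            moreover have "\<bar>cos (t \<bullet> X n \<omega> + c) - cos (t \<bullet> S n \<omega> + c)\<bar> \<le> 2"
              using abs_cos_le_one[of "t \<bullet> X n \<omega> + c"] abs_cos_le_one[of "t \<bullet> S n \<omega> + c"] by linarith
            ultimately show ?thesis using e by simp
          next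
            case False
            have "\<bar>cos (t \<bullet> X n \<omega> + c) - cos (t \<bullet> S n \<omega> + c)\<bar> \<le> \<bar>t \<bullet> (X n \<omega> - S n \<omega>)\<bar>"
              using lip[of "t \<bullet> X n \<omega> + c" "t \<bullet> S n \<omega> + c"] by (simp add: inner_diff_right)
            also have "\<dots> \<le> norm t * norm (X n \<omega> - S n \<omega>)" by (rule Cauchy_Schwarz_ineq2)
            also have "\<dots> \<le> norm t * r" using False by (intro mult_left_mono) auto
            finally show ?thesis using tr False by simp
          qed
        qed
        also have "\<dots> = e / 4 + 2 * prob ?A"
          using A by (subst Bochner_Integration.integral_add) (auto simp: prob_space emeasure_eq_measure)
        finally show ?case using elim(1) e by simp
      qed
    qed
    from tendsto_add[OF this lim'] show ?thesis by simp
  qed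
qed

end

section \<open>Principal minors\<close>

text \<open>Rows of the identity matrix contribute a nonzero factor only at fixed points. The
  resulting indicator lets a sum over permutations of \<open>J\<close> be rewritten as one over all
  permutations, and conversely.\<close>

lemma prod_perm_sum_expand:
  fixes A :: "real ^ 'n ^ 'n"
  assumes "p permutes (UNIV :: 'n set)"
  shows "(\<Prod>i\<in>UNIV - J. (mat 1 :: real ^ 'n ^ 'n) $ i $ p i) = (if p permutes J then 1 else 0)"
proof (cases "p permutes J")
  case True
  then show ?thesis by (auto simp: mat_def permutes_def intro!: prod.neutral)
next
  case False
  then obtain i where "i \<notin> J" "p i \<noteq> i"
    using permutes_superset[OF assms, of J] by auto
  then have "\<exists>a\<in>UNIV - J. a \<noteq> p a" by (intro bexI[of _ i]) auto
  then show ?thesis using False by (auto simp: mat_def)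
qed

lemma sum_permutes_fixing:
  fixes f :: "('n::finite \<Rightarrow> 'n) \<Rightarrow> real"
  shows "(\<Sum>p | p permutes UNIV. f p * (if p permutes J then 1 else 0)) = (\<Sum>p | p permutes J. f p)"
proof -
  have "(\<Sum>p | p permutes UNIV. f p * (if p permutes J then 1 else 0)) = (\<Sum>p | p permutes J. f p * (if p permutes J then 1 else 0))"
    by (rule sum.mono_neutral_right) (auto intro: permutes_subset)
  then show ?thesis by simp
qed

text \<open>Expand every product according to the set \<open>J\<close> of rows whose factor comes
  from \<open>A\<close>; the other rows take theirs from the identity and force the permutation to
  fix the complement of \<open>J\<close>. This is what normalizes the probabilities
  \<open>dpp_prob\<close>.\<close>

lemma det_mat_1_plus:
  fixes A :: "real ^ 'n ^ 'n"
  shows "det (mat 1 + A) = (\<Sum>J\<in>UNIV. principal_minor A J)"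
proof -
  have "(\<Prod>i\<in>UNIV. (mat 1 + A) $ i $ p i) =
      (\<Sum>J\<in>UNIV. (\<Prod>i\<in>J. A $ i $ p i) * (if p permutes J then 1 else 0))" if "p permutes UNIV" for p :: "'n \<Rightarrow> 'n"
  proof -
    have "(\<Prod>i\<in>UNIV. (mat 1 + A) $ i $ p i) = (\<Prod>i\<in>UNIV. A $ i $ p i + (mat 1 :: real ^ 'n ^ 'n) $ i $ p i)"
      by (simp add: add.commute)
    also have "\<dots> = (\<Sum>J\<in>Pow UNIV. (\<Prod>i\<in>J. A $ i $ p i) * (\<Prod>i\<in>UNIV - J. (mat 1 :: real ^ 'n ^ 'n) $ i $ p i))"
      by (rule prod_add) simp
    finally show ?thesis by (simp add: prod_perm_sum_expand[OF that])
  qed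
  then have "det (mat 1 + A) = (\<Sum>p | p permutes UNIV. \<Sum>J\<in>UNIV. (of_int (sign p) * (\<Prod>i\<in>J. A $ i $ p i)) * (if p permutes J then 1 else 0))"
    by (simp add: det_def sum_distrib_left mult.assoc)
  also have "\<dots> = (\<Sum>J\<in>UNIV. principal_minor A J)"
    unfolding principal_minor_def by (subst sum.swap) (simp only: sum_permutes_fixing)
  finally show ?thesis .
qed

text \<open>Rows of the identity outside \<open>J\<close> leave only the permutations of
  \<open>J\<close>; the minor becomes a value of \<open>det\<close>, to which positivity can be
  transferred.\<close>

lemma principal_minor_eq_det:
  fixes A :: "real ^ 'n ^ 'n"
  shows "principal_minor A J = det (\<chi> i j. if i \<in> J then A $ i $ j else mat 1 $ i $ j)"
proof -
  have "(\<Prod>i\<in>UNIV. (\<chi> i j. if i \<in> J then A $ i $ j else mat 1 $ i $ j) $ i $ p i)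
      = (\<Prod>i\<in>J. A $ i $ p i) * (if p permutes J then 1 else 0)" if "p permutes UNIV" for p :: "'n \<Rightarrow> 'n"
  proof -
    have "(\<Prod>i\<in>UNIV. (\<chi> i j. if i \<in> J then A $ i $ j else mat 1 $ i $ j) $ i $ p i)
       = (\<Prod>i\<in>J. A $ i $ p i) * (\<Prod>i\<in>UNIV - J. (mat 1 :: real ^ 'n ^ 'n) $ i $ p i)"
      by (subst prod.subset_diff[of J]) (auto simp: mult.commute)
    then show ?thesis by (simp add: prod_perm_sum_expand[OF that])
  qed
  then have "det (\<chi> i j. if i \<in> J then A $ i $ j else mat 1 $ i $ j) =
     (\<Sum>p | p permutes UNIV. (of_int (sign p) * (\<Prod>i\<in>J. A $ i $ p i)) * (if p permutes J then 1 else 0))"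
    by (simp add: det_def mult.assoc)
  then show ?thesis unfolding sum_permutes_fixing principal_minor_def by simp
qed

section \<open>Positive definite matrices and sign conjugation\<close>

lemma pd_matsD:
  assumes "L \<in> pd_mats"
  shows "transpose L = L" "x \<noteq> 0 \<Longrightarrow> x \<bullet> (L *v x) > 0"
  using assms by (auto simp: pd_mats_def)

lemma quad_form_inner: "x \<bullet> (A *v x) = (\<Sum>i\<in>UNIV. \<Sum>j\<in>UNIV. x $ i * A $ i $ j * x $ j)"
  by (simp add: inner_vec_def matrix_vector_mult_def sum_distrib_left mult.assoc)

text \<open>On the segment from the identity to \<open>A\<close> the quadratic form stays positive,
  so no matrix on it has a kernel. The determinant never vanishes there and keeps the sign it has at
  the identity.\<close>

lemma det_pos_of_quad_pos:
  fixes A :: "real ^ 'n ^ 'n"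
  assumes pos: "\<And>x. x \<noteq> 0 \<Longrightarrow> x \<bullet> (A *v x) > 0"
  shows "det A > 0"
proof (rule ccontr)
  assume neg: "\<not> det A > 0"
  define P where "P = (\<lambda>t::real. (1 - t) *\<^sub>R mat 1 + t *\<^sub>R A)"
  have nz: "det (P t) \<noteq> 0" if t: "0 \<le> t" "t \<le> 1" for t
  proof
    assume "det (P t) = 0"
    then obtain x where x: "x \<noteq> 0" "P t *v x = 0"
      using invertible_det_nz[of "P t"] invertible_left_inverse[of "P t"] matrix_left_invertible_ker[of "P t"] by blast
    have "x \<bullet> (P t *v x) = (1 - t) * (x \<bullet> x) + t * (x \<bullet> (A *v x))"
      by (simp add: P_def matrix_vector_mult_add_rdistrib scaleR_matrix_vector_assoc[symmetric] inner_add_right)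
    also have "\<dots> > 0"
    proof (cases "t = 0")
      case True then show ?thesis using x by simp
    next
      case False
      then have "t * (x \<bullet> (A *v x)) > 0" using t pos[OF x(1)] by simp
      moreover have "(1 - t) * (x \<bullet> x) \<ge> 0" using t by simp
      ultimately show ?thesis by linarith
    qed
    finally show False using x by simp
  qed
  have "continuous_on {0..1} (\<lambda>t. det (P t))"
    unfolding P_def det_def by (auto intro!: continuous_intros)
  moreover have "det (P 1) \<le> 0" "det (P 0) > 0" using neg by (auto simp: P_def)
  ultimately obtain t where "0 \<le> t" "t \<le> 1" "det (P t) = 0"
    using IVT2'[of "\<lambda>t. det (P t)" 1 0 0] by auto
  then show False using nz by blast
qed

lemma principal_minor_pos:
  fixes L :: "real ^ 'n ^ 'n"
  assumes L: "L \<in> pd_mats"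
  shows "principal_minor L J > 0"
proof -
  \<comment> \<open>Clearing the columns outside \<open>J\<close> in the rows of \<open>J\<close>
    leaves the minor unchanged and makes \<open>B\<close> block diagonal. Its form is then the form
    of \<open>L\<close> on the part \<open>y\<close> of \<open>x\<close> in \<open>J\<close> plus
    the squared norm of the other part \<open>z\<close>.\<close>
  define B where "B = (\<chi> i j. if i \<in> J then (if j \<in> J then L $ i $ j else 0) else mat 1 $ i $ j)"
  have "principal_minor L J = principal_minor B J"
    unfolding principal_minor_def by (intro sum.cong prod.cong arg_cong2[where f="(*)"] refl)
      (auto simp: B_def permutes_in_image)
  also have "\<dots> = det B"
    unfolding principal_minor_eq_det by (rule arg_cong[where f=det]) (simp add: B_def vec_eq_iff)
  also have "\<dots> > 0"
  proof (rule det_pos_of_quad_pos)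
    fix x :: "real ^ 'n" assume x: "x \<noteq> 0"
    define y where "y = (\<chi> i. if i \<in> J then x $ i else 0)"
    define z where "z = (\<chi> i. if i \<in> J then 0 else x $ i)"
    have Bx: "B *v x = (\<chi> i. if i \<in> J then (L *v y) $ i else x $ i)"
    proof -
      have "(\<Sum>j\<in>UNIV. (if j \<in> J then L $ i $ j else 0) * x $ j) = (\<Sum>j\<in>UNIV. L $ i $ j * (if j \<in> J then x $ j else 0))" for i
        by (intro sum.cong) auto
      moreover have "(\<Sum>j\<in>UNIV. mat 1 $ i $ j * x $ j) = x $ i" for i
        using matrix_vector_mul_lid[of x] by (simp add: matrix_vector_mult_def vec_eq_iff)
      ultimately show ?thesis by (auto simp: B_def y_def matrix_vector_mult_def vec_eq_iff)
    qed
    have "x \<bullet> (B *v x) = y \<bullet> (L *v y) + z \<bullet> z"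
    proof -
      define w where "w = L *v y"
      show ?thesis unfolding Bx w_def[symmetric]
        by (simp add: inner_vec_def y_def z_def sum.distrib[symmetric]) (intro sum.cong, auto)
    qed
    moreover have "y \<noteq> 0 \<or> z \<noteq> 0" using x by (auto simp: y_def z_def vec_eq_iff)
    ultimately show "x \<bullet> (B *v x) > 0"
      using pd_matsD(2)[OF L, of y] by (cases "y = 0") (auto simp: add_pos_nonneg)
  qed
  finally show ?thesis .
qed

lemma det_mat_1_plus_pos: "L \<in> pd_mats \<Longrightarrow> det (mat 1 + L) > 0"
  unfolding det_mat_1_plus by (rule sum_pos) (auto intro: principal_minor_pos)

lemma dpp_prob_pos: "L \<in> pd_mats \<Longrightarrow> dpp_prob L J > 0"
  by (simp add: dpp_prob_def principal_minor_pos det_mat_1_plus_pos)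

lemma dpp_prob_sum: "L \<in> pd_mats \<Longrightarrow> (\<Sum>J\<in>UNIV. dpp_prob L J) = 1"
  unfolding dpp_prob_def sum_divide_distrib[symmetric] det_mat_1_plus[symmetric]
  using det_mat_1_plus_pos[of L] by simp

lemma dpp_prob_le_1: "L \<in> pd_mats \<Longrightarrow> dpp_prob L J \<le> 1"
  using member_le_sum[of J UNIV "dpp_prob L"] dpp_prob_pos[of L] dpp_prob_sum[of L]
  by (simp add: less_imp_le)

lemma principal_minor_singleton: "principal_minor A {i} = A $ i $ i"
  by (simp add: principal_minor_def)

lemma principal_minor_doubleton:
  assumes "i \<noteq> j"
  shows "principal_minor A {i, j} = A $ i $ i * A $ j $ j - A $ i $ j * A $ j $ i"
proof -
  have *: "{p. p permutes {i, j}} = {id, Transposition.transpose i j}" by (auto simp: permutes_doubleton_iff)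
  have "id \<noteq> Transposition.transpose i j" using assms by (metis id_apply transpose_apply_first)
  then show ?thesis unfolding principal_minor_def *
    using assms by (simp add: sign_swap_id)
qed

lemma sign_mats_mult:
  assumes "D \<in> sign_mats"
  shows "(D ** L ** D) $ i $ j = D $ i $ i * L $ i $ j * D $ j $ j" and "D $ i $ i * D $ i $ i = 1"
proof -
  have D: "D $ i $ j = (if i = j then D $ i $ i else 0)" for i j
    using assms by (auto simp: sign_mats_def split: if_splits)
  have "(D ** L) $ i $ j = D $ i $ i * L $ i $ j" for i j
    unfolding matrix_matrix_mult_def by (simp, subst D) (simp add: if_distrib[of "\<lambda>x. x * _"] cong: if_cong)
  then have "(D ** L ** D) $ i $ j = (\<Sum>k\<in>UNIV. D $ i $ i * L $ i $ k * D $ k $ j)"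
    by (subst matrix_matrix_mult_def) simp
  also have "\<dots> = D $ i $ i * L $ i $ j * D $ j $ j"
    by (subst D) (simp add: if_distrib cong: if_cong)
  finally show "(D ** L ** D) $ i $ j = D $ i $ i * L $ i $ j * D $ j $ j" .
  have "D $ i $ i = -1 \<or> D $ i $ i = 1" using assms by (auto simp: sign_mats_def split: if_splits)
  then show "D $ i $ i * D $ i $ i = 1" by auto
qed

text \<open>In each product every index of \<open>J\<close> occurs once as a row and once as a
  column, so every sign is squared.\<close>

lemma principal_minor_sign_conj:
  assumes "D \<in> sign_mats"
  shows "principal_minor (D ** L ** D) J = principal_minor L J"
  unfolding principal_minor_def
proof (intro sum.cong refl arg_cong2[where f="(*)"])
  fix p assume "p \<in> {p. p permutes J}"
  then have p: "p permutes J" by simp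
  have "(\<Prod>i\<in>J. (D ** L ** D) $ i $ p i) = (\<Prod>i\<in>J. L $ i $ p i) * ((\<Prod>i\<in>J. D $ i $ i) * (\<Prod>i\<in>J. D $ p i $ p i))"
    by (simp add: sign_mats_mult[OF assms] prod.distrib[symmetric] mult_ac)
  also have "(\<Prod>i\<in>J. D $ p i $ p i) = (\<Prod>i\<in>J. D $ i $ i)"
    using prod.permute[OF p, of "\<lambda>i. D $ i $ i"] by (simp add: comp_def)
  also have "(\<Prod>i\<in>J. D $ i $ i) * (\<Prod>i\<in>J. D $ i $ i) = 1"
    by (simp add: prod.distrib[symmetric] sign_mats_mult(2)[OF assms])
  finally show "(\<Prod>i\<in>J. (D ** L ** D) $ i $ p i) = (\<Prod>i\<in>J. L $ i $ p i)" by simp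
qed

lemma pd_mats_sign_conj:
  assumes D: "D \<in> sign_mats" and L: "L \<in> pd_mats"
  shows "D ** L ** D \<in> pd_mats"
proof -
  have "L $ i $ j = L $ j $ i" for i j
    using pd_matsD(1)[OF L] by (auto simp: transpose_def vec_eq_iff)
  then have "transpose (D ** L ** D) = D ** L ** D"
    by (simp add: vec_eq_iff transpose_def sign_mats_mult[OF D] mult_ac)
  moreover have "x \<bullet> ((D ** L ** D) *v x) > 0" if "x \<noteq> 0" for x
  proof -
    define y where "y = (\<chi> i. D $ i $ i * x $ i)"
    have "x \<bullet> ((D ** L ** D) *v x) = y \<bullet> (L *v y)"
      unfolding quad_form_inner by (simp add: y_def sign_mats_mult[OF D] mult_ac)
    moreover have "y \<noteq> 0"
    proof -
      obtain i where i: "x $ i \<noteq> 0" using \<open>x \<noteq> 0\<close> unfolding vec_eq_iff zero_index by blast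
      moreover have "D $ i $ i \<noteq> 0" using sign_mats_mult(2)[OF D, of i] by auto
      ultimately show ?thesis by (auto simp: y_def vec_eq_iff)
    qed
    ultimately show ?thesis using pd_matsD(2)[OF L] by simp
  qed
  ultimately show ?thesis by (simp add: pd_mats_def)
qed

lemma dpp_prob_sign_conj:
  assumes "D \<in> sign_mats"
  shows "dpp_prob (D ** L ** D) J = dpp_prob L J"
  by (simp add: dpp_prob_def det_mat_1_plus principal_minor_sign_conj[OF assms])

text \<open>Finiteness makes \<open>Min\<close> in the alignment condition a genuine
  minimum.\<close>

lemma finite_sign_mats: "finite (sign_mats :: (real ^ 'n ^ 'n) set)"
proof (rule finite_subset)
  show "(sign_mats :: (real ^ 'n ^ 'n) set) \<subseteq> (\<lambda>f. \<chi> i j. if i = j then f i else 0) ` (UNIV \<rightarrow>\<^sub>E {-1, 1})"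
  proof
    fix D :: "real ^ 'n ^ 'n" assume "D \<in> sign_mats"
    then have "D = (\<chi> i j. if i = j then D $ i $ i else 0)" "(\<lambda>i. D $ i $ i) \<in> UNIV \<rightarrow>\<^sub>E {-1, 1}"
      by (auto simp: sign_mats_def vec_eq_iff split: if_splits)
    then show "D \<in> (\<lambda>f. \<chi> i j. if i = j then f i else 0) ` (UNIV \<rightarrow>\<^sub>E {-1, 1})" by (rule image_eqI)
  qed
qed (intro finite_imageI finite_PiE, auto)

section \<open>Principal minors and the graph of a matrix\<close>

text \<open>Follow preimages. A nonzero product makes the preimage of \<open>v i\<close> equal or
  adjacent to \<open>v i\<close>. The candidates \<open>v i\<close> and \<open>v (i - 1)\<close>
  already have other images, by induction or because \<open>v 0\<close> goes to \<open>v k\<close>,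
  and the closing edge is excluded by \<open>ends\<close>. Only \<open>v (Suc i)\<close> is
  left.\<close>

lemma perm_chain_eq:
  fixes v :: "nat \<Rightarrow> 'n" and A :: "'n \<Rightarrow> 'n \<Rightarrow> real"
  assumes inj: "inj_on v {0..k}" and k: "2 \<le> k"
    and p: "p permutes v ` {0..k}" and ends: "p (v 0) = v k" "p (v k) \<noteq> v 0"
    and chordless: "\<And>i j. i \<le> k \<Longrightarrow> j \<le> k \<Longrightarrow> i + 2 \<le> j \<Longrightarrow> \<not> (i = 0 \<and> j = k) \<Longrightarrow> A (v i) (v j) = 0 \<and> A (v j) (v i) = 0"
    and nz: "(\<Prod>x\<in>v ` {0..k}. A x (p x)) \<noteq> 0"
  shows "i < k \<Longrightarrow> p (v (Suc i)) = v i"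
proof (induction i rule: less_induct)
  case (less i)
  have vinj: "v a = v b \<longleftrightarrow> a = b" if "a \<le> k" "b \<le> k" for a b
    using inj that by (auto simp: inj_on_def)
  have "v i \<in> v ` {0..k}" using less.prems by simp
  then obtain x where x: "x \<in> v ` {0..k}" "p x = v i"
    using permutes_image[OF p] by (metis imageE)
  then obtain j where j: "j \<le> k" "p (v j) = v i" by auto
  have A: "A (v j) (v i) \<noteq> 0" using nz j x by (metis (mono_tags, lifting) finite_atLeastAtMost finite_imageI prod_zero_iff atLeastAtMost_iff image_eqI le0)
  have j0: "j \<noteq> 0" using j ends(1) vinj[of k i] less.prems by (cases "j = 0") auto
  have ji: "j \<le> Suc i"
  proof (rule ccontr)
    assume "\<not> j \<le> Suc i"
    then have "i + 2 \<le> j" "i \<le> k" using less.prems by auto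
    then have "i = 0 \<and> j = k" using chordless[of i j] A j(1) by blast
    then show False using j ends by simp
  qed
  have "i \<le> Suc j"
  proof (rule ccontr)
    assume "\<not> i \<le> Suc j"
    then show False using chordless[of j i] A j j0 less.prems by auto
  qed
  with ji have "j = Suc i \<or> j = i \<or> Suc j = i" by linarith
  moreover have "j \<noteq> i"
  proof
    assume ij: "j = i"
    then obtain i' where i': "i = Suc i'" using j0 not0_implies_Suc by blast
    then have "p (v i) = v i'" using less.IH[of i'] less.prems by auto
    then show False using j ij i' vinj[of i' i] less.prems by auto
  qed
  moreover have "Suc j \<noteq> i"
  proof
    assume ij: "Suc j = i"
    obtain j' where j': "j = Suc j'" using j0 not0_implies_Suc by blast
    then have "p (v j) = v j'" using less.IH[of j'] ij less.prems by auto
    then show False using j ij j' vinj[of j' i] less.prems by auto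
  qed
  ultimately show ?case using j by auto
qed

lemma chain_perm_exists:
  fixes v :: "nat \<Rightarrow> 'n"
  assumes inj: "inj_on v {0..k}" and k: "2 \<le> k"
  obtains c where "c permutes v ` {0..k}" "c (v 0) = v k" "\<And>i. i < k \<Longrightarrow> c (v (Suc i)) = v i" "c (v k) \<noteq> v 0"
proof -
  \<comment> \<open>The backward shift, with 0 wrapping around to \<open>k\<close>. For k = 1 it
    would be a transposition and send \<open>v k\<close> back to \<open>v 0\<close>, which
    \<open>2 \<le> k\<close> excludes.\<close>
  define s where "s = (\<lambda>i::nat. if i = 0 then k else i - 1)"
  define c where "c = (\<lambda>x. if x \<in> v ` {0..k} then v (s (inv_into {0..k} v x)) else x)"
  have cv: "c (v i) = v (s i)" if "i \<le> k" for i
    using that inj by (auto simp: c_def)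
  have "c permutes v ` {0..k}"
  proof (rule bij_imp_permutes)
    have "bij_betw s {0..k} {0..k}"
      by (rule bij_betwI[of _ _ _ "\<lambda>i. if i = k then 0 else Suc i"]) (auto simp: s_def)
    moreover have bv: "bij_betw v {0..k} (v ` {0..k})" using inj by (simp add: bij_betw_def)
    ultimately have "bij_betw (v \<circ> s \<circ> inv_into {0..k} v) (v ` {0..k}) (v ` {0..k})"
      by (meson bij_betw_trans bij_betw_inv_into)
    then show "bij_betw c (v ` {0..k}) (v ` {0..k})"
      by (rule bij_betw_cong[THEN iffD1, rotated]) (simp add: c_def)
  qed (simp add: c_def)
  moreover have "c (v 0) = v k" using cv[of 0] by (simp add: s_def)
  moreover have "c (v (Suc i)) = v i" if "i < k" for i using cv[of "Suc i"] that by (simp add: s_def)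
  moreover have "c (v k) \<noteq> v 0" using cv[of k] k inj_on_eq_iff[OF inj, of "k - 1" 0] by (auto simp: s_def)
  ultimately show ?thesis by (rule that)
qed

text \<open>In a chordless cycle the only permutations using the closing edge \<open>(v 0, v k)\<close> in exactly one
  direction are the two cyclic shifts, so flipping the sign of that edge changes the minor by
  exactly these two terms.\<close>
lemma principal_minor_flip:
  fixes A B :: "real ^ 'n ^ 'n" and v :: "nat \<Rightarrow> 'n"
  assumes inj: "inj_on v {0..k}" and k: "2 \<le> k"
    and sym: "\<And>i j. A $ i $ j = A $ j $ i" "\<And>i j. B $ i $ j = B $ j $ i"
    and chordless: "\<And>i j. i \<le> k \<Longrightarrow> j \<le> k \<Longrightarrow> i + 2 \<le> j \<Longrightarrow> \<not> (i = 0 \<and> j = k) \<Longrightarrow> A $ v i $ v j = 0"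
    and agree: "\<And>i j. i \<le> j \<Longrightarrow> j \<le> k \<Longrightarrow> \<not> (i = 0 \<and> j = k) \<Longrightarrow> B $ v i $ v j = A $ v i $ v j"
    and flip: "B $ v 0 $ v k = - A $ v 0 $ v k"
  shows "\<exists>s::real. \<bar>s\<bar> = 4 \<and> principal_minor A (v ` {0..k}) - principal_minor B (v ` {0..k})
      = s * A $ v 0 $ v k * (\<Prod>i<k. A $ v i $ v (Suc i))"
proof -
  let ?J = "v ` {0..k}" and ?a = "v 0" and ?b = "v k"
  have vinj: "v a = v b \<longleftrightarrow> a = b" if "a \<le> k" "b \<le> k" for a b
    using inj that by (auto simp: inj_on_def)
  have ab: "?a \<noteq> ?b" using vinj[of 0 k] k by simp
  have J: "finite ?J" "?a \<in> ?J" "?b \<in> ?J" by auto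
  have agree': "B $ x $ y = A $ x $ y" if xy: "x \<in> ?J" "y \<in> ?J" "\<not> (x = ?a \<and> y = ?b)" "\<not> (x = ?b \<and> y = ?a)" for x y
  proof -
    obtain i j where ij: "x = v i" "y = v j" "i \<le> k" "j \<le> k" using xy(1,2) by auto
    have "\<not> (i = 0 \<and> j = k)" "\<not> (j = 0 \<and> i = k)" using xy(3,4) ij(1,2) by blast+
    then have "i \<le> j \<Longrightarrow> B $ v i $ v j = A $ v i $ v j" "j \<le> i \<Longrightarrow> B $ v j $ v i = A $ v j $ v i"
      using agree ij(3,4) by blast+
    then show ?thesis
      unfolding ij(1,2) using sym(1)[of "v i" "v j"] sym(2)[of "v i" "v j"] by (cases "i \<le> j") simp_all
  qed
  have flip': "B $ ?b $ ?a = - A $ ?b $ ?a" using flip sym by metis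
  define rest where "rest = (\<lambda>p. \<Prod>x\<in>?J - {?a, ?b}. A $ x $ p x)"
  have split: "(\<Prod>x\<in>?J. M $ x $ p x) = M $ ?a $ p ?a * M $ ?b $ p ?b * (\<Prod>x\<in>?J - {?a, ?b}. M $ x $ p x)"
    for M :: "real ^ 'n ^ 'n" and p
  proof -
    have "?J = insert ?a (insert ?b (?J - {?a, ?b}))" using J by auto
    then have "(\<Prod>x\<in>?J. M $ x $ p x) = (\<Prod>x\<in>insert ?a (insert ?b (?J - {?a, ?b})). M $ x $ p x)" by simp
    then show ?thesis using J(1) ab by (simp add: mult.assoc)
  qed
  have restB: "(\<Prod>x\<in>?J - {?a, ?b}. B $ x $ p x) = rest p" if "p permutes ?J" for p
    unfolding rest_def using that by (intro prod.cong refl agree') (auto simp: permutes_in_image)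
  have restA: "(\<Prod>x\<in>?J - {?a, ?b}. A $ x $ p x) = rest p" for p by (simp add: rest_def)
  define d where "d = (\<lambda>p. of_int (sign p) * (\<Prod>x\<in>?J. A $ x $ p x) - of_int (sign p) * (\<Prod>x\<in>?J. B $ x $ p x) :: real)"
  \<comment> \<open>The closing edge is used in both directions, where the two sign changes cancel,
    or in neither, where both matrices give the same product.\<close>
  have d0: "d p = 0" if p: "p permutes ?J" and e: "(p ?a = ?b) = (p ?b = ?a)" for p
  proof -
    have pin: "p ?a \<in> ?J" "p ?b \<in> ?J" using p J by (simp_all add: permutes_in_image)
    have "B $ ?a $ p ?a * B $ ?b $ p ?b = A $ ?a $ p ?a * A $ ?b $ p ?b"
    proof (cases "p ?a = ?b")
      case True then show ?thesis using e flip flip' by simp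
    next
      case False then show ?thesis using e agree'[of ?a "p ?a"] agree'[of ?b "p ?b"] pin J ab by auto
    qed
    then show ?thesis unfolding d_def split restA restB[OF p] by simp
  qed
  have d1: "d p = 2 * of_int (sign p) * (\<Prod>x\<in>?J. A $ x $ p x)" if p: "p permutes ?J" and e: "p ?a = ?b" "p ?b \<noteq> ?a" for p
  proof -
    have "p ?b \<in> ?J" using p J by (simp_all add: permutes_in_image)
    then have "B $ ?a $ p ?a * B $ ?b $ p ?b = - (A $ ?a $ p ?a * A $ ?b $ p ?b)"
      using e flip agree'[of ?b "p ?b"] J ab by auto
    then show ?thesis unfolding d_def split restA restB[OF p] by simp
  qed
  have prod_inv: "(\<Prod>x\<in>?J. M $ x $ inv p x) = (\<Prod>x\<in>?J. M $ x $ p x)" if p: "p permutes ?J" and "\<And>i j. M $ i $ j = M $ j $ i" for p and M :: "real ^ 'n ^ 'n"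
  proof -
    have "(\<Prod>x\<in>?J. M $ x $ inv p x) = (\<Prod>x\<in>?J. M $ p x $ inv p (p x))"
      using prod.permute[OF p, of "\<lambda>x. M $ x $ inv p x"] by (simp add: comp_def)
    also have "\<dots> = (\<Prod>x\<in>?J. M $ x $ p x)"
      using that by (simp add: permutes_inverses(2)[OF p])
    finally show ?thesis .
  qed
  have dinv: "d (inv p) = d p" if p: "p permutes ?J" for p
  proof -
    have "permutation p" using p J(1) permutation_permutes by blast
    then have "sign (inv p) = sign p" by (rule sign_inverse)
    then show ?thesis unfolding d_def prod_inv[OF p sym(1)] prod_inv[OF p sym(2)] by simp
  qed
  obtain c where c: "c permutes ?J" "c ?a = ?b" "\<And>i. i < k \<Longrightarrow> c (v (Suc i)) = v i" "c ?b \<noteq> ?a"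
    using chain_perm_exists[OF inj k] by blast
  have unique: "p = c" if p: "p permutes ?J" and e: "p ?a = ?b" "p ?b \<noteq> ?a" and nz: "d p \<noteq> 0" for p
  proof -
    have "(\<Prod>x\<in>?J. A $ x $ p x) \<noteq> 0" using d1[OF p e] nz by auto
    then have "p (v (Suc i)) = v i" if "i < k" for i
      using perm_chain_eq[OF inj k p e, of "\<lambda>x y. A $ x $ y" i] chordless sym that by auto
    then have "p (v i) = c (v i)" if "i \<le> k" for i
      using that c e by (cases i) auto
    then have "p x = c x" if "x \<in> ?J" for x using that by auto
    then show ?thesis using permutes_not_in[OF p] permutes_not_in[OF c(1)] by (intro ext) metis
  qed
  have ic: "inv c permutes ?J" "inv c ?b = ?a" "inv c ?a \<noteq> ?b"
  proof -
    show "inv c permutes ?J" by (rule permutes_inv[OF c(1)])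
    show "inv c ?b = ?a" using permutes_inverses(2)[OF c(1), of ?a] c(2) by simp
    show "inv c ?a \<noteq> ?b" using permutes_inverses(1)[OF c(1), of ?a] c(4) by auto
  qed
  have "principal_minor A ?J - principal_minor B ?J = (\<Sum>p | p permutes ?J. d p)"
    unfolding principal_minor_def d_def by (simp add: sum_subtractf)
  also have "\<dots> = (\<Sum>p\<in>{c, inv c}. d p)"
  proof (rule sum.mono_neutral_right)
    show "finite {p. p permutes ?J}" using finite_permutations[OF J(1)] .
    show "{c, inv c} \<subseteq> {p. p permutes ?J}" using c ic by auto
    show "\<forall>p\<in>{p. p permutes ?J} - {c, inv c}. d p = 0"
    proof (intro ballI, rule ccontr)
      fix p assume p': "p \<in> {p. p permutes ?J} - {c, inv c}" and nz: "d p \<noteq> 0"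
      then have p: "p permutes ?J" "p \<noteq> c" "p \<noteq> inv c" by auto
      have "(p ?a = ?b) \<noteq> (p ?b = ?a)" using d0[OF p(1)] nz by blast
      then have "p ?b = ?a" "p ?a \<noteq> ?b" using unique[OF p(1) _ _ nz] p(2) by auto
      then have "inv p ?a = ?b" "inv p ?b \<noteq> ?a"
        using permutes_inverses(2)[OF p(1), of ?b] permutes_inverses(1)[OF p(1), of ?b] by auto
      then have "inv p = c" using unique[OF permutes_inv[OF p(1)]] dinv[OF p(1)] nz by simp
      then show False using p(3) permutes_inv_inv[OF p(1)] by simp
    qed
  qed
  also have "\<dots> = d c + d (inv c)"
  proof -
    have "c \<noteq> inv c" using c(2) ic(3) by auto
    then show ?thesis by simp
  qed
  \<comment> \<open>By symmetry the two shifts contribute equally, and each contributes twice its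
    own product because flipping the closing edge negates it; hence the factor 4.\<close>
  also have "\<dots> = 4 * of_int (sign c) * (\<Prod>x\<in>?J. A $ x $ c x)"
    using dinv[OF c(1)] d1[OF c(1,2,4)] by simp
  also have "(\<Prod>x\<in>?J. A $ x $ c x) = (\<Prod>i\<in>{0..k}. A $ v i $ c (v i))"
    using inj by (simp add: prod.reindex)
  also have "\<dots> = A $ ?a $ ?b * (\<Prod>i<k. A $ v i $ v (Suc i))"
  proof -
    have "(\<Prod>i\<in>{0..k}. A $ v i $ c (v i)) = A $ ?a $ c ?a * (\<Prod>i\<in>{1..k}. A $ v i $ c (v i))"
      by (simp add: prod.atLeast_Suc_atMost)
    also have "(\<Prod>i\<in>{1..k}. A $ v i $ c (v i)) = (\<Prod>i<k. A $ v (Suc i) $ c (v (Suc i)))"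
      by (rule prod.reindex_bij_witness[of _ Suc "\<lambda>i. i - 1"]) auto
    also have "\<dots> = (\<Prod>i<k. A $ v i $ v (Suc i))" by (intro prod.cong refl) (simp add: c(3) sym(1)[of "v (Suc _)"])
    finally show ?thesis by (simp only: c(2))
  qed
  finally show ?thesis
    by (intro exI[of _ "4 * of_int (sign c)"] conjI) (simp_all add: sign_def mult.assoc)
qed

section \<open>Walks in the graph of a matrix and irreducibility\<close>

definition walk :: "real ^ 'n ^ 'n \<Rightarrow> 'n set \<Rightarrow> nat \<Rightarrow> (nat \<Rightarrow> 'n) \<Rightarrow> bool" where
  "walk L W m v \<longleftrightarrow> (\<forall>t\<le>m. v t \<in> W) \<and> (\<forall>t<m. L $ v t $ v (Suc t) \<noteq> 0)"

lemma walk_sub: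
  assumes "walk L W m v" "i \<le> j" "j \<le> m"
  shows "walk L W (j - i) (\<lambda>t. v (i + t))"
  using assms by (auto simp: walk_def)

lemma walk_shortcut:
  assumes w: "walk L W m v" and ij: "i < j" "j \<le> m" and e: "L $ v i $ v j \<noteq> 0"
  shows "walk L W (m - (j - i - 1)) (\<lambda>t. if t \<le> i then v t else v (t + (j - i - 1)))"
  unfolding walk_def
proof (intro conjI allI impI)
  fix t assume t: "t < m - (j - i - 1)"
  consider "Suc t \<le> i" | "t = i" | "i < t" by linarith
  then show "L $ (if t \<le> i then v t else v (t + (j - i - 1))) $ (if Suc t \<le> i then v (Suc t) else v (Suc t + (j - i - 1))) \<noteq> 0"
  proof cases
    case 2
    then have "Suc t + (j - i - 1) = j" using ij by simp
    then show ?thesis using 2 e by simp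
  qed (use w t ij in \<open>auto simp: walk_def\<close>)
qed (use w ij in \<open>auto simp: walk_def\<close>)

lemma walk_loop:
  assumes w: "walk L W m v" and ij: "i < j" "j \<le> m" and e: "v i = v j"
  shows "walk L W (m - (j - i)) (\<lambda>t. if t \<le> i then v t else v (t + (j - i)))"
  unfolding walk_def
proof (intro conjI allI impI)
  fix t assume t: "t < m - (j - i)"
  consider "Suc t \<le> i" | "t = i" | "i < t" by linarith
  then show "L $ (if t \<le> i then v t else v (t + (j - i))) $ (if Suc t \<le> i then v (Suc t) else v (Suc t + (j - i))) \<noteq> 0"
  proof cases
    case 2
    then have "Suc t + (j - i) = Suc j" "j < m" using ij t by simp_all
    then show ?thesis using 2 e w by (auto simp: walk_def)
  qed (use w t ij in \<open>auto simp: walk_def\<close>)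
qed (use w ij in \<open>auto simp: walk_def\<close>)

text \<open>A repeated vertex could be cut out as a loop and a chord could be used as a shortcut;
  both give a shorter walk with the same ends. Minimal walks are thus the induced paths from which
  the chordless cycles of \<open>principal_minor_flip\<close> are built.\<close>

lemma minimal_walk:
  assumes w: "walk L W m v"
    and min: "\<And>m' v'. walk L W m' v' \<Longrightarrow> v' 0 = v 0 \<Longrightarrow> v' m' = v m \<Longrightarrow> m \<le> m'"
  shows "inj_on v {0..m}"
    and "\<And>i j. i + 2 \<le> j \<Longrightarrow> j \<le> m \<Longrightarrow> L $ v i $ v j = 0"
proof -
  have "v i \<noteq> v j" if ij: "i < j" "j \<le> m" for i j
  proof
    assume e: "v i = v j"
    \<comment> \<open>If the loop closes at the very end, the last vertex of the shortened walk is
      read off as \<open>v i\<close>, which is then equal to \<open>v m\<close>.\<close>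
    have "m - (j - i) \<le> i \<Longrightarrow> m = j" using ij by linarith
    then have "m \<le> m - (j - i)"
      using ij e by (intro min[OF walk_loop[OF w ij e]]) auto
    then show False using ij by linarith
  qed
  then show "inj_on v {0..m}"
    by (intro linorder_inj_onI) auto
  fix i j assume ij: "i + 2 \<le> j" "j \<le> m"
  show "L $ v i $ v j = 0"
  proof (rule ccontr)
    assume e: "L $ v i $ v j \<noteq> 0"
    have "m \<le> m - (j - i - 1)"
      using ij by (intro min[OF walk_shortcut[OF w _ _ e]]) auto
    then show False using ij by linarith
  qed
qed

definition walk_connected :: "real ^ 'n ^ 'n \<Rightarrow> 'n set \<Rightarrow> bool" where
  "walk_connected L W \<longleftrightarrow> (\<forall>x\<in>W. \<forall>y\<in>W. \<exists>m v. walk L W m v \<and> v 0 = x \<and> v m = y)"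

lemma walk_mono: "walk L W m v \<Longrightarrow> W \<subseteq> W' \<Longrightarrow> walk L W' m v"
  by (auto simp: walk_def)

lemma walk_connected_insert:
  assumes W: "walk_connected L W" and w: "w \<in> W" and e: "L $ x $ w \<noteq> 0" "L $ w $ x \<noteq> 0"
  shows "walk_connected L (insert x W)"
proof -
  have triv: "walk L (insert x W) 0 (\<lambda>_. x)" by (simp add: walk_def)
  have to: "\<exists>m v. walk L (insert x W) m v \<and> v 0 = y \<and> v m = w" if "y \<in> insert x W" for y
  proof (cases "y \<in> W")
    case True then show ?thesis using W w walk_mono[of L W _ _ "insert x W"] unfolding walk_connected_def by (metis subset_insertI)
  next
    case False
    then have "y = x" using that by simp
    then show ?thesis using e w
      by (intro exI[of _ "1::nat"] exI[of _ "\<lambda>t::nat. if t = 0 then x else w"]) (auto simp: walk_def)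
  qed
  have from': "\<exists>m v. walk L (insert x W) m v \<and> v 0 = w \<and> v m = y" if "y \<in> insert x W" for y
  proof (cases "y \<in> W")
    case True then show ?thesis using W w walk_mono[of L W _ _ "insert x W"] unfolding walk_connected_def by (metis subset_insertI)
  next
    case False
    then have "y = x" using that by simp
    then show ?thesis using e w
      by (intro exI[of _ "1::nat"] exI[of _ "\<lambda>t::nat. if t = 0 then w else x"]) (auto simp: walk_def)
  qed
  show ?thesis unfolding walk_connected_def
  proof (intro ballI)
    fix a b assume a: "a \<in> insert x W" and b: "b \<in> insert x W"
    obtain m v where v: "walk L (insert x W) m v" "v 0 = a" "v m = w" using to[OF a] by blast
    obtain m' v' where v': "walk L (insert x W) m' v'" "v' 0 = w" "v' m' = b" using from'[OF b] by blast
    have "walk L (insert x W) (m + m') (\<lambda>t. if t \<le> m then v t else v' (t - m))"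
      unfolding walk_def
    proof (intro conjI allI impI)
      fix t assume t: "t < m + m'"
      consider "t < m" | "t = m" | "m < t" by linarith
      then show "L $ (if t \<le> m then v t else v' (t - m)) $ (if Suc t \<le> m then v (Suc t) else v' (Suc t - m)) \<noteq> 0"
      proof cases
        case 2 then show ?thesis using v v' t by (auto simp: walk_def)
      next
        case 3
        then have "Suc t - m = Suc (t - m)" "t - m < m'" using t by auto
        then show ?thesis using 3 v' by (auto simp: walk_def)
      qed (use v v' in \<open>auto simp: walk_def\<close>)
    qed (use v v' in \<open>auto simp: walk_def\<close>)
    then show "\<exists>m v. walk L (insert x W) m v \<and> v 0 = a \<and> v m = b"
      using v v' by (intro exI[of _ "m + m'"] exI[of _ "\<lambda>t. if t \<le> m then v t else v' (t - m)"]) auto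
  qed
qed

text \<open>Without a crossing edge, \<open>W\<close> and its complement would be a forbidden
  partition into two blocks.\<close>

lemma irreducible_mat_crossing:
  fixes L :: "real ^ 'n ^ 'n"
  assumes irr: "irreducible_mat L" and sym: "\<And>i j. L $ i $ j = L $ j $ i"
    and W: "W \<noteq> {}" "W \<noteq> UNIV"
  obtains x w where "x \<notin> W" "w \<in> W" "L $ x $ w \<noteq> 0"
proof -
  have "\<exists>x w. x \<notin> W \<and> w \<in> W \<and> L $ x $ w \<noteq> 0"
  proof (rule ccontr)
    assume none: "\<not> ?thesis"
    have "W \<noteq> - W" using W(1) by blast
    then have "card {W, - W} = 2" by simp
    moreover have "partition_on UNIV {W, - W}" using W by (auto simp: partition_on_def disjoint_def)
    moreover have "\<forall>A\<in>{W, - W}. \<forall>B\<in>{W, - W}. A \<noteq> B \<longrightarrow> (\<forall>i\<in>A. \<forall>j\<in>B. L $ i $ j = 0)"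
      using none sym by (auto; metis)
    ultimately show False using irr unfolding irreducible_mat_def by (metis order_refl)
  qed
  then show ?thesis using that by blast
qed

text \<open>A connected set grows by one vertex across a crossing edge until it fills the index
  type.\<close>

lemma irreducible_mat_walk_connected:
  fixes L :: "real ^ 'n ^ 'n"
  assumes irr: "irreducible_mat L" and sym: "\<And>i j. L $ i $ j = L $ j $ i"
  shows "walk_connected L UNIV"
proof -
  have "\<exists>W. walk_connected L W \<and> card W = n" if "1 \<le> n" "n \<le> CARD('n)" for n
    using that
  proof (induction n rule: dec_induct)
    case base
    show ?case
      by (intro exI[of _ "{undefined}"])
        (auto simp: walk_connected_def walk_def intro!: exI[of _ "0::nat"] exI[of _ "\<lambda>_. undefined"])
  next
    case (step n)
    then obtain W where W: "walk_connected L W" "card W = n" by auto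
    then have "W \<noteq> {}" "W \<noteq> UNIV" using step by auto
    then obtain x w where xw: "x \<notin> W" "w \<in> W" "L $ x $ w \<noteq> 0"
      using irreducible_mat_crossing[OF irr sym] by metis
    then show ?case
      using walk_connected_insert[OF W(1) xw(2,3)] sym[of x w] W(2)
      by (intro exI[of _ "insert x W"]) auto
  qed
  from this[of "CARD('n)"] obtain W where W: "walk_connected L W" "card W = CARD('n)" by (auto simp: Suc_le_eq)
  then have "W = UNIV" by (intro card_subset_eq) auto
  with W show ?thesis by simp
qed

text \<open>Conjugating \<open>L'\<close> by the known signs gives \<open>B\<close>, which equals
  \<open>L\<close> on \<open>W\<close>. Minors of size 1 and 2 show that row \<open>x\<close> of
  \<open>B\<close> agrees with that of \<open>L\<close> up to signs, and the point is that these
  signs are all equal. Otherwise a shortest walk in \<open>W\<close> leads from a neighbour of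
  \<open>x\<close> with sign + to one with sign -. Closed up through \<open>x\<close> it is a
  chordless cycle on which \<open>B\<close> is \<open>L\<close> with one edge flipped, so the minors
  on it differ, a contradiction.\<close>

lemma minors_agree_extend:
  fixes L L' :: "real ^ 'n ^ 'n" and d :: "'n \<Rightarrow> real"
  assumes sym: "\<And>i j. L $ i $ j = L $ j $ i" "\<And>i j. L' $ i $ j = L' $ j $ i"
    and minors: "\<And>J. principal_minor L' J = principal_minor L J"
    and conn: "walk_connected L W" and d: "\<And>i. d i \<in> {-1, 1}"
    and agree: "\<And>i j. i \<in> W \<Longrightarrow> j \<in> W \<Longrightarrow> L' $ i $ j = d i * L $ i $ j * d j" and x: "x \<notin> W"
  shows "\<exists>e\<in>{-1, 1}. \<forall>j\<in>W. L' $ x $ j = e * L $ x $ j * d j"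
proof -
  define D :: "real ^ 'n ^ 'n" where "D = (\<chi> i j. if i = j then d i else 0)"
  have D: "D \<in> sign_mats" using d by (auto simp: D_def sign_mats_def)
  have dd: "d i * d i = 1" "d i * (d i * c) = c" for i c using d[of i] by auto
  define B where "B = D ** L' ** D"
  have Bij: "B $ i $ j = d i * L' $ i $ j * d j" for i j
    unfolding B_def sign_mats_mult(1)[OF D] by (simp add: D_def)
  have Bm: "principal_minor B J = principal_minor L J" for J
    unfolding B_def by (simp add: principal_minor_sign_conj[OF D] minors)
  have symB: "B $ i $ j = B $ j $ i" for i j using sym(2)[of i j] by (simp add: Bij)
  have BW: "B $ i $ j = L $ i $ j" if "i \<in> W" "j \<in> W" for i j
    by (simp add: Bij agree[OF that] dd mult.commute mult.left_commute)
  have diag: "B $ i $ i = L $ i $ i" for i using Bm[of "{i}"] by (simp add: principal_minor_singleton)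
  have sq: "B $ i $ j = L $ i $ j \<or> B $ i $ j = - L $ i $ j" for i j
  proof (cases "i = j")
    case False
    then have "(B $ i $ j)\<^sup>2 = (L $ i $ j)\<^sup>2"
      using Bm[of "{i, j}"] sym(1)[of i j] symB[of i j]
      by (simp add: principal_minor_doubleton diag power2_eq_square)
    then show ?thesis by (simp add: power2_eq_iff)
  qed (simp add: diag)
  have "(\<forall>j\<in>W. B $ x $ j = L $ x $ j) \<or> (\<forall>j\<in>W. B $ x $ j = - L $ x $ j)"
  proof (rule ccontr)
    assume "\<not> ?thesis"
    then obtain y z where yz: "y \<in> W" "B $ x $ y = L $ x $ y" "L $ x $ y \<noteq> 0" "z \<in> W" "B $ x $ z = - L $ x $ z" "L $ x $ z \<noteq> 0"
      using sq by (metis add.inverse_neutral)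
    define P where "P = (\<lambda>m. \<exists>v. walk L W m v \<and> L $ x $ v 0 \<noteq> 0 \<and> B $ x $ v 0 = L $ x $ v 0 \<and> L $ x $ v m \<noteq> 0 \<and> B $ x $ v m = - L $ x $ v m)"
    have "\<exists>m. P m"
      using conn yz unfolding walk_connected_def P_def by metis
    then have Pm: "P (LEAST m. P m)" by (rule LeastI_ex)
    define m where "m = (LEAST m. P m)"
    have least: "m \<le> n" if "P n" for n unfolding m_def using that by (rule Least_le)
    obtain v where v: "walk L W m v" "L $ x $ v 0 \<noteq> 0" "B $ x $ v 0 = L $ x $ v 0" "L $ x $ v m \<noteq> 0" "B $ x $ v m = - L $ x $ v m"
      using Pm[folded m_def] unfolding P_def by blast
    have m: "1 \<le> m" using v by (cases m) auto
    \<comment> \<open>An inner vertex adjacent to \<open>x\<close> has one of the two signs, and so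
      splits off a shorter walk of the same kind: the final piece for sign +, the initial piece for
      sign -.\<close>
    have inner: "L $ x $ v s = 0" if s: "1 \<le> s" "s < m" for s
    proof (rule ccontr)
      assume nz: "L $ x $ v s \<noteq> 0"
      from sq[of x "v s"] show False
      proof
        assume "B $ x $ v s = L $ x $ v s"
        then have "P (m - s)" unfolding P_def using s v nz walk_sub[OF v(1), of s m]
          by (intro exI[of _ "\<lambda>t. v (s + t)"]) auto
        then show False using least s by force
      next
        assume "B $ x $ v s = - L $ x $ v s"
        then have "P s" unfolding P_def using s v nz walk_sub[OF v(1), of 0 s]
          by (intro exI[of _ v]) auto
        then show False using least s by force
      qed
    qed
    have min: "m \<le> m'" if "walk L W m' v'" "v' 0 = v 0" "v' m' = v m" for m' v'
      using that v unfolding P_def by (intro least) (auto simp: P_def)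
    have mw: "inj_on v {0..m}" "\<And>i j. i + 2 \<le> j \<Longrightarrow> j \<le> m \<Longrightarrow> L $ v i $ v j = 0"
      using minimal_walk[OF v(1)] min by blast+
    \<comment> \<open>Prepending \<open>x\<close> shifts the walk by one, and the closing edge from
      \<open>x\<close> to \<open>v m\<close> is the flipped one. Since \<open>1 \<le> m\<close>, the
      last index \<open>Suc m\<close> is at least 2, as the flip lemma demands.\<close>
    define u where "u = (\<lambda>t. case t of 0 \<Rightarrow> x | Suc s \<Rightarrow> v s)"
    have [simp]: "u 0 = x" "u (Suc s) = v s" for s by (simp_all add: u_def)
    have vW: "v s \<in> W" if "s \<le> m" for s using v(1) that by (simp add: walk_def)
    have inju: "inj_on u {0..Suc m}"
    proof (rule linorder_inj_onI)
      fix i j :: nat assume ij: "i < j" "i \<in> {0..Suc m}" "j \<in> {0..Suc m}"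
      then obtain j' where j': "j = Suc j'" "j' \<le> m" by (cases j) auto
      show "u i \<noteq> u j"
      proof (cases i)
        case 0 then show ?thesis using j' vW[of j'] x by auto
      next
        case (Suc i') then show ?thesis using inj_onD[OF mw(1), of i' j'] ij j' by auto
      qed
    qed auto
    have "\<exists>s::real. \<bar>s\<bar> = 4 \<and> principal_minor L (u ` {0..Suc m}) - principal_minor B (u ` {0..Suc m})
      = s * L $ u 0 $ u (Suc m) * (\<Prod>i<Suc m. L $ u i $ u (Suc i))"
    proof (rule principal_minor_flip[OF inju])
      show "L $ u i $ u j = 0" if ij: "i \<le> Suc m" "j \<le> Suc m" "i + 2 \<le> j" "\<not> (i = 0 \<and> j = Suc m)" for i j
      proof -
        obtain j' where j': "j = Suc j'" using ij by (cases j) auto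
        then show ?thesis using ij inner[of j'] mw(2)[of "i - 1" j'] by (cases i) auto
      qed
      show "B $ u i $ u j = L $ u i $ u j" if ij: "i \<le> j" "j \<le> Suc m" "\<not> (i = 0 \<and> j = Suc m)" for i j
      proof (cases j)
        case 0 then show ?thesis using ij diag by simp
      next
        case (Suc j')
        show ?thesis
        proof (cases i)
          case 0
          show ?thesis
          proof (cases "j' = 0")
            case True then show ?thesis using 0 Suc v by simp
          next
            case False
            then have "L $ x $ v j' = 0" using inner[of j'] ij 0 Suc by auto
            then show ?thesis using 0 Suc sq[of x "v j'"] by auto
          qed
        next
          case (Suc i') then show ?thesis using \<open>j = Suc j'\<close> BW vW ij by auto
        qed
      qed
    qed (use m sym symB v in auto)
    then obtain s :: real where "\<bar>s\<bar> = 4" "s * L $ u 0 $ u (Suc m) * (\<Prod>i<Suc m. L $ u i $ u (Suc i)) = 0"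
      using Bm by auto
    moreover have "L $ u i $ u (Suc i) \<noteq> 0" if "i < Suc m" for i
      using that v by (cases i) (auto simp: walk_def)
    ultimately show False using v by auto
  qed
  then have "(\<forall>j\<in>W. L' $ x $ j = d x * L $ x $ j * d j) \<or> (\<forall>j\<in>W. L' $ x $ j = - d x * L $ x $ j * d j)"
  proof (rule disj_forward)
    assume *: "\<forall>j\<in>W. B $ x $ j = L $ x $ j"
    show "\<forall>j\<in>W. L' $ x $ j = d x * L $ x $ j * d j"
      using * by (metis Bij dd(2) mult.assoc mult.commute)
  next
    assume *: "\<forall>j\<in>W. B $ x $ j = - L $ x $ j"
    show "\<forall>j\<in>W. L' $ x $ j = - d x * L $ x $ j * d j"
    proof
      fix j assume "j \<in> W"
      then have "d x * (d x * L' $ x $ j * d j) * d j = d x * (- L $ x $ j) * d j" using * by (simp add: Bij)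
      then show "L' $ x $ j = - d x * L $ x $ j * d j" using dd(1)[of x] dd(1)[of j] by (simp add: mult_ac) (metis dd(2) mult.commute mult.left_commute)
    qed
  qed
  moreover have "d x \<in> {-1, 1}" "- d x \<in> {-1, 1}" using d[of x] by auto
  ultimately show ?thesis by blast
qed

text \<open>The signs are fixed vertex by vertex. Each new vertex is reached by a crossing edge, so
  the matched set stays walk-connected and \<open>minors_agree_extend\<close> applies again.\<close>

theorem principal_minors_determine:
  fixes L L' :: "real ^ 'n ^ 'n"
  assumes irr: "irreducible_mat L"
    and sym: "\<And>i j. L $ i $ j = L $ j $ i" "\<And>i j. L' $ i $ j = L' $ j $ i"
    and minors: "\<And>J. principal_minor L' J = principal_minor L J"
  obtains D where "D \<in> sign_mats" "L' = D ** L ** D"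
proof -
  have diag: "L' $ i $ i = L $ i $ i" for i using minors[of "{i}"] by (simp add: principal_minor_singleton)
  have "\<exists>W d. walk_connected L W \<and> card W = n \<and> (\<forall>i. d i \<in> {-1, 1 :: real}) \<and>
      (\<forall>i\<in>W. \<forall>j\<in>W. L' $ i $ j = d i * L $ i $ j * d j)" if "1 \<le> n" "n \<le> CARD('n)" for n
    using that
  proof (induction n rule: dec_induct)
    case base
    have "walk_connected L {undefined}"
      by (auto simp: walk_connected_def walk_def intro!: exI[of _ "0::nat"] exI[of _ "\<lambda>_. undefined"])
    then show ?case
      by (intro exI[of _ "{undefined}"] exI[of _ "\<lambda>_. 1"]) (auto simp: diag)
  next
    case (step n)
    have "n \<le> CARD('n)" using step.prems by simp
    from step.IH[OF this] obtain W d where W: "walk_connected L W" "card W = n" and d: "\<And>i. d i \<in> {-1, 1 :: real}"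
      and agree: "\<And>i j. i \<in> W \<Longrightarrow> j \<in> W \<Longrightarrow> L' $ i $ j = d i * L $ i $ j * d j" by blast
    then have "W \<noteq> {}" "W \<noteq> UNIV" using step by auto
    then obtain x w where xw: "x \<notin> W" "w \<in> W" "L $ x $ w \<noteq> 0"
      using irreducible_mat_crossing[OF irr sym(1)] by metis
    obtain e where e: "e \<in> {-1, 1}" "\<And>j. j \<in> W \<Longrightarrow> L' $ x $ j = e * L $ x $ j * d j"
      using minors_agree_extend[OF sym minors W(1) d agree xw(1)] by blast
    have "L' $ i $ j = (d(x := e)) i * L $ i $ j * (d(x := e)) j" if "i \<in> insert x W" "j \<in> insert x W" for i j
    proof (cases "i = x")
      case True
      then show ?thesis using e that(2) xw(1) diag by (cases "j = x") auto
    next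
      case False
      then have i: "i \<in> W" using that by simp
      show ?thesis
      proof (cases "j = x")
        case True then show ?thesis using e(2)[OF i] sym[of i x] False by (simp add: mult_ac)
      next
        case F: False then show ?thesis using agree[of i j] that False by simp
      qed
    qed
    moreover have "walk_connected L (insert x W)"
      using walk_connected_insert[OF W(1) xw(2,3)] sym(1)[of x w] xw(3) by simp
    moreover have "card (insert x W) = Suc n" using W xw(1) by simp
    moreover have "(d(x := e)) i \<in> {-1, 1}" for i using d e(1) by simp
    ultimately show ?case by blast
  qed
  note * = this[of "CARD('n)"]
  have "1 \<le> CARD('n)" by (simp add: Suc_le_eq)
  from *[OF this order_refl] obtain W d where W: "card W = CARD('n)" and d: "\<And>i. d i \<in> {-1, 1 :: real}"
    and agree: "\<And>i j. i \<in> W \<Longrightarrow> j \<in> W \<Longrightarrow> L' $ i $ j = d i * L $ i $ j * d j" by blast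
  have [simp]: "W = UNIV" using W by (intro card_subset_eq) auto
  define D :: "real ^ 'n ^ 'n" where "D = (\<chi> i j. if i = j then d i else 0)"
  have D: "D \<in> sign_mats" using d by (auto simp: D_def sign_mats_def)
  have "L' = D ** L ** D" unfolding vec_eq_iff sign_mats_mult(1)[OF D] using agree by (simp add: D_def)
  with D show ?thesis by (rule that)
qed

text \<open>The infinitesimal form of identifiability. Minors of size 1 and 2 make \<open>H\<close>
  vanish on the diagonal and on the edges of \<open>L\<close>. If \<open>H\<close> is nonzero
  elsewhere, take a shortest walk in the graph of \<open>L\<close> between the ends of a nonzero
  entry of \<open>H\<close>. No other entry of \<open>H\<close> lives on this walk, so
  \<open>L + t *\<^sub>R H\<close> and \<open>L - t *\<^sub>R H\<close> differ there only by a sign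
  on the closing edge, and the flip lemma makes the difference of the two minors linear in t with
  nonzero slope.\<close>

theorem principal_minors_derivative_injective:
  fixes L H :: "real ^ 'n ^ 'n"
  assumes irr: "irreducible_mat L"
    and sym: "\<And>i j. L $ i $ j = L $ j $ i" "\<And>i j. H $ i $ j = H $ j $ i"
    and deriv: "\<And>J. ((\<lambda>t. principal_minor (L + t *\<^sub>R H) J) has_real_derivative 0) (at 0)"
  shows "H = 0"
proof -
  have diag: "H $ i $ i = 0" for i
  proof -
    have "((\<lambda>t. L $ i $ i + t * H $ i $ i) has_real_derivative H $ i $ i) (at 0)"
      by (auto intro!: derivative_eq_intros)
    from DERIV_unique[OF this] show ?thesis using deriv[of "{i}"] by (simp add: principal_minor_singleton)
  qed
  have edge: "H $ i $ j = 0" if nz: "L $ i $ j \<noteq> 0" for i j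
  proof (cases "i = j")
    case False
    have "((\<lambda>t. principal_minor (L + t *\<^sub>R H) {i, j}) has_real_derivative - 2 * L $ i $ j * H $ i $ j) (at 0)"
      unfolding principal_minor_doubleton[OF False]
      by (auto intro!: derivative_eq_intros simp: diag sym(1)[of j i] sym(2)[of j i])
    from DERIV_unique[OF this deriv] show ?thesis using nz by simp
  qed (simp add: diag)
  show ?thesis
  proof (rule ccontr)
    assume "H \<noteq> 0"
    then obtain a b where ab: "H $ a $ b \<noteq> 0" by (metis vec_eq_iff zero_index)
    define P where "P = (\<lambda>m. \<exists>v. walk L UNIV m v \<and> H $ v 0 $ v m \<noteq> 0)"
    have "\<exists>m. P m"
      using irreducible_mat_walk_connected[OF irr sym(1)] ab unfolding walk_connected_def P_def by (metis UNIV_I)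
    then have Pm: "P (LEAST m. P m)" by (rule LeastI_ex)
    define m where "m = (LEAST m. P m)"
    have least: "m \<le> n" if "P n" for n unfolding m_def using that by (rule Least_le)
    obtain v where v: "walk L UNIV m v" "H $ v 0 $ v m \<noteq> 0"
      using Pm[folded m_def] unfolding P_def by blast
    have min: "m \<le> m'" if "walk L UNIV m' v'" "v' 0 = v 0" "v' m' = v m" for m' v'
      using that v by (intro least) (auto simp: P_def)
    have mw: "inj_on v {0..m}" "\<And>i j. i + 2 \<le> j \<Longrightarrow> j \<le> m \<Longrightarrow> L $ v i $ v j = 0"
      using minimal_walk[OF v(1)] min by blast+
    have m2: "2 \<le> m"
    proof (rule ccontr)
      assume "\<not> 2 \<le> m"
      then have "m = 0 \<or> m = 1" by auto
      then show False using v diag edge[of "v 0" "v 1"] by (auto simp: walk_def)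
    qed
    have H0: "H $ v i $ v j = 0" if ij: "i \<le> j" "j \<le> m" "\<not> (i = 0 \<and> j = m)" for i j
    proof (rule ccontr)
      assume "H $ v i $ v j \<noteq> 0"
      then have "P (j - i)" unfolding P_def using walk_sub[OF v(1) ij(1,2)] ij(1)
        by (intro exI[of _ "\<lambda>t. v (i + t)"]) auto
      then show False using least ij by force
    qed
    have Lab: "L $ v 0 $ v m = 0" using mw(2)[of 0 m] m2 by simp
    let ?J = "v ` {0..m}"
    define f where "f = (\<lambda>t. principal_minor (L + t *\<^sub>R H) ?J)"
    define \<kappa> where "\<kappa> = 4 * \<bar>H $ v 0 $ v m\<bar> * \<bar>\<Prod>i<m. L $ v i $ v (Suc i)\<bar>"
    have "(\<Prod>i<m. L $ v i $ v (Suc i)) \<noteq> 0" using v(1) by (simp add: walk_def)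
    then have \<kappa>: "\<kappa> > 0" using v(2) by (simp add: \<kappa>_def)
    have diff: "\<bar>f t - f (- t)\<bar> = \<bar>t\<bar> * \<kappa>" for t
    proof -
      have "\<exists>s::real. \<bar>s\<bar> = 4 \<and> principal_minor (L + t *\<^sub>R H) ?J - principal_minor (L + (- t) *\<^sub>R H) ?J
        = s * (L + t *\<^sub>R H) $ v 0 $ v m * (\<Prod>i<m. (L + t *\<^sub>R H) $ v i $ v (Suc i))"
      proof (rule principal_minor_flip[OF mw(1) m2])
        show "(L + t *\<^sub>R H) $ v i $ v j = 0" if "i \<le> m" "j \<le> m" "i + 2 \<le> j" "\<not> (i = 0 \<and> j = m)" for i j
          using that mw(2)[of i j] H0[of i j] by simp
        show "(L + (- t) *\<^sub>R H) $ v i $ v j = (L + t *\<^sub>R H) $ v i $ v j" if "i \<le> j" "j \<le> m" "\<not> (i = 0 \<and> j = m)" for i j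
          using H0[OF that] by simp
      qed (use sym Lab in \<open>auto simp: sym(1) sym(2)\<close>)
      moreover have "(\<Prod>i<m. (L + t *\<^sub>R H) $ v i $ v (Suc i)) = (\<Prod>i<m. L $ v i $ v (Suc i))"
      proof (rule prod.cong)
        fix i assume "i \<in> {..<m}"
        then show "(L + t *\<^sub>R H) $ v i $ v (Suc i) = L $ v i $ v (Suc i)"
          using H0[of i "Suc i"] m2 by (cases "i = 0") simp_all
      qed simp
      ultimately show ?thesis by (auto simp: f_def \<kappa>_def Lab abs_mult)
    qed
    \<comment> \<open>By hypothesis the quotient of \<open>f t - f (- t)\<close> by \<open>t\<close>
      tends to 0, whereas \<open>diff\<close> says that its modulus is constantly
      \<open>\<kappa>\<close>.\<close>
    have "((\<lambda>t. f t - f (- t)) has_real_derivative 0 - 0 * (-1)) (at 0)"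
      using deriv[of ?J] unfolding f_def[symmetric]
      by (intro DERIV_diff DERIV_chain2[of f 0 "\<lambda>t. - t"]) (auto intro!: derivative_eq_intros)
    then have "((\<lambda>t. (f t - f (- t)) / t) \<longlongrightarrow> 0) (at 0)"
      by (simp add: has_field_derivative_iff)
    then have "((\<lambda>t. \<bar>(f t - f (- t)) / t\<bar>) \<longlongrightarrow> \<bar>0\<bar>) (at 0)" by (rule tendsto_rabs)
    moreover have "\<forall>\<^sub>F t::real in at 0. \<bar>(f t - f (- t)) / t\<bar> = \<kappa>"
      by (rule eventually_mono[OF eventually_neq_at_within[of 0]]) (simp add: diff)
    ultimately have "((\<lambda>t::real. \<kappa>) \<longlongrightarrow> 0) (at 0)" by (simp add: tendsto_cong)
    then show False using \<kappa> by (simp add: tendsto_const_iff)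
  qed
qed

section \<open>Scores and directional derivatives\<close>

lemma sym_matsD: "A \<in> sym_mats \<Longrightarrow> A $ i $ j = A $ j $ i"
  by (auto simp: sym_mats_def transpose_def vec_eq_iff)

lemma sym_matsI: "(\<And>i j. A $ i $ j = A $ j $ i) \<Longrightarrow> A \<in> sym_mats"
  by (auto simp: sym_mats_def transpose_def vec_eq_iff)

lemma pd_mats_sym: "L \<in> pd_mats \<Longrightarrow> L \<in> sym_mats"
  by (simp add: pd_mats_def sym_mats_def)

lemma subspace_sym_mats: "subspace (sym_mats :: (real ^ 'n ^ 'n) set)"
  unfolding subspace_def by (auto intro!: sym_matsI dest: sym_matsD) (metis sym_matsD)+

text \<open>The orthogonal projection onto \<open>sym_mats\<close>.\<close>

definition symz :: "real ^ 'n ^ 'n \<Rightarrow> real ^ 'n ^ 'n" where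
  "symz A = (1 / 2) *\<^sub>R (A + transpose A)"

lemma symz_nth: "symz A $ i $ j = (A $ i $ j + A $ j $ i) / 2"
  by (simp add: symz_def transpose_def)

lemma linear_symz: "linear symz"
  by (rule linearI) (simp_all add: vec_eq_iff symz_nth algebra_simps add_divide_distrib)

lemma symz_in: "symz A \<in> sym_mats"
  by (rule sym_matsI) (simp add: symz_nth add.commute)

lemma symz_id: "A \<in> sym_mats \<Longrightarrow> symz A = A"
  by (simp add: vec_eq_iff symz_nth sym_matsD[of A])

lemma inner_symz: "symz A \<bullet> B = A \<bullet> symz B"
proof -
  have "(\<Sum>i\<in>UNIV. \<Sum>j\<in>UNIV. A $ j $ i * B $ i $ j) = (\<Sum>i\<in>UNIV. \<Sum>j\<in>UNIV. A $ i $ j * B $ j $ i)"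
    by (rule sum.swap)
  then show ?thesis
    by (simp add: inner_vec_def symz_nth distrib_left distrib_right add_divide_distrib sum.distrib sum_divide_distrib[symmetric])
qed

lemma trace_mult_sym: "B \<in> sym_mats \<Longrightarrow> trace (A ** B) = A \<bullet> B"
  by (simp add: trace_def matrix_matrix_mult_def inner_vec_def sym_matsD[of B])

text \<open>Composing with the projection, which fixes \<open>sym_mats\<close> pointwise, replaces
  the gradient by its symmetric part. This places the scores in the space on which the Fisher
  operator is invertible.\<close>

lemma has_derivative_symz_gradient:
  fixes f :: "real ^ 'n ^ 'n \<Rightarrow> real"
  assumes f: "(f has_derivative (\<lambda>v. G \<bullet> v)) (at L within sym_mats)" and L: "L \<in> sym_mats"
  shows "(f has_derivative (\<lambda>v. symz G \<bullet> v)) (at L within sym_mats)"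
proof -
  have "bounded_linear (symz :: real ^ 'n ^ 'n \<Rightarrow> _)" using linear_symz by (simp add: linear_conv_bounded_linear)
  then have s: "(symz has_derivative symz) (at L within sym_mats)" by (rule bounded_linear_imp_has_derivative)
  have "(f has_derivative (\<lambda>v. G \<bullet> v)) (at (symz L) within symz ` sym_mats)"
    unfolding symz_id[OF L] by (rule has_derivative_subset[OF f]) (auto intro: symz_in)
  from diff_chain_within[OF s this] have "(f \<circ> symz has_derivative (\<lambda>v. symz G \<bullet> v)) (at L within sym_mats)"
    by (simp add: comp_def inner_symz)
  then show ?thesis by (rule has_derivative_transform[OF L, rotated]) (simp add: symz_id)
qed

text \<open>The cofactors of the block \<open>J\<close> of \<open>L\<close>, padded with zeros, in
  the form in which the product rule yields them from the permutation expansion.\<close>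

definition minor_grad :: "real ^ 'n ^ 'n \<Rightarrow> 'n set \<Rightarrow> real ^ 'n ^ 'n" where
  "minor_grad L J = (\<Sum>p | p permutes J. \<Sum>a\<in>J.
     (of_int (sign p) * (\<Prod>j\<in>J - {a}. L $ j $ p j)) *\<^sub>R axis a (axis (p a) 1))"

lemma has_derivative_principal_minor:
  fixes L :: "real ^ 'n ^ 'n"
  shows "((\<lambda>L. principal_minor L J) has_derivative (\<lambda>v. minor_grad L J \<bullet> v)) (at L within S)"
proof -
  have nth: "((\<lambda>L. L $ i $ j) has_derivative (\<lambda>v. v $ i $ j)) (at L within S)" for i j
    by (intro bounded_linear_imp_has_derivative bounded_linear_compose[OF bounded_linear_vec_nth] bounded_linear_vec_nth)
  have "((\<lambda>L. principal_minor L J) has_derivative (\<lambda>v. \<Sum>p | p permutes J. of_int (sign p) *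
      (\<Sum>a\<in>J. v $ a $ p a * (\<Prod>j\<in>J - {a}. L $ j $ p j)))) (at L within S)"
    unfolding principal_minor_def
    by (intro has_derivative_sum has_derivative_mult_right has_derivative_prod nth)
  moreover have "(\<Sum>p | p permutes J. of_int (sign p) * (\<Sum>a\<in>J. v $ a $ p a * (\<Prod>j\<in>J - {a}. L $ j $ p j)))
     = minor_grad L J \<bullet> v" for v
    by (simp add: minor_grad_def inner_sum_left inner_axis' sum_distrib_left mult_ac)
  ultimately show ?thesis by simp
qed

lemma continuous_on_principal_minor: "continuous_on S (\<lambda>L. principal_minor L J)"
  unfolding principal_minor_def by (intro continuous_intros)

lemma continuous_on_minor_grad: "continuous_on S (\<lambda>L. minor_grad L J)"
  unfolding minor_grad_def by (intro continuous_intros)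

text \<open>The subtracted term is the logarithmic gradient of the normalizing determinant,
  differentiated as the sum of all principal minors.\<close>

definition score :: "real ^ 'n ^ 'n \<Rightarrow> 'n set \<Rightarrow> real ^ 'n ^ 'n" where
  "score L J = symz (minor_grad L J /\<^sub>R principal_minor L J
     - (\<Sum>K\<in>UNIV. minor_grad L K) /\<^sub>R det (mat 1 + L))"

lemma score_in_sym: "score L J \<in> sym_mats"
  by (simp add: score_def symz_in)

lemma continuous_on_dpp_prob: "continuous_on pd_mats (\<lambda>L. dpp_prob L J)"
  unfolding dpp_prob_def
  by (intro continuous_on_divide continuous_on_principal_minor)
    (auto simp: det_mat_1_plus[symmetric] dest: det_mat_1_plus_pos simp del: det_mat_1_plus intro: continuous_on_principal_minor
      intro!: continuous_on_eq[OF continuous_on_sum[OF continuous_on_principal_minor] det_mat_1_plus[symmetric]])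

lemma continuous_on_score: "continuous_on pd_mats (\<lambda>L. score L J)"
proof -
  have "continuous_on pd_mats (\<lambda>L :: real ^ 'n ^ 'n. det (mat 1 + L))"
    unfolding det_mat_1_plus by (intro continuous_on_sum continuous_on_principal_minor)
  moreover have "bounded_linear (symz :: real ^ 'n ^ 'n \<Rightarrow> _)" using linear_symz by (simp add: linear_conv_bounded_linear)
  ultimately show ?thesis unfolding score_def
    by (intro bounded_linear.continuous_on[where f=symz] continuous_intros continuous_on_principal_minor continuous_on_minor_grad)
      (auto dest: det_mat_1_plus_pos simp: less_imp_neq[OF principal_minor_pos, symmetric])
qed

lemma has_derivative_dpp_prob:
  assumes L: "L \<in> pd_mats"
  shows "((\<lambda>L. dpp_prob L J) has_derivative (\<lambda>v. dpp_prob L J * (score L J \<bullet> v))) (at L within sym_mats)"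
proof -
  define G where "G = dpp_prob L J *\<^sub>R (minor_grad L J /\<^sub>R principal_minor L J
     - (\<Sum>K\<in>UNIV. minor_grad L K) /\<^sub>R det (mat 1 + L))"
  have m: "principal_minor L J > 0" and d: "det (mat 1 + L) > 0"
    using L by (auto intro: principal_minor_pos det_mat_1_plus_pos)
  have dd: "((\<lambda>L. det (mat 1 + L)) has_derivative (\<lambda>v. (\<Sum>K\<in>UNIV. minor_grad L K) \<bullet> v)) (at L within sym_mats)"
    unfolding det_mat_1_plus inner_sum_left
    by (intro has_derivative_sum has_derivative_principal_minor)
  have "((\<lambda>L. dpp_prob L J) has_derivative (\<lambda>v. G \<bullet> v)) (at L within sym_mats)"
    unfolding dpp_prob_def[abs_def]
    by (rule has_derivative_eq_rhs[OF has_derivative_divide'[OF has_derivative_principal_minor dd]])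
      (use m d in \<open>auto simp: G_def dpp_prob_def fun_eq_iff inner_diff_left field_simps power2_eq_square\<close>)
  from has_derivative_symz_gradient[OF this pd_mats_sym[OF L]] show ?thesis
    by (simp add: G_def score_def linear_cmul[OF linear_symz])
qed

text \<open>The derivative of the total mass 1. Weighting by \<open>dpp_prob\<close> cancels the
  minors in the denominators, and what remains is \<open>G\<close> minus \<open>G\<close> times the
  total mass.\<close>

lemma sum_prob_score:
  assumes L: "L \<in> pd_mats"
  shows "(\<Sum>J\<in>UNIV. dpp_prob L J *\<^sub>R score L J) = 0"
proof -
  have d: "det (mat 1 + L) > 0" using L by (rule det_mat_1_plus_pos)
  have m: "principal_minor L J \<noteq> 0" for J using principal_minor_pos[OF L, of J] by simp
  define G where "G = (\<Sum>K\<in>UNIV. minor_grad L K) /\<^sub>R det (mat 1 + L)"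
  have "dpp_prob L J *\<^sub>R score L J = symz (minor_grad L J /\<^sub>R det (mat 1 + L) - dpp_prob L J *\<^sub>R G)" for J
    using m[of J] unfolding score_def linear_cmul[OF linear_symz, symmetric] G_def[symmetric]
    by (simp add: dpp_prob_def scaleR_diff_right inverse_eq_divide)
  then have "(\<Sum>J\<in>UNIV. dpp_prob L J *\<^sub>R score L J)
      = symz (\<Sum>J\<in>UNIV. minor_grad L J /\<^sub>R det (mat 1 + L) - dpp_prob L J *\<^sub>R G)"
    by (simp add: linear_sum[OF linear_symz])
  also have "(\<Sum>J\<in>UNIV. minor_grad L J /\<^sub>R det (mat 1 + L) - dpp_prob L J *\<^sub>R G)
      = G - (\<Sum>J\<in>UNIV. dpp_prob L J) *\<^sub>R G"
    unfolding sum_subtractf scaleR_sum_left by (simp add: G_def scaleR_sum_right)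
  finally show ?thesis by (simp add: dpp_prob_sum[OF L] linear_0[OF linear_symz])
qed

lemma abs_quad_form_le:
  fixes M :: "real ^ 'n ^ 'n"
  shows "\<bar>x \<bullet> (M *v x)\<bar> \<le> (real CARD('n))\<^sup>2 * norm M * (norm x)\<^sup>2"
proof -
  have entry: "\<bar>M $ i $ j\<bar> \<le> norm M" for i j
    by (rule order_trans[OF component_le_norm_cart Finite_Cartesian_Product.norm_nth_le])
  have "\<bar>x \<bullet> (M *v x)\<bar> \<le> (\<Sum>i\<in>UNIV. \<Sum>j\<in>UNIV. \<bar>x $ i * M $ i $ j * x $ j\<bar>)"
    unfolding quad_form_inner by (intro order_trans[OF sum_abs] sum_mono sum_abs)
  also have "\<dots> \<le> (\<Sum>i\<in>(UNIV::'n set). \<Sum>j\<in>(UNIV::'n set). norm x * norm M * norm x)"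
    unfolding abs_mult by (intro sum_mono mult_mono entry component_le_norm_cart) auto
  also have "\<dots> = (real CARD('n))\<^sup>2 * norm M * (norm x)\<^sup>2" by (simp add: power2_eq_square)
  finally show ?thesis .
qed

text \<open>On the unit sphere the form of \<open>L\<close> has a positive minimum \<open>c\<close>,
  and a perturbation of norm below c / N^2, N the number of indices, changes the form there by less
  than \<open>c\<close>.\<close>

lemma pd_mats_open_in_sym:
  fixes L :: "real ^ 'n ^ 'n"
  assumes L: "L \<in> pd_mats"
  obtains \<delta> where "\<delta> > 0" "\<And>A. A \<in> sym_mats \<Longrightarrow> norm (A - L) < \<delta> \<Longrightarrow> A \<in> pd_mats"
proof -
  let ?S = "sphere 0 1 :: (real ^ 'n) set"
  have "continuous_on ?S (\<lambda>x. x \<bullet> (L *v x))"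
    by (intro continuous_intros linear_continuous_on) (simp add: matrix_vector_mul_bounded_linear)
  moreover have "?S \<noteq> {}" by (metis sphere_eq_empty not_one_less_zero)
  ultimately obtain x0 where x0: "x0 \<in> ?S" "\<And>x. x \<in> ?S \<Longrightarrow> x0 \<bullet> (L *v x0) \<le> x \<bullet> (L *v x)"
    using continuous_attains_inf[of ?S "\<lambda>x. x \<bullet> (L *v x)"] by auto
  define c where "c = x0 \<bullet> (L *v x0)"
  have "x0 \<noteq> 0" using x0(1) by auto
  then have c: "c > 0" using pd_matsD(2)[OF L] by (simp add: c_def)
  have lower: "c * (norm x)\<^sup>2 \<le> x \<bullet> (L *v x)" for x
  proof (cases "x = 0")
    case False
    have "c \<le> (x /\<^sub>R norm x) \<bullet> (L *v (x /\<^sub>R norm x))" unfolding c_def using False by (intro x0(2)) simp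
    also have "\<dots> = (x \<bullet> (L *v x)) / (norm x)\<^sup>2"
      by (simp add: matrix_vector_mult_scaleR power2_eq_square divide_inverse)
    finally show ?thesis using False by (simp add: pos_le_divide_eq)
  qed simp
  show ?thesis
  proof (rule that[of "c / (real CARD('n))\<^sup>2"])
    show "c / (real CARD('n))\<^sup>2 > 0" using c by simp
    fix A :: "real ^ 'n ^ 'n" assume A: "A \<in> sym_mats" "norm (A - L) < c / (real CARD('n))\<^sup>2"
    have "x \<bullet> (A *v x) > 0" if x: "x \<noteq> 0" for x
    proof -
      have "\<bar>x \<bullet> ((A - L) *v x)\<bar> \<le> (real CARD('n))\<^sup>2 * norm (A - L) * (norm x)\<^sup>2" by (rule abs_quad_form_le)
      also have "\<dots> < c * (norm x)\<^sup>2"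
        using A(2) x by (intro mult_strict_right_mono) (auto simp: field_simps)
      finally have "\<bar>x \<bullet> (A *v x) - x \<bullet> (L *v x)\<bar> < c * (norm x)\<^sup>2"
        by (simp add: matrix_vector_mult_diff_rdistrib inner_diff_right)
      then show ?thesis using lower[of x] by linarith
    qed
    then show "A \<in> pd_mats" using A(1) by (simp add: pd_mats_def sym_mats_def)
  qed
qed

text \<open>By relative openness a short segment in a symmetric direction stays in
  \<open>pd_mats\<close>, so a derivative within that set yields an ordinary two-sided derivative on
  the segment, to which one-variable calculus applies.\<close>

lemma has_derivative_pd_line:
  fixes F :: "real ^ 'n ^ 'n \<Rightarrow> real"
  assumes F: "(F has_derivative D) (at y within pd_mats)" and y: "y \<in> pd_mats" and v: "v \<in> sym_mats"
  obtains \<delta> where "\<delta> > 0" "\<And>t. \<bar>t\<bar> < \<delta> \<Longrightarrow> y + t *\<^sub>R v \<in> pd_mats"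
    "((\<lambda>t. F (y + t *\<^sub>R v)) has_real_derivative D v) (at 0)"
proof -
  obtain e where e: "e > 0" "\<And>A. A \<in> sym_mats \<Longrightarrow> norm (A - y) < e \<Longrightarrow> A \<in> pd_mats"
    using pd_mats_open_in_sym[OF y] by blast
  define \<delta> where "\<delta> = e / (norm v + 1)"
  have \<delta>: "\<delta> > 0" using e by (simp add: \<delta>_def add_nonneg_pos)
  have pd: "y + t *\<^sub>R v \<in> pd_mats" if t: "\<bar>t\<bar> < \<delta>" for t
  proof (rule e(2))
    show "y + t *\<^sub>R v \<in> sym_mats"
      by (intro subspace_add[OF subspace_sym_mats] subspace_scale[OF subspace_sym_mats] pd_mats_sym[OF y] v)
    have "\<bar>t\<bar> * norm v \<le> \<bar>t\<bar> * (norm v + 1)" by (intro mult_left_mono) auto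
    also have "\<dots> < e" using t by (simp add: \<delta>_def pos_less_divide_eq add_nonneg_pos)
    finally show "norm (y + t *\<^sub>R v - y) < e" by simp
  qed
  have line: "((\<lambda>t. y + t *\<^sub>R v) has_derivative (\<lambda>t. t *\<^sub>R v)) (at 0 within ball 0 \<delta>)"
    by (auto intro!: derivative_eq_intros)
  have "(F has_derivative D) (at (y + 0 *\<^sub>R v) within (\<lambda>t. y + t *\<^sub>R v) ` ball 0 \<delta>)"
    using has_derivative_subset[OF F] pd by (simp add: image_subset_iff)
  from diff_chain_within[OF line this]
  have "((\<lambda>t. F (y + t *\<^sub>R v)) has_derivative (\<lambda>t. D (t *\<^sub>R v))) (at 0)"
    using \<delta> by (simp add: comp_def at_within_open[of 0 "ball 0 \<delta>"])
  moreover have "D (t *\<^sub>R v) = D v * t" for t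
    using has_derivative_linear[OF F] by (simp add: linear_cmul mult.commute)
  ultimately show ?thesis using \<delta> pd that by (simp add: has_field_derivative_def)
qed

text \<open>Derivatives within \<open>pd_mats\<close> may differ in directions that are not
  symmetric, so \<open>frechet_derivative\<close> is an unspecified choice. In a symmetric direction
  any choice is the derivative along a line, which is unique.\<close>

lemma frechet_derivative_within_pd:
  fixes F :: "real ^ 'n ^ 'n \<Rightarrow> real"
  assumes F: "(F has_derivative D) (at y within pd_mats)" and y: "y \<in> pd_mats" and v: "v \<in> sym_mats"
  shows "frechet_derivative F (at y within pd_mats) v = D v"
proof -
  have "F differentiable (at y within pd_mats)" using F by (auto simp: differentiable_def)
  then have F': "(F has_derivative frechet_derivative F (at y within pd_mats)) (at y within pd_mats)"
    by (simp add: frechet_derivative_works)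
  show ?thesis
    by (rule has_derivative_pd_line[OF F y v], rule has_derivative_pd_line[OF F' y v]) (rule DERIV_unique)
qed

text \<open>A product rule for a factor \<open>g\<close> that is merely continuous: since
  \<open>f\<close> vanishes at \<open>x\<close>, changes of \<open>g\<close> enter only multiplied
  by something of order \<open>norm (y - x)\<close>. The Hessian and the score equation both have
  this shape.\<close>

lemma has_derivative_mult_vanishing:
  fixes f g :: "'a::real_normed_vector \<Rightarrow> real"
  assumes f: "(f has_derivative f') (at x within S)" and f0: "f x = 0"
    and g: "continuous (at x within S) g"
  shows "((\<lambda>y. f y * g y) has_derivative (\<lambda>h. f' h * g x)) (at x within S)"
proof -
  have bl: "bounded_linear f'" using f by (rule has_derivative_bounded_linear)
  then obtain K where K: "\<And>h. \<bar>f' h\<bar> \<le> norm h * K" using bounded_linear.bounded by (metis real_norm_def)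
  have g': "(g \<longlongrightarrow> g x) (at x within S)" using g by (simp add: continuous_within)
  have 1: "((\<lambda>y. (1 / norm (y - x)) *\<^sub>R (f y - (f x + f' (y - x))) * g y) \<longlongrightarrow> 0 * g x) (at x within S)"
    using f g' unfolding has_derivative_within by (intro tendsto_mult) auto
  have 2: "((\<lambda>y. f' (y - x) / norm (y - x) * (g y - g x)) \<longlongrightarrow> 0) (at x within S)"
  proof (rule Lim_null_comparison)
    show "((\<lambda>y. \<bar>K\<bar> * \<bar>g y - g x\<bar>) \<longlongrightarrow> 0) (at x within S)"
      using tendsto_mult_right_zero[OF tendsto_rabs_zero[OF LIM_zero[OF g']]] by simp
    have "\<bar>f' (y - x) / norm (y - x)\<bar> \<le> \<bar>K\<bar>" for y
      using K[of "y - x"] by (cases "y = x") (auto simp: abs_divide pos_divide_le_eq mult.commute intro: order_trans mult_left_mono)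
    then show "\<forall>\<^sub>F y in at x within S. norm (f' (y - x) / norm (y - x) * (g y - g x)) \<le> \<bar>K\<bar> * \<bar>g y - g x\<bar>"
      by (intro always_eventually allI) (simp only: real_norm_def abs_mult, intro mult_right_mono, auto)
  qed
  have "(1 / norm (y - x)) *\<^sub>R (f y * g y - (f x * g x + f' (y - x) * g x)) =
      (1 / norm (y - x)) *\<^sub>R (f y - (f x + f' (y - x))) * g y + f' (y - x) / norm (y - x) * (g y - g x)" for y
    by (simp add: f0 algebra_simps add_divide_distrib diff_divide_distrib)
  then show ?thesis unfolding has_derivative_within
    using tendsto_add[OF 1 2] bounded_linear_mult_const[OF bl] by simp
qed

text \<open>One objective for both likelihoods: empirical frequencies as \<open>q\<close> give the
  sample version, the true probabilities the expected one.\<close>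

definition mean_log_prob :: "real ^ 'n set \<Rightarrow> real ^ 'n ^ 'n \<Rightarrow> real" where
  "mean_log_prob q L = (\<Sum>J\<in>UNIV. q $ J * ln (dpp_prob L J))"

lemma has_derivative_mean_log_prob:
  assumes L: "L \<in> pd_mats"
  shows "(mean_log_prob q has_derivative (\<lambda>v. (\<Sum>J\<in>UNIV. q $ J *\<^sub>R score L J) \<bullet> v)) (at L within pd_mats)"
proof -
  have "((\<lambda>L. \<Sum>J\<in>UNIV. q $ J * ln (dpp_prob L J)) has_derivative
      (\<lambda>v. \<Sum>J\<in>UNIV. q $ J * (dpp_prob L J * (score L J \<bullet> v) * inverse (dpp_prob L J)))) (at L within pd_mats)"
    using dpp_prob_pos[OF L]
    by (intro has_derivative_sum has_derivative_mult_right has_derivative_ln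
        has_derivative_subset[OF has_derivative_dpp_prob[OF L]]) (auto simp: pd_mats_sym)
  moreover have "dpp_prob L J * x * inverse (dpp_prob L J) = x" for J x using dpp_prob_pos[OF L, of J] by simp
  ultimately show ?thesis
    unfolding mean_log_prob_def[abs_def] by (simp add: inner_sum_left)
qed

text \<open>The gradient \<open>v\<close> is itself a symmetric direction, and along it the
  derivative at the maximum is \<open>v \<bullet> v\<close>.\<close>

lemma maximizer_score_eq:
  assumes L: "L \<in> pd_mats" and max: "\<And>A. A \<in> pd_mats \<Longrightarrow> mean_log_prob q A \<le> mean_log_prob q L"
  shows "(\<Sum>J\<in>UNIV. q $ J *\<^sub>R score L J) = 0"
proof -
  define v where "v = (\<Sum>J\<in>UNIV. q $ J *\<^sub>R score L J)"
  have v: "v \<in> sym_mats" unfolding v_def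
    by (intro subspace_sum[OF subspace_sym_mats] subspace_scale[OF subspace_sym_mats] score_in_sym)
  obtain \<delta> where \<delta>: "\<delta> > 0" "\<And>t. \<bar>t\<bar> < \<delta> \<Longrightarrow> L + t *\<^sub>R v \<in> pd_mats"
    "((\<lambda>t. mean_log_prob q (L + t *\<^sub>R v)) has_real_derivative v \<bullet> v) (at 0)"
    using has_derivative_pd_line[OF has_derivative_mean_log_prob[OF L, of q] L v] unfolding v_def[symmetric] by blast
  have "v \<bullet> v = 0"
    by (rule DERIV_local_max[OF \<delta>(3,1)]) (use \<delta>(2) max in auto)
  then show ?thesis by (simp add: v_def)
qed

text \<open>The minor of the empty set is constant, so the score of the empty set isolates the
  normalizer. Once that term is known to vanish along \<open>H\<close>, so do the derivatives of all
  minors.\<close>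

lemma score_injective:
  assumes L: "L \<in> pd_mats" and irr: "irreducible_mat L" and H: "H \<in> sym_mats"
    and 0: "\<And>J. score L J \<bullet> H = 0"
  shows "H = 0"
proof (rule principal_minors_derivative_injective[OF irr])
  show "L $ i $ j = L $ j $ i" for i j using sym_matsD[OF pd_mats_sym[OF L]] .
  show "H $ i $ j = H $ j $ i" for i j using sym_matsD[OF H] .
  fix J
  have eq: "score L J \<bullet> H = (minor_grad L J \<bullet> H) / principal_minor L J - ((\<Sum>K\<in>UNIV. minor_grad L K) \<bullet> H) / det (mat 1 + L)" for J
    by (simp add: score_def inner_symz symz_id[OF H] inner_diff_left divide_inverse mult.commute)
  have "minor_grad L {} = 0" by (simp add: minor_grad_def)
  then have "((\<Sum>K\<in>UNIV. minor_grad L K) \<bullet> H) / det (mat 1 + L) = 0"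
    using eq[of "{}"] 0[of "{}"] by (metis diff_0 div_0 inner_zero_left neg_equal_0_iff_equal)
  then have "(minor_grad L J \<bullet> H) / principal_minor L J = 0" using eq[of J] 0[of J] by linarith
  then have grad: "minor_grad L J \<bullet> H = 0" using principal_minor_pos[OF L, of J] by simp
  have line: "((\<lambda>t. L + t *\<^sub>R H) has_derivative (\<lambda>t. t *\<^sub>R H)) (at 0)"
    by (auto intro!: derivative_eq_intros)
  from diff_chain_at[OF line has_derivative_principal_minor[of J]]
  show "((\<lambda>t. principal_minor (L + t *\<^sub>R H) J) has_real_derivative 0) (at 0)"
    by (simp add: comp_def has_field_derivative_def grad lambda_zero)
qed

section \<open>Fisher information and the score equation\<close>

locale dpp_model =
  fixes Lstar :: "real ^ 'n ^ 'n"
  assumes pd: "Lstar \<in> pd_mats" and irr: "irreducible_mat Lstar"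
begin

abbreviation pr :: "'n set \<Rightarrow> real" where "pr \<equiv> dpp_prob Lstar"
abbreviation sc :: "'n set \<Rightarrow> real ^ 'n ^ 'n" where "sc \<equiv> score Lstar"
abbreviation qstar :: "real ^ 'n set" where "qstar \<equiv> (\<chi> J. pr J)"

text \<open>The covariance operator of the score at \<open>Lstar\<close>, which has mean
  zero.\<close>

definition fisher :: "real ^ 'n ^ 'n \<Rightarrow> real ^ 'n ^ 'n" where
  "fisher H = (\<Sum>J\<in>UNIV. (pr J * (sc J \<bullet> H)) *\<^sub>R sc J)"

lemma linear_fisher: "linear fisher"
  unfolding fisher_def
  by (rule linearI) (simp_all add: inner_add_right distrib_left scaleR_add_left sum.distrib scaleR_sum_right mult.left_commute)

lemma fisher_in_sym: "fisher H \<in> sym_mats"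
  unfolding fisher_def
  by (intro subspace_sum[OF subspace_sym_mats] subspace_scale[OF subspace_sym_mats] score_in_sym)

lemma inner_fisher: "H \<bullet> fisher K = (\<Sum>J\<in>UNIV. pr J * (sc J \<bullet> H) * (sc J \<bullet> K))"
  by (simp add: fisher_def inner_sum_right mult_ac inner_commute)

lemma fisher_self_adjoint: "H \<bullet> fisher K = fisher H \<bullet> K"
  unfolding inner_commute[of "fisher H"] inner_fisher by (simp add: mult_ac)

lemma fisher_pos:
  assumes H: "H \<in> sym_mats" "H \<noteq> 0"
  shows "H \<bullet> fisher H > 0"
proof -
  obtain J where J: "sc J \<bullet> H \<noteq> 0" using score_injective[OF pd irr H(1)] H(2) by blast
  have nn: "0 \<le> pr J * (sc J \<bullet> H) * (sc J \<bullet> H)" for J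
    using dpp_prob_pos[OF pd, of J] by (simp add: mult.assoc)
  have "0 < pr J * (sc J \<bullet> H) * (sc J \<bullet> H)"
    using J dpp_prob_pos[OF pd, of J] by (simp add: mult.assoc zero_less_mult_iff not_less le_less) (metis linorder_neqE_linordered_idom)
  then show ?thesis unfolding inner_fisher using nn by (intro sum_pos2[of UNIV J]) auto
qed

lemma fisher_inverse_exists:
  obtains U where "linear U" "\<And>H. H \<in> sym_mats \<Longrightarrow> U H \<in> sym_mats"
    "\<And>H. H \<in> sym_mats \<Longrightarrow> fisher (U H) = H" "\<And>H. H \<in> sym_mats \<Longrightarrow> U (fisher H) = H"
proof -
  \<comment> \<open>\<open>fisher\<close> annihilates antisymmetric matrices. Adding the identity on
    the complement of \<open>sym_mats\<close> makes it injective on the whole space, hence bijective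
    by dimension, and the inverse maps \<open>sym_mats\<close> to itself.\<close>
  define T where "T = (\<lambda>H. fisher H + (H - symz H))"
  have lin: "linear T" unfolding T_def
    by (intro linear_compose_add linear_compose_sub linear_fisher linear_symz linear_id[unfolded id_def])
  have symz_T: "symz (T H) = fisher H" for H
    by (simp add: T_def linear_add[OF linear_symz] linear_diff[OF linear_symz] symz_id[OF fisher_in_sym] symz_id[OF symz_in])
  have inj: "inj T"
    unfolding linear_injective_0[OF lin]
  proof (intro allI impI)
    fix H assume H: "T H = 0"
    then have f0: "fisher H = 0" using symz_T[of H] linear_0[OF linear_symz] by metis
    then have "H = symz H" using H by (simp add: T_def)
    then have "H \<in> sym_mats" using symz_in[of H] by simp
    then show "H = 0" using fisher_pos[of H] f0 by fastforce
  qed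
  then have surj: "surj T" using lin linear_injective_imp_surjective by blast
  define U where "U = inv T"
  have UT: "U (T H) = H" for H unfolding U_def using inj by simp
  have TU: "T (U H) = H" for H unfolding U_def using surj by (simp add: surj_f_inv_f)
  have linU: "linear U"
  proof (rule linearI)
    show "U (a + b) = U a + U b" for a b using UT[of "U a + U b"] by (simp add: linear_add[OF lin] TU)
    show "U (r *\<^sub>R a) = r *\<^sub>R U a" for r a using UT[of "r *\<^sub>R U a"] by (simp add: linear_cmul[OF lin] TU)
  qed
  have fU: "fisher (U H) = H" if "H \<in> sym_mats" for H
    using symz_T[of "U H"] symz_id[OF that] by (simp add: TU)
  have Usym: "U H \<in> sym_mats" if "H \<in> sym_mats" for H
  proof -
    have "U H = symz (U H)" using TU[of H] fU[OF that] by (simp add: T_def)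
    then show ?thesis using symz_in[of "U H"] by simp
  qed
  have "U (fisher H) = H" if "H \<in> sym_mats" for H
    using UT[of H] symz_id[OF that] by (simp add: T_def)
  then show ?thesis using that linU Usym fU by blast
qed

definition fisher_inv :: "real ^ 'n ^ 'n \<Rightarrow> real ^ 'n ^ 'n" where
  "fisher_inv = (SOME U. linear U \<and> (\<forall>H\<in>sym_mats. U H \<in> sym_mats \<and> fisher (U H) = H \<and> U (fisher H) = H))"

lemma fisher_inv:
  shows "linear fisher_inv" "H \<in> sym_mats \<Longrightarrow> fisher_inv H \<in> sym_mats"
    "H \<in> sym_mats \<Longrightarrow> fisher (fisher_inv H) = H" "H \<in> sym_mats \<Longrightarrow> fisher_inv (fisher H) = H"
proof -
  have "\<exists>U. linear U \<and> (\<forall>H\<in>sym_mats. U H \<in> sym_mats \<and> fisher (U H) = H \<and> U (fisher H) = H)"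
    by (rule fisher_inverse_exists) blast
  from someI_ex[OF this]
  show "linear fisher_inv" "H \<in> sym_mats \<Longrightarrow> fisher_inv H \<in> sym_mats"
    "H \<in> sym_mats \<Longrightarrow> fisher (fisher_inv H) = H" "H \<in> sym_mats \<Longrightarrow> fisher_inv (fisher H) = H"
    unfolding fisher_inv_def by auto
qed

lemma expected_log_likelihood_eq:
  assumes L: "L \<in> pd_mats"
  shows "expected_log_likelihood Lstar L = mean_log_prob qstar L"
proof -
  have "mean_log_prob qstar L = (\<Sum>J\<in>UNIV. pr J * ln (principal_minor L J) - pr J * ln (det (mat 1 + L)))"
    unfolding mean_log_prob_def
    by (intro sum.cong refl) (simp add: dpp_prob_def[of L] ln_div less_imp_neq[OF principal_minor_pos[OF L], symmetric]
        less_imp_neq[OF det_mat_1_plus_pos[OF L], symmetric] right_diff_distrib)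
  also have "\<dots> = (\<Sum>J\<in>UNIV. pr J * ln (principal_minor L J)) - (\<Sum>J\<in>UNIV. pr J) * ln (det (mat 1 + L))"
    by (simp add: sum_subtractf sum_distrib_right)
  finally show ?thesis by (simp add: expected_log_likelihood_def dpp_prob_sum[OF pd])
qed

lemma has_derivative_expected_log_likelihood:
  assumes L: "L \<in> pd_mats"
  shows "(expected_log_likelihood Lstar has_derivative (\<lambda>v. (\<Sum>J\<in>UNIV. pr J *\<^sub>R score L J) \<bullet> v)) (at L within pd_mats)"
  by (rule has_derivative_transform[OF L expected_log_likelihood_eq])
    (use has_derivative_mean_log_prob[OF L, of qstar] in simp_all)

text \<open>Since the mean of the score vanishes, the gradient of \<open>\<Phi>\<close> at \<open>L\<close> is \<open>\<Sum>\<^sub>J (p\<^sub>J(L\<^sup>*) - p\<^sub>J(L)) s\<^sub>J(L)\<close>, whose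
  first factor vanishes at \<open>L\<^sup>*\<close>: no second derivative of the minors is needed.\<close>
lemma information_form_eq:
  assumes u: "u \<in> sym_mats" and v: "v \<in> sym_mats"
  shows "information_form Lstar u v = u \<bullet> fisher v"
proof -
  define G where "G = (\<lambda>y. frechet_derivative (expected_log_likelihood Lstar) (at y within pd_mats) v)"
  have G: "G y = (\<Sum>J\<in>UNIV. (pr J - dpp_prob y J) * (score y J \<bullet> v))" if y: "y \<in> pd_mats" for y
  proof -
    have "G y = (\<Sum>J\<in>UNIV. pr J *\<^sub>R score y J) \<bullet> v"
      unfolding G_def by (rule frechet_derivative_within_pd[OF has_derivative_expected_log_likelihood[OF y] y v])
    also have "\<dots> = (\<Sum>J\<in>UNIV. pr J *\<^sub>R score y J) \<bullet> v - (\<Sum>J\<in>UNIV. dpp_prob y J *\<^sub>R score y J) \<bullet> v"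
      by (simp add: sum_prob_score[OF y])
    finally show ?thesis by (simp add: inner_sum_left left_diff_distrib sum_subtractf)
  qed
  have "((\<lambda>y. (pr J - dpp_prob y J) * (score y J \<bullet> v)) has_derivative
      (\<lambda>h. - (pr J * (sc J \<bullet> h)) * (sc J \<bullet> v))) (at Lstar within pd_mats)" for J
  proof (rule has_derivative_mult_vanishing)
    show "((\<lambda>y. pr J - dpp_prob y J) has_derivative (\<lambda>h. - (pr J * (sc J \<bullet> h)))) (at Lstar within pd_mats)"
      by (rule has_derivative_eq_rhs[OF has_derivative_diff[OF has_derivative_const
            has_derivative_subset[OF has_derivative_dpp_prob[OF pd]]]]) (auto simp: pd_mats_sym)
    have "continuous (at Lstar within pd_mats) (\<lambda>y. score y J)"
      using continuous_on_score pd by (auto simp: continuous_on_eq_continuous_within)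
    then show "continuous (at Lstar within pd_mats) (\<lambda>y. score y J \<bullet> v)" by (intro continuous_intros)
  qed simp
  then have "((\<lambda>y. \<Sum>J\<in>UNIV. (pr J - dpp_prob y J) * (score y J \<bullet> v)) has_derivative
      (\<lambda>h. \<Sum>J\<in>UNIV. - (pr J * (sc J \<bullet> h)) * (sc J \<bullet> v))) (at Lstar within pd_mats)"
    by (rule has_derivative_sum)
  then have "(G has_derivative (\<lambda>h. \<Sum>J\<in>UNIV. - (pr J * (sc J \<bullet> h)) * (sc J \<bullet> v))) (at Lstar within pd_mats)"
    by (rule has_derivative_transform[OF pd G, rotated])
  from frechet_derivative_within_pd[OF this pd u]
  show ?thesis
    by (simp add: information_form_def second_derivative_within_def G_def inner_fisher sum_negf)
qed

text \<open>The operator chosen by \<open>SOME\<close> is known only through the form. On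
  \<open>sym_mats\<close> it must be \<open>fisher\<close>: the difference of the two values is
  symmetric and, tested against itself, has norm zero.\<close>

lemma asymptotic_covariance_eq:
  assumes H': "H' \<in> sym_mats"
  shows "asymptotic_covariance Lstar H H' = H \<bullet> fisher_inv H'"
proof -
  have "represents_form fisher (information_form Lstar)"
    unfolding represents_form_def
    by (auto simp: linear_fisher fisher_in_sym trace_mult_sym information_form_eq fisher_self_adjoint)
  moreover define T where "T = (SOME T. represents_form T (information_form Lstar))"
  ultimately have rep: "represents_form T (information_form Lstar)"
    using someI[where P="\<lambda>T. represents_form T (information_form Lstar)"] by blast
  have T: "T K = fisher K" if K: "K \<in> sym_mats" for K
  proof -
    have TK: "T K \<in> sym_mats" using rep K unfolding represents_form_def by auto
    have D: "T K - fisher K \<in> sym_mats"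
      using TK fisher_in_sym by (rule subspace_diff[OF subspace_sym_mats])
    have "(T K - fisher K) \<bullet> T K = information_form Lstar (T K - fisher K) K"
      using rep D K TK unfolding represents_form_def by (simp add: trace_mult_sym)
    also have "\<dots> = (T K - fisher K) \<bullet> fisher K" by (rule information_form_eq[OF D K])
    finally have "(T K - fisher K) \<bullet> (T K - fisher K) = 0" by (simp add: inner_diff_right)
    then show ?thesis by simp
  qed
  have "inj_on T sym_mats"
    by (rule inj_on_inverseI[of _ fisher_inv]) (simp add: T fisher_inv)
  then have "inv_into sym_mats T (T (fisher_inv H')) = fisher_inv H'"
    by (rule inv_into_f_f) (rule fisher_inv(2)[OF H'])
  then have "inv_into sym_mats T H' = fisher_inv H'"
    using H' by (simp add: T fisher_inv)
  then show ?thesis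
    unfolding asymptotic_covariance_def inverse_form_def T_def[symmetric]
    by (simp add: trace_mult_sym fisher_inv(2)[OF H'])
qed

lemma fisher_inv_self_adjoint:
  assumes "H \<in> sym_mats" "K \<in> sym_mats"
  shows "H \<bullet> fisher_inv K = fisher_inv H \<bullet> K"
  using fisher_self_adjoint[of "fisher_inv H" "fisher_inv K"] assms by (simp add: fisher_inv)

text \<open>The right side is the variance that the central limit theorem gives to
  \<open>fisher_inv\<close> of the score in direction \<open>H\<close>; this identifies the limit
  covariance with \<open>asymptotic_covariance\<close>.\<close>

lemma fisher_inv_quadratic:
  assumes H: "H \<in> sym_mats"
  shows "H \<bullet> fisher_inv H = (\<Sum>J\<in>UNIV. pr J * (H \<bullet> fisher_inv (sc J))\<^sup>2)"
proof -
  have "H \<bullet> fisher_inv H = fisher_inv H \<bullet> fisher (fisher_inv H)"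
    using H by (simp add: fisher_inv inner_commute)
  also have "\<dots> = (\<Sum>J\<in>UNIV. pr J * (H \<bullet> fisher_inv (sc J))\<^sup>2)"
    unfolding inner_fisher
    by (simp add: fisher_inv_self_adjoint[OF H score_in_sym] inner_commute power2_eq_square mult.assoc)
  finally show ?thesis .
qed

lemma pos_def_asymptotic_covariance: "pos_def_form_on_sym (asymptotic_covariance Lstar)"
  unfolding pos_def_form_on_sym_def
proof (intro conjI ballI allI impI)
  fix H K H' :: "real ^ 'n ^ 'n" and c :: real
  assume H: "H \<in> sym_mats" and H': "H' \<in> sym_mats"
  show "asymptotic_covariance Lstar H H' = asymptotic_covariance Lstar H' H"
    using H H' by (simp add: asymptotic_covariance_eq fisher_inv_self_adjoint[OF H H'] inner_commute)
  show "asymptotic_covariance Lstar (c *\<^sub>R H) H' = c * asymptotic_covariance Lstar H H'"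
    using H' by (simp add: asymptotic_covariance_eq)
  show "asymptotic_covariance Lstar (H + K) H' = asymptotic_covariance Lstar H H' + asymptotic_covariance Lstar K H'"
    using H' by (simp add: asymptotic_covariance_eq inner_add_left)
next
  fix H :: "real ^ 'n ^ 'n" assume H: "H \<in> sym_mats" "H \<noteq> 0"
  then have "fisher_inv H \<noteq> 0" using fisher_inv(3)[of H] linear_0[OF linear_fisher] by auto
  from fisher_pos[OF fisher_inv(2)[OF H(1)] this] show "asymptotic_covariance Lstar H H > 0"
    using H by (simp add: asymptotic_covariance_eq fisher_inv inner_commute)
qed

text \<open>Since the mean score is zero, at an empirical frequency vector this is the sample mean
  of \<open>fisher_inv (sc (z i))\<close>.\<close>

definition influence :: "real ^ 'n set \<Rightarrow> real ^ 'n ^ 'n" where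
  "influence q = fisher_inv (\<Sum>J\<in>UNIV. (q $ J - pr J) *\<^sub>R sc J)"

text \<open>For h = L - Lstar, the defect \<open>E\<close> in the linearized equation consists of
  the linearization error of p_J times a score, and of p_J - q_J times the change of the score. Both
  are small relative to norm h + norm (q - qstar). Applying \<open>fisher_inv\<close> gives the
  claim up to the term in \<open>h\<close>, which is absorbed because \<open>influence q\<close> is
  of order norm (q - qstar).\<close>

lemma score_equation_expansion:
  assumes \<epsilon>: "\<epsilon> > 0"
  shows "\<exists>\<delta>>0. \<forall>q L. L \<in> pd_mats \<and> norm (L - Lstar) < \<delta> \<and> (\<Sum>J\<in>UNIV. q $ J *\<^sub>R score L J) = 0 \<longrightarrow>
    norm (L - Lstar - influence q) \<le> \<epsilon> * norm (q - qstar)"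
proof -
  define N where "N = real CARD('n set)"
  define C where "C = (\<Sum>J\<in>UNIV. norm (sc J))"
  have C0: "C \<ge> 0" by (simp add: C_def sum_nonneg)
  have N0: "N \<ge> 0" by (simp add: N_def)
  have Cj: "norm (sc J) \<le> C" for J unfolding C_def by (rule member_le_sum) auto
  have "bounded_linear fisher_inv" using fisher_inv(1) by (simp add: linear_conv_bounded_linear)
  then obtain K where K: "K > 0" "\<And>x. norm (fisher_inv x) \<le> norm x * K" using bounded_linear.pos_bounded by blast
  \<comment> \<open>The three summands of \<open>C1\<close> come from the linearization error, from
    |p_J(L) - pr J| and from |q_J - pr J|. The constant \<open>A\<close> is what absorption leaves:
    norm h + norm (q - qstar) is at most A * norm (q - qstar).\<close>
  define C1 where "C1 = C + N * (C + 1) + N"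
  have C10: "C1 \<ge> 0" using C0 N0 by (simp add: C1_def)
  define A where "A = 2 * K * C + 2"
  have A: "A > 0" using K C0 by (simp add: A_def add_nonneg_pos)
  \<comment> \<open>The bound 1 makes p_J Lipschitz at \<open>Lstar\<close> with constant C + 1, the
    second bound gives the factor 1/2 for the absorption, and the third the final
    \<open>\<epsilon>\<close>.\<close>
  define \<eta> where "\<eta> = min 1 (min (1 / (2 * K * (C1 + 1))) (\<epsilon> / (K * (C1 + 1) * A)))"
  have \<eta>: "\<eta> > 0" "\<eta> \<le> 1" using K C10 \<epsilon> A by (auto simp: \<eta>_def)
  have \<eta>2: "K * (\<eta> * C1) \<le> 1 / 2"
  proof -
    have "\<eta> \<le> 1 / (2 * K * (C1 + 1))" by (simp add: \<eta>_def)
    then have "\<eta> * (2 * K * (C1 + 1)) \<le> 1" using K C10 by (simp add: pos_le_divide_eq)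
    moreover have "\<eta> * (2 * K * C1) \<le> \<eta> * (2 * K * (C1 + 1))" using \<eta> K by (intro mult_left_mono) auto
    ultimately show ?thesis by (simp add: mult_ac)
  qed
  have \<eta>3: "K * (\<eta> * C1) * A \<le> \<epsilon>"
  proof -
    have "\<eta> \<le> \<epsilon> / (K * (C1 + 1) * A)" by (simp add: \<eta>_def)
    then have "\<eta> * (K * (C1 + 1) * A) \<le> \<epsilon>" using K C10 A by (simp add: pos_le_divide_eq)
    moreover have "\<eta> * (K * C1 * A) \<le> \<eta> * (K * (C1 + 1) * A)" using \<eta> K A by (intro mult_left_mono mult_right_mono) auto
    ultimately show ?thesis by (simp add: mult_ac)
  qed
  have "\<exists>d>0. \<forall>L\<in>pd_mats. norm (L - Lstar) < d \<longrightarrow>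
      \<bar>dpp_prob L J - pr J - pr J * (sc J \<bullet> (L - Lstar))\<bar> \<le> \<eta> * norm (L - Lstar) \<and> norm (score L J - sc J) \<le> \<eta>" for J
  proof -
    have "\<forall>e>0. \<exists>d>0. \<forall>y\<in>sym_mats. norm (y - Lstar) < d \<longrightarrow>
        norm (dpp_prob y J - pr J - pr J * (sc J \<bullet> (y - Lstar))) \<le> e * norm (y - Lstar)"
      using has_derivative_dpp_prob[OF pd, of J] unfolding has_derivative_within_alt by auto
    then obtain d1 where d1: "d1 > 0" "\<forall>y\<in>sym_mats. norm (y - Lstar) < d1 \<longrightarrow>
        norm (dpp_prob y J - pr J - pr J * (sc J \<bullet> (y - Lstar))) \<le> \<eta> * norm (y - Lstar)" using \<eta> by meson
    obtain d2 where d2: "d2 > 0" "\<forall>y\<in>pd_mats. dist y Lstar < d2 \<longrightarrow> dist (score y J) (sc J) < \<eta>"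
      using continuous_on_score[of J] pd \<eta> unfolding continuous_on_iff by blast
    show ?thesis
      using d1 d2 by (intro exI[of _ "min d1 d2"]) (auto simp: dist_norm pd_mats_sym less_imp_le)
  qed
  then obtain d where d: "\<And>J. d J > 0" "\<And>J L. L \<in> pd_mats \<Longrightarrow> norm (L - Lstar) < d J \<Longrightarrow>
      \<bar>dpp_prob L J - pr J - pr J * (sc J \<bullet> (L - Lstar))\<bar> \<le> \<eta> * norm (L - Lstar) \<and> norm (score L J - sc J) \<le> \<eta>" by metis
  define \<delta> where "\<delta> = Min (range d)"
  have \<delta>: "\<delta> > 0" "\<And>J. \<delta> \<le> d J" using d(1) by (auto simp: \<delta>_def)
  show ?thesis
  proof (intro exI[of _ \<delta>] conjI allI impI \<delta>(1))
    fix q :: "real ^ 'n set" and L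
    assume "L \<in> pd_mats \<and> norm (L - Lstar) < \<delta> \<and> (\<Sum>J\<in>UNIV. q $ J *\<^sub>R score L J) = 0"
    then have L: "L \<in> pd_mats" and near: "norm (L - Lstar) < \<delta>" and q: "(\<Sum>J\<in>UNIV. q $ J *\<^sub>R score L J) = 0" by auto
    define h where "h = L - Lstar"
    have hsym: "h \<in> sym_mats" unfolding h_def
      by (rule subspace_diff[OF subspace_sym_mats pd_mats_sym[OF L] pd_mats_sym[OF pd]])
    have p1: "\<bar>dpp_prob L J - pr J - pr J * (sc J \<bullet> h)\<bar> \<le> \<eta> * norm h" and s1: "norm (score L J - sc J) \<le> \<eta>" for J
      using d(2)[OF L, of J] near \<delta>(2)[of J] by (auto simp: h_def)
    have dp: "\<bar>dpp_prob L J - pr J\<bar> \<le> (C + 1) * norm h" for J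
    proof -
      have "\<bar>pr J * (sc J \<bullet> h)\<bar> \<le> 1 * (C * norm h)"
        unfolding abs_mult using dpp_prob_pos[OF pd, of J] dpp_prob_le_1[OF pd, of J]
        by (intro mult_mono order_trans[OF Cauchy_Schwarz_ineq2] mult_right_mono Cj) (auto intro: less_imp_le)
      moreover have "\<eta> * norm h \<le> 1 * norm h" using \<eta> by (intro mult_right_mono) auto
      ultimately show ?thesis using p1[of J] by (simp add: algebra_simps)
    qed
    have dq: "\<bar>q $ J - pr J\<bar> \<le> norm (q - qstar)" for J
      using component_le_norm_cart[of "q - qstar" J] by simp
    define E where "E = fisher h - (\<Sum>J\<in>UNIV. (q $ J - pr J) *\<^sub>R sc J)"
    have zero: "(\<Sum>J\<in>UNIV. (dpp_prob L J - q $ J) *\<^sub>R score L J) = 0"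
      using q sum_prob_score[OF L] by (simp add: scaleR_diff_left sum_subtractf)
    have "E = (\<Sum>J\<in>UNIV. (pr J * (sc J \<bullet> h) - (q $ J - pr J)) *\<^sub>R sc J)
        - (\<Sum>J\<in>UNIV. (dpp_prob L J - q $ J) *\<^sub>R score L J)"
      unfolding zero by (simp add: E_def fisher_def scaleR_diff_left sum_subtractf)
    also have "\<dots> = (\<Sum>J\<in>UNIV. (pr J * (sc J \<bullet> h) - (dpp_prob L J - pr J)) *\<^sub>R sc J
        + (dpp_prob L J - q $ J) *\<^sub>R (sc J - score L J))"
      unfolding sum_subtractf[symmetric] by (intro sum.cong refl) (simp add: algebra_simps)
    finally have E: "E = \<dots>" .
    have "norm E \<le> (\<Sum>J\<in>UNIV. \<eta> * norm h * norm (sc J) + ((C + 1) * norm h + norm (q - qstar)) * \<eta>)"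
      unfolding E
    proof (rule sum_norm_le)
      fix J :: "'n set"
      have "norm ((pr J * (sc J \<bullet> h) - (dpp_prob L J - pr J)) *\<^sub>R sc J) \<le> \<eta> * norm h * norm (sc J)"
        unfolding norm_scaleR using p1[of J] by (intro mult_right_mono) (auto simp: abs_minus_commute)
      moreover have "norm ((dpp_prob L J - q $ J) *\<^sub>R (sc J - score L J)) \<le> ((C + 1) * norm h + norm (q - qstar)) * \<eta>"
        unfolding norm_scaleR
      proof (rule mult_mono)
        show "\<bar>dpp_prob L J - q $ J\<bar> \<le> (C + 1) * norm h + norm (q - qstar)" using dp[of J] dq[of J] by linarith
      qed (use s1[of J] C0 in \<open>auto simp: norm_minus_commute\<close>)
      ultimately show "norm ((pr J * (sc J \<bullet> h) - (dpp_prob L J - pr J)) *\<^sub>R sc J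
        + (dpp_prob L J - q $ J) *\<^sub>R (sc J - score L J)) \<le> \<eta> * norm h * norm (sc J) + ((C + 1) * norm h + norm (q - qstar)) * \<eta>"
        by (rule norm_triangle_mono)
    qed
    also have "\<dots> = \<eta> * norm h * C + N * (((C + 1) * norm h + norm (q - qstar)) * \<eta>)"
      by (simp add: sum.distrib C_def N_def sum_distrib_left)
    also have "\<dots> \<le> \<eta> * C1 * (norm h + norm (q - qstar))"
    proof -
      have "\<eta> * C1 * (norm h + norm (q - qstar)) - (\<eta> * norm h * C + N * (((C + 1) * norm h + norm (q - qstar)) * \<eta>))
          = \<eta> * (N * norm h + (C + N * (C + 1)) * norm (q - qstar))"
        by (simp add: C1_def algebra_simps)
      also have "\<dots> \<ge> 0" using \<eta> N0 C0 by (intro mult_nonneg_nonneg add_nonneg_nonneg) auto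
      finally show ?thesis by linarith
    qed
    finally have normE: "norm E \<le> \<eta> * C1 * (norm h + norm (q - qstar))" .
    have "fisher_inv E = h - influence q"
      unfolding E_def influence_def by (simp add: linear_diff[OF fisher_inv(1)] fisher_inv(4)[OF hsym])
    then have "norm (h - influence q) \<le> norm E * K" using K(2)[of E] by simp
    also have "\<dots> \<le> \<eta> * C1 * (norm h + norm (q - qstar)) * K" using K(1) by (intro mult_right_mono normE) auto
    also have "\<dots> = K * (\<eta> * C1) * (norm h + norm (q - qstar))" by (simp only: mult_ac)
    finally have rem: "norm (h - influence q) \<le> K * (\<eta> * C1) * (norm h + norm (q - qstar))" .
    have infl: "norm (influence q) \<le> K * C * norm (q - qstar)"
    proof -
      have "norm (\<Sum>J\<in>UNIV. (q $ J - pr J) *\<^sub>R sc J) \<le> (\<Sum>J\<in>UNIV. norm (q - qstar) * norm (sc J))"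
        using dq by (intro sum_norm_le) (auto intro: mult_right_mono)
      also have "\<dots> = C * norm (q - qstar)" by (simp add: C_def sum_distrib_left mult.commute)
      finally have "norm (\<Sum>J\<in>UNIV. (q $ J - pr J) *\<^sub>R sc J) * K \<le> C * norm (q - qstar) * K" using K(1) by (intro mult_right_mono) auto
      then show ?thesis unfolding influence_def using K(2) by (smt (verit) mult.assoc mult.commute)
    qed
    have "K * (\<eta> * C1) * (norm h + norm (q - qstar)) \<le> 1 / 2 * (norm h + norm (q - qstar))"
      using \<eta>2 by (intro mult_right_mono) auto
    then have "norm h \<le> norm (influence q) + 1 / 2 * (norm h + norm (q - qstar))"
      using rem norm_triangle_sub[of h "influence q"] by linarith
    then have "norm h + norm (q - qstar) \<le> 2 * norm (influence q) + 2 * norm (q - qstar)" by (simp add: field_simps)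
    also have "\<dots> \<le> A * norm (q - qstar)" using infl by (simp add: A_def algebra_simps)
    finally have "norm h + norm (q - qstar) \<le> A * norm (q - qstar)" .
    then have "K * (\<eta> * C1) * (norm h + norm (q - qstar)) \<le> K * (\<eta> * C1) * (A * norm (q - qstar))"
      using K \<eta> C10 by (intro mult_left_mono) auto
    also have "\<dots> \<le> \<epsilon> * norm (q - qstar)"
      using mult_right_mono[OF \<eta>3, of "norm (q - qstar)"] by (simp add: mult.assoc)
    finally show "norm (L - Lstar - influence q) \<le> \<epsilon> * norm (q - qstar)"
      using rem by (simp add: h_def)
  qed
qed

end

section \<open>Consistency and asymptotic normality\<close>

text \<open>If y = L x were nonzero, a small step from \<open>x\<close> along -y would make the form
  negative: at x - t y it is t * (t * b - 2 * (y . y)). The denominator b + 1 in the choice of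
  \<open>t\<close> ensures t * b \<le> y . y.\<close>

lemma psd_kernel:
  fixes L :: "real ^ 'n ^ 'n"
  assumes sym: "transpose L = L" and psd: "\<And>x. 0 \<le> x \<bullet> (L *v x)" and x: "x \<bullet> (L *v x) = 0"
  shows "L *v x = 0"
proof (rule ccontr)
  define y where "y = L *v x"
  assume "L *v x \<noteq> 0"
  then have a: "y \<bullet> y > 0" by (simp add: y_def)
  define b where "b = y \<bullet> (L *v y)"
  have b: "b \<ge> 0" using psd by (simp add: b_def)
  define t where "t = (y \<bullet> y) / (b + 1)"
  have "x \<bullet> (L *v y) = y \<bullet> y" using dot_lmul_matrix[of x L y] sym
    by (simp add: y_def matrix_vector_mul_lid vector_transpose_matrix[symmetric])
  then have "(x - t *\<^sub>R y) \<bullet> (L *v (x - t *\<^sub>R y)) = t * (t * b - 2 * (y \<bullet> y))"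
    using x by (simp add: y_def[symmetric] b_def matrix_vector_mult_diff_distrib matrix_vector_mult_scaleR
        inner_diff_left inner_diff_right algebra_simps)
  moreover have "t > 0" using a b by (simp add: t_def)
  moreover have "t * b - 2 * (y \<bullet> y) < 0"
  proof -
    have "t * b \<le> t * (b + 1)" using \<open>t > 0\<close> by simp
    also have "\<dots> = y \<bullet> y" using b by (simp add: t_def)
    finally show ?thesis using a by linarith
  qed
  ultimately show False using psd[of "x - t *\<^sub>R y"] by (simp add: mult_pos_neg not_less[symmetric])
qed

text \<open>All conditions are closed; semidefiniteness becomes definiteness through the lower bound
  on \<open>det L\<close>. The bound 1 / e says that the empty set has probability at least
  \<open>e\<close>.\<close>

definition bounded_pd :: "real \<Rightarrow> (real ^ 'n ^ 'n) set" where
  "bounded_pd e = {L. transpose L = L \<and> (\<forall>x. 0 \<le> x \<bullet> (L *v x)) \<and> det (mat 1 + L) \<le> 1 / e \<and> e \<le> det L}"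

lemma bounded_pd_subset:
  assumes e: "e > 0"
  shows "bounded_pd e \<subseteq> pd_mats"
proof
  fix L :: "real ^ 'n ^ 'n" assume L: "L \<in> bounded_pd e"
  have "x \<bullet> (L *v x) > 0" if x: "x \<noteq> 0" for x
  proof -
    have "L *v x \<noteq> 0"
    proof
      assume "L *v x = 0"
      then have "\<not> invertible L" using x invertible_left_inverse[of L] matrix_left_invertible_ker[of L] by blast
      then show False using L e by (simp add: invertible_det_nz bounded_pd_def)
    qed
    then have "x \<bullet> (L *v x) \<noteq> 0" using psd_kernel[of L x] L by (auto simp: bounded_pd_def)
    then show ?thesis using L by (simp add: bounded_pd_def order_less_le)
  qed
  then show "L \<in> pd_mats" using L by (simp add: bounded_pd_def pd_mats_def)
qed

text \<open>Diagonal entries are positive summands of \<open>det (mat 1 + L)\<close>, and positivity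
  of the 2x2 minors bounds the other entries by the diagonal.\<close>

lemma compact_bounded_pd:
  assumes e: "e > 0"
  shows "compact (bounded_pd e :: (real ^ 'n ^ 'n) set)"
  unfolding compact_eq_bounded_closed
proof
  have entry: "\<bar>L $ i $ j\<bar> \<le> 1 / e" if L: "L \<in> bounded_pd e" for L :: "real ^ 'n ^ 'n" and i j
  proof -
    have pd: "L \<in> pd_mats" using L bounded_pd_subset[OF e] by blast
    have diag: "0 < L $ i $ i \<and> L $ i $ i \<le> 1 / e" for i
    proof -
      have "principal_minor L {i} \<le> det (mat 1 + L)"
        unfolding det_mat_1_plus
        by (rule member_le_sum) (auto intro: less_imp_le principal_minor_pos[OF pd])
      then show ?thesis using L principal_minor_pos[OF pd, of "{i}"] by (simp add: principal_minor_singleton bounded_pd_def)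
    qed
    show ?thesis
    proof (cases "i = j")
      case True then show ?thesis using diag[of i] by simp
    next
      case False
      have "L $ i $ j * L $ i $ j < L $ i $ i * L $ j $ j"
        using principal_minor_pos[OF pd, of "{i, j}"] sym_matsD[OF pd_mats_sym[OF pd], of j i]
        by (simp add: principal_minor_doubleton[OF False])
      also have "\<dots> \<le> (1 / e) * (1 / e)" using diag[of i] diag[of j] e by (intro mult_mono) auto
      finally have "(L $ i $ j)\<^sup>2 \<le> (1 / e)\<^sup>2" by (simp add: power2_eq_square)
      then show ?thesis using e abs_le_square_iff[of "L $ i $ j" "1 / e"] by simp
    qed
  qed
  show "bounded (bounded_pd e :: (real ^ 'n ^ 'n) set)"
    unfolding bounded_iff
  proof (intro exI ballI)
    fix L :: "real ^ 'n ^ 'n" assume L: "L \<in> bounded_pd e"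
    have "norm L \<le> (\<Sum>i\<in>UNIV. norm (L $ i))" by (simp add: norm_vec_def L2_set_le_sum)
    also have "\<dots> \<le> (\<Sum>i\<in>UNIV. \<Sum>j\<in>UNIV. \<bar>L $ i $ j\<bar>)" by (intro sum_mono norm_le_l1_cart)
    also have "\<dots> \<le> (\<Sum>i\<in>(UNIV :: 'n set). \<Sum>j\<in>(UNIV :: 'n set). 1 / e)" by (intro sum_mono entry[OF L])
    finally show "norm L \<le> (\<Sum>i\<in>(UNIV :: 'n set). \<Sum>j\<in>(UNIV :: 'n set). 1 / e)" .
  qed
  have cdet: "continuous_on UNIV (\<lambda>L :: real ^ 'n ^ 'n. det (f L))" if "continuous_on UNIV f" for f :: "real ^ 'n ^ 'n \<Rightarrow> real ^ 'n ^ 'n"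
    unfolding det_def using that by (intro continuous_intros)
  have "bounded_pd e = (\<Inter>i. \<Inter>j. {L :: real ^ 'n ^ 'n. L $ i $ j = L $ j $ i})
      \<inter> (\<Inter>x. {L. 0 \<le> x \<bullet> (L *v x)}) \<inter> {L. det (mat 1 + L) \<le> 1 / e} \<inter> {L. e \<le> det L}"
    by (auto simp: bounded_pd_def transpose_def vec_eq_iff)
  moreover have "closed \<dots>"
    unfolding quad_form_inner
    by (intro closed_Int closed_INT ballI closed_Collect_eq closed_Collect_le cdet continuous_intros)
  ultimately show "closed (bounded_pd e :: (real ^ 'n ^ 'n) set)" by simp
qed

lemma continuous_on_mean_log_prob: "continuous_on pd_mats (mean_log_prob q)"
  unfolding mean_log_prob_def[abs_def]
  by (intro continuous_intros continuous_on_dpp_prob) (auto dest: dpp_prob_pos simp: less_imp_neq[OF dpp_prob_pos, symmetric])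

text \<open>All summands are nonpositive. Hence a lower bound on the objective is a lower bound on
  every p_J(L) that has positive weight.\<close>

lemma mean_log_prob_le:
  assumes L: "L \<in> pd_mats" and q: "\<And>J. 0 \<le> q $ J"
  shows "mean_log_prob q L \<le> q $ J * ln (dpp_prob L J)"
proof -
  have np: "q $ K * ln (dpp_prob L K) \<le> 0" for K
    using q[of K] dpp_prob_pos[OF L, of K] dpp_prob_le_1[OF L, of K] by (simp add: mult_nonneg_nonpos)
  have "mean_log_prob q L = q $ J * ln (dpp_prob L J) + (\<Sum>K\<in>UNIV - {J}. q $ K * ln (dpp_prob L K))"
    unfolding mean_log_prob_def by (simp add: sum.remove[of UNIV J])
  moreover have "(\<Sum>K\<in>UNIV - {J}. q $ K * ln (dpp_prob L K)) \<le> 0" by (rule sum_nonpos) (rule np)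
  ultimately show ?thesis by linarith
qed

context dpp_model
begin

text \<open>Sum ln t \<le> t - 1, strict for t \<noteq> 1, over the ratios of the two laws. If all
  ratios were 1, the empty set would give equal normalizers, hence equal minors, and
  \<open>L\<close> would be a sign conjugate of \<open>Lstar\<close>.\<close>

lemma gibbs_strict:
  assumes L: "L \<in> pd_mats" and ne: "\<And>D. D \<in> sign_mats \<Longrightarrow> L \<noteq> D ** Lstar ** D"
  shows "mean_log_prob qstar L < mean_log_prob qstar Lstar"
proof -
  obtain J where J: "dpp_prob L J \<noteq> pr J"
  proof (rule ccontr)
    assume "\<not> thesis"
    then have eq: "dpp_prob L J = pr J" for J using that by blast
    have "1 / det (mat 1 + L) = 1 / det (mat 1 + Lstar)"
      using eq[of "{}"] by (simp add: dpp_prob_def principal_minor_empty)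
    then have "det (mat 1 + L) = det (mat 1 + Lstar)" by simp
    then have minors: "principal_minor L J = principal_minor Lstar J" for J
      using eq[of J] det_mat_1_plus_pos[OF L] det_mat_1_plus_pos[OF pd] by (simp add: dpp_prob_def)
    obtain D where "D \<in> sign_mats" "L = D ** Lstar ** D"
      by (rule principal_minors_determine[OF irr sym_matsD[OF pd_mats_sym[OF pd]] sym_matsD[OF pd_mats_sym[OF L]] minors])
    then show False using ne by blast
  qed
  have pos: "dpp_prob L K > 0" "pr K > 0" for K using dpp_prob_pos L pd by auto
  have le: "pr K * ln (dpp_prob L K) - pr K * ln (pr K) \<le> dpp_prob L K - pr K" for K
  proof -
    have "ln (dpp_prob L K / pr K) \<le> dpp_prob L K / pr K - 1" using pos by (intro ln_le_minus_one) simp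
    then have "pr K * ln (dpp_prob L K / pr K) \<le> pr K * (dpp_prob L K / pr K - 1)" using pos(2)[of K] by simp
    then show ?thesis using pos[of K] by (simp add: ln_div less_imp_neq[symmetric] right_diff_distrib)
  qed
  have lt: "pr J * ln (dpp_prob L J) - pr J * ln (pr J) < dpp_prob L J - pr J"
  proof -
    have "dpp_prob L J / pr J \<noteq> 1" using J pos(2)[of J] by simp
    then have "ln (dpp_prob L J / pr J) < dpp_prob L J / pr J - 1"
      using ln_le_minus_one[of "dpp_prob L J / pr J"] ln_eq_minus_one[of "dpp_prob L J / pr J"] pos[of J] by fastforce
    then have "pr J * ln (dpp_prob L J / pr J) < pr J * (dpp_prob L J / pr J - 1)" using pos(2)[of J] by simp
    then show ?thesis using pos[of J] by (simp add: ln_div less_imp_neq[symmetric] right_diff_distrib)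
  qed
  have "mean_log_prob qstar L - mean_log_prob qstar Lstar = (\<Sum>K\<in>UNIV. pr K * ln (dpp_prob L K) - pr K * ln (pr K))"
    by (simp add: mean_log_prob_def sum_subtractf)
  also have "\<dots> < (\<Sum>K\<in>UNIV. dpp_prob L K - pr K)"
    by (rule sum_strict_mono_ex1) (use le lt in auto)
  also have "\<dots> = 0" by (simp add: sum_subtractf dpp_prob_sum[OF L] dpp_prob_sum[OF pd])
  finally show ?thesis by simp
qed

text \<open>Only the two events \<open>Z = \<emptyset>\<close> and \<open>Z = [N]\<close> are needed for coercivity.\<close>
lemma superlevel_bounded:
  obtains \<delta> e where "\<delta> > 0" "e > 0"
    "\<And>q L. norm (q - qstar) < \<delta> \<Longrightarrow> (\<And>J. 0 \<le> q $ J) \<Longrightarrow> L \<in> pd_mats \<Longrightarrow>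
      mean_log_prob q Lstar \<le> mean_log_prob q L \<Longrightarrow> L \<in> bounded_pd e"
proof -
  \<comment> \<open>Half of the smaller probability, so that a \<open>q\<close> within distance
    \<open>p0\<close> still gives each of the two events weight at least \<open>p0\<close>.\<close>
  define p0 where "p0 = min (pr {}) (pr UNIV) / 2"
  have p0: "p0 > 0" "2 * p0 \<le> pr {}" "2 * p0 \<le> pr UNIV" using dpp_prob_pos[OF pd] by (auto simp: p0_def)
  \<comment> \<open>A lower bound for \<open>mean_log_prob q Lstar\<close> over the unit ball around
    \<open>qstar\<close>, where \<open>q $ J \<le> 2\<close> and the logarithms are nonpositive.
    Dividing by the weight \<open>p0\<close> and exponentiating gives \<open>e\<close>.\<close>
  define C where "C = (\<Sum>J\<in>UNIV. 2 * ln (pr J))"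
  define e where "e = exp (C / p0)"
  show ?thesis
  proof (rule that[of "min 1 p0" e])
    show "min 1 p0 > 0" "e > 0" using p0 by (auto simp: e_def)
    fix q :: "real ^ 'n set" and L
    assume near: "norm (q - qstar) < min 1 p0" and q: "\<And>J. 0 \<le> q $ J" and L: "L \<in> pd_mats"
      and le: "mean_log_prob q Lstar \<le> mean_log_prob q L"
    have dq: "\<bar>q $ J - pr J\<bar> \<le> norm (q - qstar)" for J
      using component_le_norm_cart[of "q - qstar" J] by simp
    have "C \<le> mean_log_prob q Lstar"
      unfolding C_def mean_log_prob_def
    proof (rule sum_mono)
      fix J
      have "q $ J \<le> 2" using dq[of J] near dpp_prob_le_1[OF pd, of J] by linarith
      moreover have "ln (pr J) \<le> 0" using dpp_prob_pos[OF pd, of J] dpp_prob_le_1[OF pd, of J] by simp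
      ultimately show "2 * ln (pr J) \<le> q $ J * ln (pr J)" by (rule mult_right_mono_neg)
    qed
    then have C: "C \<le> q $ J * ln (dpp_prob L J)" for J
      using le mean_log_prob_le[OF L q, of J] by linarith
    have large: "e \<le> dpp_prob L J" if J: "2 * p0 \<le> pr J" for J
    proof -
      have "p0 \<le> q $ J" using dq[of J] near J by linarith
      moreover have "ln (dpp_prob L J) \<le> 0" using dpp_prob_pos[OF L, of J] dpp_prob_le_1[OF L, of J] by simp
      ultimately have "q $ J * ln (dpp_prob L J) \<le> p0 * ln (dpp_prob L J)" by (rule mult_right_mono_neg)
      then have "C / p0 \<le> ln (dpp_prob L J)" using C[of J] p0 by (simp add: pos_divide_le_eq mult.commute)
      then show ?thesis unfolding e_def using dpp_prob_pos[OF L, of J] by (simp add: ln_ge_iff)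
    qed
    have d: "det (mat 1 + L) > 0" by (rule det_mat_1_plus_pos[OF L])
    have "e \<le> 1 / det (mat 1 + L)" using large[OF p0(2)] by (simp add: dpp_prob_def principal_minor_empty)
    then have "det (mat 1 + L) \<le> 1 / e" using d by (simp add: field_simps e_def)
    moreover have "e \<le> det L"
    proof -
      \<comment> \<open>The normalizer is at least the empty minor 1, so the lower bound on the
        probability of the full set passes to \<open>det L\<close>.\<close>
      have "principal_minor L {} \<le> det (mat 1 + L)" unfolding det_mat_1_plus
        by (rule member_le_sum) (auto intro: less_imp_le principal_minor_pos[OF L])
      then have "e \<le> e * det (mat 1 + L)" by (simp add: principal_minor_empty e_def)
      also have "\<dots> \<le> det L" using large[OF p0(3)] d by (simp add: dpp_prob_def principal_minor_UNIV pos_le_divide_eq)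
      finally show ?thesis .
    qed
    moreover have "0 \<le> x \<bullet> (L *v x)" for x using pd_matsD(2)[OF L, of x] by (cases "x = 0") auto
    ultimately show "L \<in> bounded_pd e" using pd_matsD(1)[OF L] by (simp add: bounded_pd_def)
  qed
qed

text \<open>Outside the compact set the objective is below its value at \<open>Lstar\<close>, which
  lies inside, so a maximizer over the compact set is global.\<close>

lemma maximizer_exists:
  obtains \<delta> where "\<delta> > 0" "\<And>q. norm (q - qstar) < \<delta> \<Longrightarrow> (\<And>J. 0 \<le> q $ J) \<Longrightarrow>
     \<exists>L\<in>pd_mats. \<forall>A\<in>pd_mats. mean_log_prob q A \<le> mean_log_prob q L"
proof -
  obtain \<delta> e where \<delta>: "\<delta> > 0" "e > 0"
    and B: "\<And>q L. norm (q - qstar) < \<delta> \<Longrightarrow> (\<And>J. 0 \<le> q $ J) \<Longrightarrow> L \<in> pd_mats \<Longrightarrow>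
      mean_log_prob q Lstar \<le> mean_log_prob q L \<Longrightarrow> L \<in> bounded_pd e"
    using superlevel_bounded by blast
  show ?thesis
  proof (rule that[OF \<delta>(1)])
    fix q :: "real ^ 'n set" assume near: "norm (q - qstar) < \<delta>" and q: "\<And>J. 0 \<le> q $ J"
    have Ls: "Lstar \<in> bounded_pd e" by (rule B[OF near q pd]) auto
    have sub: "bounded_pd e \<subseteq> pd_mats" by (rule bounded_pd_subset[OF \<delta>(2)])
    obtain L where L: "L \<in> bounded_pd e" "\<And>A. A \<in> bounded_pd e \<Longrightarrow> mean_log_prob q A \<le> mean_log_prob q L"
      using continuous_attains_sup[OF compact_bounded_pd[OF \<delta>(2)] _ continuous_on_subset[OF continuous_on_mean_log_prob sub]] Ls
      by blast
    have "mean_log_prob q A \<le> mean_log_prob q L" if A: "A \<in> pd_mats" for A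
    proof (cases "mean_log_prob q Lstar \<le> mean_log_prob q A")
      case True then show ?thesis using L(2) B[OF near q A] by blast
    next
      case False then show ?thesis using L(2)[OF Ls] by linarith
    qed
    then show "\<exists>L\<in>pd_mats. \<forall>A\<in>pd_mats. mean_log_prob q A \<le> mean_log_prob q L" using L(1) sub by blast
  qed
qed

text \<open>The matrices of the compact set that no sign conjugation brings
  \<open>\<eta>\<close>-close to \<open>Lstar\<close> form a compact set \<open>F\<close>, on which
  the strict Gibbs inequality leaves a uniform gap \<open>g\<close>. Replacing \<open>qstar\<close>
  by \<open>q\<close> moves the objective by at most norm (q - qstar) * b at each of the two
  matrices compared, so a distance below g / (2 * b) cannot close the gap.\<close>

lemma maximizer_near_orbit:
  assumes \<eta>: "\<eta> > 0"
  obtains \<delta> where "\<delta> > 0" "\<And>q L. norm (q - qstar) < \<delta> \<Longrightarrow> (\<And>J. 0 \<le> q $ J) \<Longrightarrow> L \<in> pd_mats \<Longrightarrow>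
     mean_log_prob q Lstar \<le> mean_log_prob q L \<Longrightarrow> \<exists>D\<in>sign_mats. norm (D ** L ** D - Lstar) < \<eta>"
proof -
  obtain \<delta>0 e where \<delta>0: "\<delta>0 > 0" "e > 0"
    and B: "\<And>q L. norm (q - qstar) < \<delta>0 \<Longrightarrow> (\<And>J. 0 \<le> q $ J) \<Longrightarrow> L \<in> pd_mats \<Longrightarrow>
      mean_log_prob q Lstar \<le> mean_log_prob q L \<Longrightarrow> L \<in> bounded_pd e"
    using superlevel_bounded by blast
  let ?K = "bounded_pd e :: (real ^ 'n ^ 'n) set"
  have sub: "?K \<subseteq> pd_mats" by (rule bounded_pd_subset[OF \<delta>0(2)])
  have cont: "continuous_on UNIV (\<lambda>L :: real ^ 'n ^ 'n. norm (D ** L ** D - Lstar))" for D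
    unfolding matrix_matrix_mult_def by (intro continuous_intros)
  define F where "F = {L \<in> ?K. \<forall>D\<in>sign_mats. \<eta> \<le> norm (D ** L ** D - Lstar)}"
  have "F = ?K \<inter> (\<Inter>D\<in>sign_mats. {L. \<eta> \<le> norm (D ** L ** D - Lstar)})" by (auto simp: F_def)
  moreover have "closed (\<Inter>D\<in>sign_mats. {L. \<eta> \<le> norm (D ** L ** D - Lstar)})"
    by (intro closed_INT ballI closed_Collect_le cont continuous_intros)
  ultimately have cF: "compact F" using compact_Int_closed[OF compact_bounded_pd[OF \<delta>0(2)]] by simp
  have strict: "mean_log_prob qstar L < mean_log_prob qstar Lstar" if L: "L \<in> F" for L
  proof (rule gibbs_strict)
    show "L \<in> pd_mats" using L sub by (auto simp: F_def)
    fix D :: "real ^ 'n ^ 'n" assume D: "D \<in> sign_mats"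
    show "L \<noteq> D ** Lstar ** D"
    proof
      assume eq: "L = D ** Lstar ** D"
      have "D ** L ** D = Lstar"
        unfolding vec_eq_iff sign_mats_mult(1)[OF D] eq
        using sign_mats_mult(2)[OF D] by (simp add: mult.assoc mult.left_commute)
      then show False using L D \<eta> by (auto simp: F_def)
    qed
  qed
  obtain g where g: "g > 0" "\<And>L. L \<in> F \<Longrightarrow> mean_log_prob qstar L + g \<le> mean_log_prob qstar Lstar"
  proof (cases "F = {}")
    case True then show ?thesis using that[of 1] by simp
  next
    case False
    have "F \<subseteq> pd_mats" using sub by (auto simp: F_def)
    then obtain L0 where L0: "L0 \<in> F" "\<And>L. L \<in> F \<Longrightarrow> mean_log_prob qstar L \<le> mean_log_prob qstar L0"
      using continuous_attains_sup[OF cF False continuous_on_subset[OF continuous_on_mean_log_prob]] by blast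
    show ?thesis
      by (rule that[of "mean_log_prob qstar Lstar - mean_log_prob qstar L0"]) (use L0 strict in force)+
  qed
  have "continuous_on ?K (\<lambda>L. \<Sum>J\<in>UNIV. \<bar>ln (dpp_prob L J)\<bar>)"
    by (rule continuous_on_subset[OF _ sub], intro continuous_intros continuous_on_dpp_prob)
      (auto simp: less_imp_neq[OF dpp_prob_pos, symmetric])
  then have "bounded ((\<lambda>L. \<Sum>J\<in>UNIV. \<bar>ln (dpp_prob L J)\<bar>) ` ?K)"
    by (intro compact_imp_bounded compact_continuous_image compact_bounded_pd[OF \<delta>0(2)])
  then obtain b where b: "b > 0" "\<And>L. L \<in> ?K \<Longrightarrow> (\<Sum>J\<in>UNIV. \<bar>ln (dpp_prob L J)\<bar>) \<le> b"
    unfolding bounded_pos by auto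
  have diff: "\<bar>mean_log_prob q L - mean_log_prob qstar L\<bar> \<le> norm (q - qstar) * b" if "L \<in> ?K" for q L
  proof -
    have "mean_log_prob q L - mean_log_prob qstar L = (\<Sum>J\<in>UNIV. (q - qstar) $ J * ln (dpp_prob L J))"
      by (simp add: mean_log_prob_def sum_subtractf left_diff_distrib)
    also have "\<bar>\<dots>\<bar> \<le> (\<Sum>J\<in>UNIV. norm (q - qstar) * \<bar>ln (dpp_prob L J)\<bar>)"
      by (rule order_trans[OF sum_abs sum_mono]) (simp only: abs_mult, intro mult_right_mono component_le_norm_cart abs_ge_zero)
    also have "\<dots> \<le> norm (q - qstar) * b" using b(2)[OF that] by (simp add: sum_distrib_left[symmetric] mult_left_mono)
    finally show ?thesis .
  qed
  show ?thesis
  proof (rule that[of "min \<delta>0 (g / (2 * b))"])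
    show "min \<delta>0 (g / (2 * b)) > 0" using \<delta>0 g b by simp
    fix q :: "real ^ 'n set" and L
    assume near: "norm (q - qstar) < min \<delta>0 (g / (2 * b))" and q: "\<And>J. 0 \<le> q $ J"
      and L: "L \<in> pd_mats" and le: "mean_log_prob q Lstar \<le> mean_log_prob q L"
    have near': "norm (q - qstar) < \<delta>0" using near by simp
    have LK: "L \<in> ?K" by (rule B[OF near' q L le])
    have LsK: "Lstar \<in> ?K" by (rule B[OF near' q pd]) auto
    have small: "norm (q - qstar) * b < g / 2" using near b by (simp add: pos_less_divide_eq mult_ac)
    show "\<exists>D\<in>sign_mats. norm (D ** L ** D - Lstar) < \<eta>"
    proof (rule ccontr)
      assume "\<not> ?thesis"
      then have "L \<in> F" using LK by (force simp: F_def)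
      then show False using g(2)[of L] diff[OF LK, of q] diff[OF LsK, of q] small le by linarith
    qed
  qed
qed

text \<open>The best alignment \<open>D0\<close> does at least as well as the one supplied by
  consistency, so the aligned matrix lies within the radius \<open>\<delta>1\<close> of the
  expansion; being a sign conjugate of a maximizer, it solves the score equation.\<close>

lemma mle_expansion:
  assumes \<epsilon>: "\<epsilon> > 0"
  obtains \<delta> where "\<delta> > 0"
    "\<And>q. norm (q - qstar) < \<delta> \<Longrightarrow> (\<And>J. 0 \<le> q $ J) \<Longrightarrow>
      \<exists>L\<in>pd_mats. \<forall>A\<in>pd_mats. mean_log_prob q A \<le> mean_log_prob q L"
    "\<And>q L D0. norm (q - qstar) < \<delta> \<Longrightarrow> (\<And>J. 0 \<le> q $ J) \<Longrightarrow> L \<in> pd_mats \<Longrightarrow>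
      (\<And>A. A \<in> pd_mats \<Longrightarrow> mean_log_prob q A \<le> mean_log_prob q L) \<Longrightarrow> D0 \<in> sign_mats \<Longrightarrow>
      (\<And>D. D \<in> sign_mats \<Longrightarrow> norm (D0 ** L ** D0 - Lstar) \<le> norm (D ** L ** D - Lstar)) \<Longrightarrow>
      norm (D0 ** L ** D0 - Lstar - influence q) \<le> \<epsilon> * norm (q - qstar)"
proof -
  obtain \<delta>1 where \<delta>1: "\<delta>1 > 0" "\<And>q L. L \<in> pd_mats \<Longrightarrow> norm (L - Lstar) < \<delta>1 \<Longrightarrow> (\<Sum>J\<in>UNIV. q $ J *\<^sub>R score L J) = 0 \<Longrightarrow>
    norm (L - Lstar - influence q) \<le> \<epsilon> * norm (q - qstar)"
    using score_equation_expansion[OF \<epsilon>] by blast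
  obtain \<delta>2 where \<delta>2: "\<delta>2 > 0" "\<And>q L. norm (q - qstar) < \<delta>2 \<Longrightarrow> (\<And>J. 0 \<le> q $ J) \<Longrightarrow> L \<in> pd_mats \<Longrightarrow>
     mean_log_prob q Lstar \<le> mean_log_prob q L \<Longrightarrow> \<exists>D\<in>sign_mats. norm (D ** L ** D - Lstar) < \<delta>1"
    using maximizer_near_orbit[OF \<delta>1(1)] by blast
  obtain \<delta>3 where \<delta>3: "\<delta>3 > 0" "\<And>q. norm (q - qstar) < \<delta>3 \<Longrightarrow> (\<And>J. 0 \<le> q $ J) \<Longrightarrow>
     \<exists>L\<in>pd_mats. \<forall>A\<in>pd_mats. mean_log_prob q A \<le> mean_log_prob q L"
    using maximizer_exists by blast
  show ?thesis
  proof (rule that[of "min \<delta>2 \<delta>3"])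
    show "min \<delta>2 \<delta>3 > 0" using \<delta>2 \<delta>3 by simp
    show "\<exists>L\<in>pd_mats. \<forall>A\<in>pd_mats. mean_log_prob q A \<le> mean_log_prob q L"
      if "norm (q - qstar) < min \<delta>2 \<delta>3" "\<And>J. 0 \<le> q $ J" for q
      using \<delta>3(2)[of q] that by simp
    fix q :: "real ^ 'n set" and L D0 :: "real ^ 'n ^ 'n"
    assume near: "norm (q - qstar) < min \<delta>2 \<delta>3" and q: "\<And>J. 0 \<le> q $ J" and L: "L \<in> pd_mats"
      and max: "\<And>A. A \<in> pd_mats \<Longrightarrow> mean_log_prob q A \<le> mean_log_prob q L" and D0: "D0 \<in> sign_mats"
      and min: "\<And>D. D \<in> sign_mats \<Longrightarrow> norm (D0 ** L ** D0 - Lstar) \<le> norm (D ** L ** D - Lstar)"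
    have "norm (q - qstar) < \<delta>2" using near by simp
    from \<delta>2(2)[OF this q L max[OF pd]] obtain D where "D \<in> sign_mats" "norm (D ** L ** D - Lstar) < \<delta>1" by blast
    then have "norm (D0 ** L ** D0 - Lstar) < \<delta>1" using min[of D] by linarith
    moreover have pd0: "D0 ** L ** D0 \<in> pd_mats" by (rule pd_mats_sign_conj[OF D0 L])
    moreover have "(\<Sum>J\<in>UNIV. q $ J *\<^sub>R score (D0 ** L ** D0) J) = 0"
    proof (rule maximizer_score_eq[OF pd0])
      fix A :: "real ^ 'n ^ 'n" assume "A \<in> pd_mats"
      then show "mean_log_prob q A \<le> mean_log_prob q (D0 ** L ** D0)"
        using max[of A] by (simp add: mean_log_prob_def dpp_prob_sign_conj[OF D0])
    qed
    ultimately show "norm (D0 ** L ** D0 - Lstar - influence q) \<le> \<epsilon> * norm (q - qstar)"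
      by (intro \<delta>1(2))
  qed
qed

end

section \<open>Empirical frequencies and the limit law\<close>

lemma borel_measurable_matrix_mult:
  fixes f g :: "'a \<Rightarrow> real ^ 'n ^ 'n"
  assumes "f \<in> borel_measurable M" "g \<in> borel_measurable M"
  shows "(\<lambda>\<omega>. f \<omega> ** g \<omega>) \<in> borel_measurable M"
  by (rule borel_measurable_continuous_Pair[OF assms])
    (unfold matrix_matrix_mult_def, intro continuous_intros)

definition empirical_freq :: "nat \<Rightarrow> (nat \<Rightarrow> 'n::finite set) \<Rightarrow> real ^ 'n set" where
  "empirical_freq n z = (\<Sum>i<n. axis (z i) 1) /\<^sub>R real n"

lemma empirical_freq_nonneg: "0 \<le> empirical_freq n z $ J"
  by (simp add: empirical_freq_def axis_def sum_nonneg)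

lemma sum_empirical_freq:
  fixes f :: "'n::finite set \<Rightarrow> 'b::real_vector"
  shows "(\<Sum>J\<in>UNIV. empirical_freq n z $ J *\<^sub>R f J) = (\<Sum>i<n. f (z i)) /\<^sub>R real n"
proof -
  have "(\<Sum>J\<in>UNIV. empirical_freq n z $ J *\<^sub>R f J) = (\<Sum>J\<in>UNIV. \<Sum>i<n. inverse (real n) *\<^sub>R ((if J = z i then 1 else 0) *\<^sub>R f J))"
    by (simp add: empirical_freq_def axis_def scaleR_sum_left scaleR_sum_right sum_distrib_left)
  also have "\<dots> = (\<Sum>i<n. inverse (real n) *\<^sub>R (\<Sum>J\<in>UNIV. (if J = z i then 1 else 0) *\<^sub>R f J))"
    by (subst sum.swap) (simp add: scaleR_sum_right)
  also have "\<dots> = (\<Sum>i<n. f (z i)) /\<^sub>R real n"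
    by (simp add: if_distrib[of "\<lambda>x. x *\<^sub>R _"] scaleR_sum_right cong: if_cong)
  finally show ?thesis .
qed

lemma log_likelihood_eq: "log_likelihood n z L = mean_log_prob (empirical_freq n z) L"
  using sum_empirical_freq[of n z "\<lambda>J. ln (dpp_prob L J)"]
  by (simp add: log_likelihood_def mean_log_prob_def divide_inverse)

lemma is_max_likelihood_iff:
  "is_max_likelihood n z L \<longleftrightarrow> L \<in> pd_mats \<and>
     (\<forall>A\<in>pd_mats. mean_log_prob (empirical_freq n z) A \<le> mean_log_prob (empirical_freq n z) L)"
  by (auto simp: is_max_likelihood_def is_arg_max_def log_likelihood_eq[abs_def] not_less)

theorem theorem7:
  fixes M :: "'a measure"
    and Lstar :: "real ^ 'n ^ 'n"
    and Z :: "nat \<Rightarrow> 'a \<Rightarrow> 'n set"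
    and Lhat Dhat Ltilde :: "nat \<Rightarrow> 'a \<Rightarrow> real ^ 'n ^ 'n"
  assumes "prob_space M"
    and "Lstar \<in> pd_mats"
    and "irreducible_mat Lstar"
    and "prob_space.indep_vars M (\<lambda>_. count_space UNIV) Z UNIV"
    and "\<And>i. distr M (count_space UNIV) (Z i) = DPP Lstar"
    and "\<And>n. n \<ge> 1 \<Longrightarrow> is_MLE M Z n (Lhat n)"
    and "\<And>n. n \<ge> 1 \<Longrightarrow> Dhat n \<in> borel_measurable M"
    and "\<And>n \<omega>. n \<ge> 1 \<Longrightarrow> \<omega> \<in> space M \<Longrightarrow> Dhat n \<omega> \<in> sign_mats"
    and "\<And>n \<omega>. n \<ge> 1 \<Longrightarrow> \<omega> \<in> space M \<Longrightarrow>
           norm (Dhat n \<omega> ** Lhat n \<omega> ** Dhat n \<omega> - Lstar) =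
           Min ((\<lambda>D. norm (D ** Lhat n \<omega> ** D - Lstar)) ` sign_mats)"
    and "\<And>n \<omega>. n \<ge> 1 \<Longrightarrow> \<omega> \<in> space M \<Longrightarrow>
           Ltilde n \<omega> = Dhat n \<omega> ** Lhat n \<omega> ** Dhat n \<omega>"
  shows "\<exists>\<mu>. is_sym_normal 0 (asymptotic_covariance Lstar) \<mu> \<and>
             converges_in_distribution M
               (\<lambda>n \<omega>. sqrt (real n) *\<^sub>R (Ltilde n \<omega> - Lstar)) \<mu>"
proof -
  note mle = assms(6) and D_meas = assms(7) and D_sign = assms(8) and D_min = assms(9) and Lt = assms(10)
  interpret dpp_model Lstar using assms(2,3) by unfold_locales
  interpret prob_space M by fact
  interpret iid_finite M Z pr
    using assms(4,5) dpp_prob_pos[OF assms(2)] by unfold_locales (auto simp: DPP_def less_imp_le)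
  define a where "a = (\<lambda>J. fisher_inv (sc J))"
  have mean_a: "(\<Sum>J\<in>UNIV. pr J *\<^sub>R a J) = 0"
  proof -
    have "(\<Sum>J\<in>UNIV. pr J *\<^sub>R a J) = fisher_inv (\<Sum>J\<in>UNIV. pr J *\<^sub>R sc J)"
      by (simp add: a_def linear_sum[OF fisher_inv(1)] linear_cmul[OF fisher_inv(1)])
    then show ?thesis by (simp add: sum_prob_score[OF pd] linear_0[OF fisher_inv(1)])
  qed
  have a_sym: "a J \<in> sym_mats" for J by (simp add: a_def fisher_inv(2) score_in_sym)
  \<comment> \<open>The weights sqrt (pr J) give the inner product with \<open>t\<close> the
    variance of a single summand \<open>t \<bullet> a (Z i \<omega>)\<close>.\<close>
  obtain \<mu> where \<mu>: "prob_space \<mu>" "sets \<mu> = sets borel"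
    "\<And>S. subspace S \<Longrightarrow> closed S \<Longrightarrow> range (\<lambda>J. sqrt (pr J) *\<^sub>R a J) \<subseteq> S \<Longrightarrow> AE x in \<mu>. x \<in> S"
    "\<And>t. distr \<mu> borel (\<lambda>x. t \<bullet> x) = gaussian_law 0 (\<Sum>J\<in>UNIV. (t \<bullet> (sqrt (pr J) *\<^sub>R a J))\<^sup>2)"
    using gaussian_vector_exists[of "\<lambda>J. sqrt (pr J) *\<^sub>R a J"] by blast
  have law: "distr \<mu> borel (\<lambda>x. t \<bullet> x) = gaussian_law 0 (\<Sum>J\<in>UNIV. pr J * (t \<bullet> a J)\<^sup>2)" for t
    unfolding \<mu>(4) using pr_nonneg by (simp add: power_mult_distrib)
  have "is_sym_normal 0 (asymptotic_covariance Lstar) \<mu>"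
    unfolding is_sym_normal_def
  proof (intro conjI ballI)
    show "0 \<in> sym_mats" by (rule subspace_0[OF subspace_sym_mats])
    show "AE A in \<mu>. A \<in> sym_mats"
      by (rule \<mu>(3)) (auto intro: subspace_sym_mats closed_subspace subspace_scale a_sym)
    fix H :: "real ^ 'n ^ 'n" assume H: "H \<in> sym_mats"
    have "distr \<mu> borel (\<lambda>A. trace (A ** H)) = distr \<mu> borel (\<lambda>A. H \<bullet> A)" "trace (0 ** H) = 0"
      unfolding trace_mult_sym[OF H] by (simp_all add: inner_commute)
    then show "distr \<mu> borel (\<lambda>A. trace (A ** H)) = gaussian_law (trace (0 ** H)) (asymptotic_covariance Lstar H H)"
      by (simp only: law asymptotic_covariance_eq[OF H] fisher_inv_quadratic[OF H] a_def)
  qed (use \<mu> pos_def_asymptotic_covariance in auto)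
  moreover have "converges_in_distribution M (\<lambda>n \<omega>. sqrt (real n) *\<^sub>R (Ltilde n \<omega> - Lstar)) \<mu>"
  proof (rule clt_remainder[OF mean_a \<mu>(1,2) law])
    show "(\<lambda>\<omega>. sqrt (real n) *\<^sub>R (Ltilde n \<omega> - Lstar)) \<in> borel_measurable M" if n: "n \<ge> 1" for n
    proof -
      have "Lhat n \<in> borel_measurable M" using mle[OF n] by (simp add: is_MLE_def)
      then have "(\<lambda>\<omega>. Dhat n \<omega> ** Lhat n \<omega> ** Dhat n \<omega>) \<in> borel_measurable M"
        by (intro borel_measurable_matrix_mult D_meas[OF n])
      then have "Ltilde n \<in> borel_measurable M"
        using Lt[OF n] by (subst measurable_cong) auto
      then show ?thesis by measurable
    qed
    fix r e :: real assume r: "0 < r" and e: "0 < e"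
    \<comment> \<open>Centred indicators, whose sample mean is \<open>q - qstar\<close>.\<close>
    define b :: "'n set \<Rightarrow> real ^ 'n set" where "b = (\<lambda>J. axis J 1 - qstar)"
    define V where "V = (\<Sum>J\<in>UNIV. pr J * (norm (b J))\<^sup>2)"
    have V: "V \<ge> 0" unfolding V_def by (intro sum_nonneg mult_nonneg_nonneg pr_nonneg) simp
    have mean_b: "(\<Sum>J\<in>UNIV. pr J *\<^sub>R b J) = 0"
      by (simp add: b_def scaleR_diff_right sum_subtractf scaleR_sum_left[symmetric] pr_sum)
        (simp add: vec_eq_iff axis_def if_distrib cong: if_cong)
    \<comment> \<open>Chosen so that the Chebyshev bound for the remainder, V * \<epsilon>^2 / r^2,
      is at most e / 2.\<close>
    define \<epsilon> where "\<epsilon> = r * sqrt (e / (2 * (V + 1)))"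
    have \<epsilon>: "\<epsilon> > 0" using r e V by (simp add: \<epsilon>_def)
    have \<epsilon>2: "V * \<epsilon>\<^sup>2 / r\<^sup>2 \<le> e / 2"
    proof -
      have "V * \<epsilon>\<^sup>2 / r\<^sup>2 = V * (e / (2 * (V + 1)))" using r e V by (simp add: \<epsilon>_def power_mult_distrib)
      also have "\<dots> \<le> e / 2" using e V by (simp add: field_simps)
      finally show ?thesis .
    qed
    obtain \<delta> where \<delta>: "\<delta> > 0"
      and ex: "\<And>q. norm (q - qstar) < \<delta> \<Longrightarrow> (\<And>J. 0 \<le> q $ J) \<Longrightarrow>
        \<exists>L\<in>pd_mats. \<forall>A\<in>pd_mats. mean_log_prob q A \<le> mean_log_prob q L"
      and expand: "\<And>q L D0. norm (q - qstar) < \<delta> \<Longrightarrow> (\<And>J. 0 \<le> q $ J) \<Longrightarrow> L \<in> pd_mats \<Longrightarrow>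
        (\<And>A. A \<in> pd_mats \<Longrightarrow> mean_log_prob q A \<le> mean_log_prob q L) \<Longrightarrow> D0 \<in> sign_mats \<Longrightarrow>
        (\<And>D. D \<in> sign_mats \<Longrightarrow> norm (D0 ** L ** D0 - Lstar) \<le> norm (D ** L ** D - Lstar)) \<Longrightarrow>
        norm (D0 ** L ** D0 - Lstar - influence q) \<le> \<epsilon> * norm (q - qstar)"
      using mle_expansion[OF \<epsilon>] by metis
    \<comment> \<open>From \<open>n0\<close> on, the Chebyshev bound V / (n * \<delta>^2) for
      leaving the ball around \<open>qstar\<close> is at most e / 2.\<close>
    obtain n0 :: nat where n0: "2 * V / (\<delta>\<^sup>2 * e) \<le> real n0" using real_arch_simple by blast
    show "\<forall>\<^sub>F n in sequentially. prob {\<omega>\<in>space M. norm (sqrt (real n) *\<^sub>R (Ltilde n \<omega> - Lstar) - (\<Sum>i<n. a (Z i \<omega>)) /\<^sub>R sqrt (real n)) > r} \<le> e"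
      using eventually_ge_at_top[of "max 1 n0"]
    proof eventually_elim
      case (elim n)
      then have n: "n \<ge> 1" "n0 \<le> n" by auto
      let ?B = "\<lambda>c. {\<omega>\<in>space M. norm (\<Sum>i<n. b (Z i \<omega>)) \<ge> c}"
      \<comment> \<open>Either \<open>q\<close> is outside the ball, where a maximizer may fail to
        exist and \<open>Lhat\<close> is then arbitrary, or the expansion holds and a remainder
        above \<open>r\<close> forces the sum of the \<open>b (Z i \<omega>)\<close> to be
        large.\<close>
      have "{\<omega>\<in>space M. norm (sqrt (real n) *\<^sub>R (Ltilde n \<omega> - Lstar) - (\<Sum>i<n. a (Z i \<omega>)) /\<^sub>R sqrt (real n)) > r}
          \<subseteq> ?B (real n * \<delta>) \<union> ?B (sqrt (real n) * r / \<epsilon>)"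
      proof
        fix \<omega> assume "\<omega> \<in> {\<omega>\<in>space M. norm (sqrt (real n) *\<^sub>R (Ltilde n \<omega> - Lstar) - (\<Sum>i<n. a (Z i \<omega>)) /\<^sub>R sqrt (real n)) > r}"
        then have \<omega>: "\<omega> \<in> space M" and big: "norm (sqrt (real n) *\<^sub>R (Ltilde n \<omega> - Lstar) - (\<Sum>i<n. a (Z i \<omega>)) /\<^sub>R sqrt (real n)) > r" by auto
        define q where "q = empirical_freq n (\<lambda>i. Z i \<omega>)"
        have q0: "0 \<le> q $ J" for J by (simp add: q_def empirical_freq_nonneg)
        have dq: "q - qstar = (\<Sum>i<n. b (Z i \<omega>)) /\<^sub>R real n"
          using n(1) by (simp add: q_def empirical_freq_def b_def sum_subtractf scaleR_diff_right sum_constant_scaleR del: sum_constant)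
        have infl: "influence q = (\<Sum>i<n. a (Z i \<omega>)) /\<^sub>R real n"
        proof -
          have "(\<Sum>J\<in>UNIV. (q $ J - pr J) *\<^sub>R sc J) = (\<Sum>i<n. sc (Z i \<omega>)) /\<^sub>R real n"
            by (simp add: scaleR_diff_left sum_subtractf sum_prob_score[OF pd] q_def sum_empirical_freq)
          then show ?thesis
            by (simp add: influence_def a_def linear_cmul[OF fisher_inv(1)] linear_sum[OF fisher_inv(1)])
        qed
        show "\<omega> \<in> ?B (real n * \<delta>) \<union> ?B (sqrt (real n) * r / \<epsilon>)"
        proof (cases "norm (q - qstar) < \<delta>")
          case False
          then show ?thesis using \<omega> n(1) by (simp add: dq field_simps)
        next
          case True
          obtain L where "is_max_likelihood n (\<lambda>i. Z i \<omega>) L"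
            using ex[OF True q0] unfolding is_max_likelihood_iff q_def by blast
          then have "is_max_likelihood n (\<lambda>i. Z i \<omega>) (Lhat n \<omega>)"
            using mle[OF n(1)] \<omega> unfolding is_MLE_def by blast
          then have max: "Lhat n \<omega> \<in> pd_mats" "\<And>A. A \<in> pd_mats \<Longrightarrow> mean_log_prob q A \<le> mean_log_prob q (Lhat n \<omega>)"
            unfolding is_max_likelihood_iff q_def by auto
          have "norm (Dhat n \<omega> ** Lhat n \<omega> ** Dhat n \<omega> - Lstar) \<le> norm (D ** Lhat n \<omega> ** D - Lstar)" if "D \<in> sign_mats" for D
            unfolding D_min[OF n(1) \<omega>] using that finite_sign_mats by (intro Min_le) auto
          from expand[OF True q0 max D_sign[OF n(1) \<omega>] this]
          have close: "norm (Ltilde n \<omega> - Lstar - influence q) \<le> \<epsilon> * norm (q - qstar)" by (simp add: Lt[OF n(1) \<omega>])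
          have sq: "sqrt (real n) / real n = 1 / sqrt (real n)"
            using n(1) real_div_sqrt[of "real n"] by (simp add: field_simps)
          have "sqrt (real n) *\<^sub>R (Ltilde n \<omega> - Lstar) - (\<Sum>i<n. a (Z i \<omega>)) /\<^sub>R sqrt (real n)
              = sqrt (real n) *\<^sub>R (Ltilde n \<omega> - Lstar - influence q)"
            unfolding infl using sq by (simp add: scaleR_diff_right inverse_eq_divide)
          then have "r < sqrt (real n) * norm (Ltilde n \<omega> - Lstar - influence q)" using big by simp
          also have "\<dots> \<le> sqrt (real n) * (\<epsilon> * norm (q - qstar))" using close by (intro mult_left_mono) auto
          also have "norm (q - qstar) = norm (\<Sum>i<n. b (Z i \<omega>)) / real n" unfolding dq by (simp add: divide_inverse mult.commute)
          also have "sqrt (real n) * (\<epsilon> * (norm (\<Sum>i<n. b (Z i \<omega>)) / real n)) = \<epsilon> * norm (\<Sum>i<n. b (Z i \<omega>)) * (sqrt (real n) / real n)"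
            by simp
          finally have "r < \<epsilon> * norm (\<Sum>i<n. b (Z i \<omega>)) / sqrt (real n)" unfolding sq by simp
          then have "sqrt (real n) * r / \<epsilon> \<le> norm (\<Sum>i<n. b (Z i \<omega>))"
            using n(1) \<epsilon> by (simp add: field_simps)
          then show ?thesis using \<omega> by simp
        qed
      qed
      then have "prob {\<omega>\<in>space M. norm (sqrt (real n) *\<^sub>R (Ltilde n \<omega> - Lstar) - (\<Sum>i<n. a (Z i \<omega>)) /\<^sub>R sqrt (real n)) > r}
          \<le> prob (?B (real n * \<delta>) \<union> ?B (sqrt (real n) * r / \<epsilon>))"
        by (intro finite_measure_mono) measurable
      also have "\<dots> \<le> prob (?B (real n * \<delta>)) + prob (?B (sqrt (real n) * r / \<epsilon>))"
        by (intro measure_Un_le) measurable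
      also have "\<dots> \<le> real n * V / (real n * \<delta>)\<^sup>2 + real n * V / (sqrt (real n) * r / \<epsilon>)\<^sup>2"
        unfolding V_def by (intro add_mono tail_sum_le[OF mean_b]) (use n(1) \<delta> r \<epsilon> in auto)
      also have "real n * V / (sqrt (real n) * r / \<epsilon>)\<^sup>2 = V * \<epsilon>\<^sup>2 / r\<^sup>2"
        using n(1) by (simp add: power_divide power_mult_distrib)
      also have "real n * V / (real n * \<delta>)\<^sup>2 \<le> e / 2"
      proof -
        have "2 * V / (\<delta>\<^sup>2 * e) \<le> real n" using n0 n(2) by linarith
        then have "2 * V \<le> real n * (\<delta>\<^sup>2 * e)" using \<delta> e by (simp add: pos_divide_le_eq)
        moreover have "real n * V / (real n * \<delta>)\<^sup>2 = V / (real n * \<delta>\<^sup>2)"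
          using n(1) by (simp add: power2_eq_square)
        ultimately show ?thesis using n(1) \<delta> by (simp add: pos_divide_le_eq mult_ac)
      qed
      finally show ?case using \<epsilon>2 by linarith
    qed
  qed
  ultimately show ?thesis by blast
qed

end
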